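(* Let $d\in\mathbb{R}\setminus\{0\}$, $\zeta,\omega,f_0\in\mathbb{R}$ and $e\in H^2(0,2\pi)$ be fixed. For $f_1\in\mathbb{R}$ consider the equation $$-d u''+\mathrm{i}\omega u'+(\zeta-\mathrm{i})u-|u|^2u+\mathrm{i}f_0+\mathrm{i}f_1e(s)=0,\qquad u\ 2\pi\text{-periodic}. \qquad ( * )$$ Let $u_0\in\mathbb{C}$ be a constant non-degenerate solution of $( * )$ for $f_1=0$. Then the maximal continuum $\mathcal{C}^+\subset[0,\infty)\times H^2_{\mathrm{per}}(0,2\pi)$ of solutions $(f_1,u)$ of $( * )$ with $(0,u_0)\in\mathcal{C}^+$ has the following properties: (i) locally near $(0,u_0)$ the set $\mathcal{C}^+$ is the graph of a smooth curve $f_1\mapsto(f_1,u(f_1))$; (ii) $\mathcal{C}^+\cap\big([0,M]\times H^2_{\mathrm{per}}(0,2\pi)\big)$ is bounded for every $M>0$. Moreover, if $\operatorname{pr}_1(\mathcal{C}^+)$ denotes the projection of $\mathcal{C}^+$ onto the $f_1$-component, then at least one of the following holds: (a) $\operatorname{pr}_1(\mathcal{C}^+)=[0,\infty)$; (b) there exists $u_0^+\neq u_0$ with $(0,u_0^+)\in\mathcal{C}^+$. A maximal continuum $\mathcal{C}^-\subset(-\infty,0]\times H^2_{\mathrm{per}}(0,2\pi)$ of solutions of $( * )$ containing $(0,u_0)$ with the corresponding properties (with $[0,M]$ replaced by $[-M,0]$ and $[0,\infty)$ replaced by $(-\infty,0]$) also exists.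
   Context: All functions are complex valued and function spaces are regarded as vector spaces over $\mathbb{R}$. $H^2(0,2\pi)$ is the usual Sobolev space; $e\in H^2(0,2\pi)$ is regarded as extended $2\pi$-periodically to $\mathbb{R}$ (not necessarily continuously). $H^2_{\mathrm{per}}(0,2\pi)$ is the space of locally square-integrable $2\pi$-periodic functions on $\mathbb{R}$ whose weak derivatives on $\mathbb{R}$ up to order $2$ are locally square-integrable, with the norm $\big(\sum_{j=0}^2\|u^{(j)}\|_{L^2(0,2\pi)}^2\big)^{1/2}$. A solution $(f_1,u)$ of $( * )$ is a pair in $\mathbb{R}\times H^2_{\mathrm{per}}(0,2\pi)$ satisfying $( * )$. A continuum is a closed and connected set; the maximal continuum containing a point is the largest one (with respect to inclusion) in the indicated set that consists of solutions and contains the point. A solution $u\in H^2_{\mathrm{per}}(0,2\pi)$ of $( * )$ for $f_1=0$ is called non-degenerate if the kernel of the ($\mathbb{R}$-linear) operator $L_u\varphi=-d\varphi''+\mathrm{i}\omega\varphi'+(\zeta-\mathrm{i}-2|u|^2)\varphi-u^2\overline{\varphi}$, $\varphi\in H^2_{\mathrm{per}}(0,2\pi)$, equals $\operatorname{span}_{\mathbb{R}}\{u'\}$. (For constant $u=u_0$ this means that $L_{u_0}$ is injective.) *)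

theory Defs
  imports "HOL-Computational_Algebra.Polynomial" "HOL-Analysis.Analysis"
begin

section \<open>Weak derivatives and Sobolev spaces\<close>

definition square_integrable :: "real set \<Rightarrow> (real \<Rightarrow> complex) \<Rightarrow> bool" where
  "square_integrable S u \<longleftrightarrow>
     u \<in> borel_measurable (lebesgue_on S) \<and> integrable (lebesgue_on S) (\<lambda>x. (cmod (u x))\<^sup>2)"

definition locally_square_integrable :: "(real \<Rightarrow> complex) \<Rightarrow> bool" where
  "locally_square_integrable u \<longleftrightarrow> (\<forall>a b. square_integrable {a..b} u)"

definition test_functions :: "real set \<Rightarrow> (real \<Rightarrow> real) set" where
  "test_functions S =
     {\<phi>. (\<forall>n x. (deriv ^^ n) \<phi> differentiable at x) \<and>
         compact (closure {x. \<phi> x \<noteq> 0}) \<and> closure {x. \<phi> x \<noteq> 0} \<subseteq> S}"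

definition has_weak_deriv_on ::
    "real set \<Rightarrow> nat \<Rightarrow> (real \<Rightarrow> complex) \<Rightarrow> (real \<Rightarrow> complex) \<Rightarrow> bool" where
  "has_weak_deriv_on S k u v \<longleftrightarrow>
     (\<forall>\<phi>\<in>test_functions S.
        (LINT x|lebesgue_on S. (deriv ^^ k) \<phi> x *\<^sub>R u x) =
        (-1) ^ k * (LINT x|lebesgue_on S. \<phi> x *\<^sub>R v x))"

text \<open>Representatives of elements of \<open>H\<^sup>2(0,2\<pi>)\<close>; values outside \<open>(0,2\<pi>)\<close> are irrelevant.\<close>

definition H2_funs :: "(real \<Rightarrow> complex) set" where
  "H2_funs = {u. square_integrable {0<..<2*pi} u \<and>
     (\<forall>k\<in>{1,2}. \<exists>v. square_integrable {0<..<2*pi} v \<and> has_weak_deriv_on {0<..<2*pi} k u v)}"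

text \<open>Representatives of elements of \<open>H\<^sup>2\<^sub>p\<^sub>e\<^sub>r(0,2\<pi>)\<close>; the weak derivatives are taken on the whole line.\<close>

definition H2per_funs :: "(real \<Rightarrow> complex) set" where
  "H2per_funs = {u. (\<forall>x. u (x + 2*pi) = u x) \<and> locally_square_integrable u \<and>
     (\<forall>k\<in>{1,2}. \<exists>v. locally_square_integrable v \<and> has_weak_deriv_on UNIV k u v)}"


section \<open>Test functions and uniqueness of weak derivatives\<close>

definition bump :: "real \<Rightarrow> real \<Rightarrow> real \<Rightarrow> real poly \<Rightarrow> nat \<Rightarrow> real \<Rightarrow> real" where
  "bump a b c p k x = (if (x - a) * (b - x) > 0
     then poly p x / ((x - a) * (b - x)) ^ k * exp (- 1 / (c * ((x - a) * (b - x)))) else 0)"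

lemma exp_minus_inverse_le:
  fixes y :: real
  assumes "y > 0"
  shows "exp (- 1 / y) \<le> fact m * y ^ m"
proof -
  have "(1 / y) ^ m / fact m \<le> (\<Sum>k\<in>{m}. (1/y) ^ k / fact k)" by simp
  also have "\<dots> \<le> (\<Sum>k<Suc m. (1/y) ^ k / fact k)"
    by (rule sum_mono2) (use assms in auto)
  also have "\<dots> \<le> exp (1 / y)"
  proof -
    have "(\<lambda>n. (1/y) ^ n /\<^sub>R fact n) sums exp (1 / y)" by (rule exp_converges)
    then have s: "(\<lambda>n. (1/y) ^ n / fact n) sums exp (1 / y)" by (simp add: field_simps)
    show ?thesis
      using sum_le_suminf[OF sums_summable[OF s], of "{..<Suc m}"] sums_unique[OF s] assms by auto
  qed
  finally have "(1 / y) ^ m / fact m \<le> exp (1 / y)" .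
  then have "inverse (exp (1/y)) \<le> inverse ((1 / y) ^ m / fact m)"
    by (rule le_imp_inverse_le) (use assms in auto)
  then show ?thesis using assms by (simp add: exp_minus field_simps)
qed

lemma bump_has_derivative:
  assumes "a < b" "c > 0"
  defines "w \<equiv> [:- a * b, a + b, - 1:]"
  shows "(bump a b c p k has_real_derivative
           bump a b c (pderiv p * w\<^sup>2 - smult (real k) (p * pderiv w * w) + smult (1 / c) (p * pderiv w))
             (k + 2) x) (at x)"
proof -
  have w: "poly w x = (x - a) * (b - x)" for x
    by (simp add: w_def algebra_simps)
  let ?q = "pderiv p * w\<^sup>2 - smult (real k) (p * pderiv w * w) + smult (1 / c) (p * pderiv w)"
  have ow: "open {x. poly w x > 0}" "open {x. poly w x < 0}"
    by (auto intro!: open_Collect_less continuous_intros)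
  consider "poly w x > 0" | "poly w x < 0" | "poly w x = 0" by linarith
  then show ?thesis
  proof cases
    case 1
    have "((\<lambda>x. poly p x / poly w x ^ k * exp (- 1 / (c * poly w x))) has_real_derivative
        poly ?q x / poly w x ^ (k + 2) * exp (- 1 / (c * poly w x))) (at x)"
    proof (cases k)
      case 0
      then show ?thesis using 1 assms(2)
        by (auto intro!: derivative_eq_intros poly_DERIV simp: field_simps power2_eq_square)
    next
      case (Suc j)
      have "((\<lambda>x. poly w x ^ Suc j) has_real_derivative
          real (Suc j) * poly w x ^ j * poly (pderiv w) x) (at x)"
        using DERIV_power[OF poly_DERIV[of w x], of "Suc j"] by (simp add: mult_ac)
      then show ?thesis using 1 assms(2) unfolding Suc
        by (auto intro!: derivative_eq_intros poly_DERIV simp: field_simps power2_eq_square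
            simp del: power_Suc)
          (simp add: field_simps)
    qed
    then show ?thesis
    proof (rule has_field_derivative_transform_within_open[OF _ ow(1), THEN DERIV_cong])
      show "x \<in> {x. poly w x > 0}" using 1 by simp
    qed (use 1 in \<open>auto simp: bump_def w\<close>)
  next
    case 2
    have "((\<lambda>x. 0) has_real_derivative 0) (at x)" by simp
    then show ?thesis
    proof (rule has_field_derivative_transform_within_open[OF _ ow(2), THEN DERIV_cong])
      show "x \<in> {x. poly w x < 0}" using 2 by simp
    qed (use 2 in \<open>auto simp: bump_def w\<close>)
  next
    case 3
    then have x: "x = a \<or> x = b" by (auto simp: w)
    have 0: "bump a b c r l x = 0" for r l using x by (auto simp: bump_def)
    let ?K = "fact (k + 2) * c ^ (k + 2) * (b - a)\<^sup>2"
    have le: "\<bar>bump a b c p k y\<bar> \<le> \<bar>poly p y\<bar> * ?K * (y - x)\<^sup>2" for y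
    proof (cases "poly w y > 0")
      case True
      then have ab: "a < y" "y < b"
        using assms(1) by (auto simp: w zero_less_mult_iff)
      then have "poly w y \<le> (b - a) * \<bar>y - x\<bar>"
        using x by (auto simp: w abs_if intro!: mult_right_mono mult_left_mono)
      then have "(poly w y)\<^sup>2 \<le> ((b - a) * \<bar>y - x\<bar>)\<^sup>2"
        using True by (intro power_mono) auto
      then have w2: "(poly w y)\<^sup>2 \<le> (b - a)\<^sup>2 * (y - x)\<^sup>2" by (simp add: power_mult_distrib)
      have "exp (- 1 / (c * poly w y)) \<le> fact (k + 2) * (c * poly w y) ^ (k + 2)"
        using True assms(2) by (intro exp_minus_inverse_le) auto
      then have "exp (- 1 / (c * poly w y)) / poly w y ^ k
          \<le> (fact (k + 2) * (c * poly w y) ^ (k + 2)) / poly w y ^ k"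
        using True by (intro divide_right_mono) auto
      also have "\<dots> = fact (k + 2) * c ^ (k + 2) * (poly w y)\<^sup>2"
        using True by (simp add: power_mult_distrib power_add) (simp add: power2_eq_square)
      also have "\<dots> \<le> fact (k + 2) * c ^ (k + 2) * ((b - a)\<^sup>2 * (y - x)\<^sup>2)"
        using assms(2) w2 by (intro mult_left_mono) auto
      finally have e: "exp (- 1 / (c * poly w y)) / poly w y ^ k \<le> ?K * (y - x)\<^sup>2"
        by (simp add: mult.assoc)
      have "\<bar>bump a b c p k y\<bar> = \<bar>poly p y\<bar> * (exp (- 1 / (c * poly w y)) / poly w y ^ k)"
        using True by (simp add: bump_def w[symmetric] abs_mult)
      also have "\<dots> \<le> \<bar>poly p y\<bar> * (?K * (y - x)\<^sup>2)"
        using e by (intro mult_left_mono) auto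
      finally show ?thesis by (simp add: mult.assoc)
    next
      case False
      then show ?thesis using assms(2) by (auto simp: bump_def w[symmetric])
    qed
    have lim: "((\<lambda>y. \<bar>poly p y\<bar> * ?K * \<bar>y - x\<bar>) \<longlongrightarrow> \<bar>poly p x\<bar> * ?K * \<bar>x - x\<bar>) (at x)"
      by (intro tendsto_intros)
    have "((\<lambda>y. (bump a b c p k y - bump a b c p k x) / (y - x)) \<longlongrightarrow> 0) (at x)"
    proof (rule Lim_null_comparison)
      show "\<forall>\<^sub>F y in at x. norm ((bump a b c p k y - bump a b c p k x) / (y - x))
              \<le> \<bar>poly p y\<bar> * ?K * \<bar>y - x\<bar>"
        unfolding eventually_at_filter
      proof (intro always_eventually allI impI)
        fix y assume "y \<noteq> x"
        then show "norm ((bump a b c p k y - bump a b c p k x) / (y - x)) \<le> \<bar>poly p y\<bar> * ?K * \<bar>y - x\<bar>"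
          using le[of y] by (simp add: 0 divide_le_eq power2_eq_square mult.assoc
              abs_mult_self_eq del: power_Suc)
      qed
      show "((\<lambda>y. \<bar>poly p y\<bar> * ?K * \<bar>y - x\<bar>) \<longlongrightarrow> 0) (at x)" using lim by simp
    qed
    then show ?thesis by (simp add: has_field_derivative_iff 0)
  qed
qed

lemma bump_deriv_funpow:
  assumes "a < b" "c > 0"
  shows "\<exists>q l. (deriv ^^ n) (bump a b c p k) = bump a b c q l"
proof (induction n)
  case 0
  then show ?case by auto
next
  case (Suc n)
  then obtain q l where ql: "(deriv ^^ n) (bump a b c p k) = bump a b c q l" by blast
  show ?case
    using DERIV_imp_deriv[OF bump_has_derivative[OF assms, of q l]] by (auto simp: ql fun_eq_iff)
qed

lemma bump_in_test_functions:
  assumes "a < b" "c > 0"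
  shows "bump a b c p k \<in> test_functions UNIV"
proof -
  have sub: "{x. bump a b c p k x \<noteq> 0} \<subseteq> {a..b}"
    using assms(1) by (auto simp: bump_def zero_less_mult_iff split: if_splits)
  then have "bounded {x. bump a b c p k x \<noteq> 0}"
    by (rule bounded_subset[rotated]) simp
  moreover have "(deriv ^^ n) (bump a b c p k) differentiable at x" for n x
    using bump_deriv_funpow[OF assms, of n p k] bump_has_derivative[OF assms]
    by (metis real_differentiable_def)
  ultimately show ?thesis
    by (auto simp: test_functions_def)
qed

lemma bump_tendsto_indicator:
  assumes "a < b"
  shows "(\<lambda>n. bump a b (real (Suc n)) 1 0 x) \<longlonglongrightarrow> indicator {a<..<b} x"
proof (cases "(x - a) * (b - x) > 0")
  case True
  have "(\<lambda>n. exp (- (inverse (real (Suc n)) * inverse ((x - a) * (b - x))))) \<longlonglongrightarrow> exp (- (0 * inverse ((x - a) * (b - x))))"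
    by (intro tendsto_intros LIMSEQ_inverse_real_of_nat)
  moreover have "x \<in> {a<..<b}" using True assms by (auto simp: zero_less_mult_iff)
  ultimately show ?thesis using True by (simp add: bump_def field_simps)
next
  case False
  then have "x \<notin> {a<..<b}" by auto
  then show ?thesis using False by (simp add: bump_def)
qed

lemma bump_bounds:
  assumes "a < b" "c > 0"
  shows "\<bar>bump a b c 1 0 x\<bar> \<le> indicator {a..b} x"
  using assms by (auto simp: bump_def zero_less_mult_iff indicator_def)

lemma square_integrable_add:
  assumes "square_integrable S u" "square_integrable S v"
  shows "square_integrable S (\<lambda>x. u x + v x)"
proof -
  note [measurable] = assms[unfolded square_integrable_def, THEN conjunct1]
  have int: "integrable (lebesgue_on S) (\<lambda>x. 2 * (cmod (u x))\<^sup>2 + 2 * (cmod (v x))\<^sup>2)"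
    using assms by (auto simp: square_integrable_def)
  have "(cmod (a + b))\<^sup>2 \<le> 2 * (cmod a)\<^sup>2 + 2 * (cmod b)\<^sup>2" for a b
  proof -
    have "(cmod (a + b))\<^sup>2 \<le> (cmod a + cmod b)\<^sup>2"
      by (intro power_mono norm_triangle_ineq) auto
    also have "\<dots> \<le> 2 * (cmod a)\<^sup>2 + 2 * (cmod b)\<^sup>2"
      using sum_squares_bound[of "cmod a" "cmod b"] by (simp add: power2_sum)
    finally show ?thesis .
  qed
  then have le: "AE x in lebesgue_on S. norm ((cmod (u x + v x))\<^sup>2)
      \<le> norm (2 * (cmod (u x))\<^sup>2 + 2 * (cmod (v x))\<^sup>2)"
    by (intro AE_I2) (metis abs_of_nonneg order_trans real_norm_def zero_le_power2)
  have "(\<lambda>x. (cmod (u x + v x))\<^sup>2) \<in> borel_measurable (lebesgue_on S)" by measurable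
  from Bochner_Integration.integrable_bound[OF int this le]
  have "integrable (lebesgue_on S) (\<lambda>x. (cmod (u x + v x))\<^sup>2)" .
  then show ?thesis by (auto simp: square_integrable_def)
qed

lemma square_integrable_scaleR:
  assumes "square_integrable S u"
  shows "square_integrable S (\<lambda>x. c *\<^sub>R u x)"
proof -
  from assms have u: "u \<in> borel_measurable (lebesgue_on S)"
    and i: "integrable (lebesgue_on S) (\<lambda>x. (cmod (u x))\<^sup>2)"
    by (simp_all add: square_integrable_def)
  have "(\<lambda>x. c *\<^sub>R u x) \<in> borel_measurable (lebesgue_on S)"
    by (rule borel_measurable_scaleR[OF borel_measurable_const u])
  moreover have "integrable (lebesgue_on S) (\<lambda>x. (cmod (c *\<^sub>R u x))\<^sup>2)"
    unfolding norm_scaleR power_mult_distrib by (rule integrable_mult_right[OF i])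
  ultimately show ?thesis unfolding square_integrable_def by (rule conjI)
qed

lemma square_integrable_subset:
  assumes "square_integrable T u" "S \<subseteq> T" "S \<in> sets lebesgue" "T \<in> sets lebesgue"
  shows "square_integrable S u"
  unfolding square_integrable_def
proof
  show "u \<in> borel_measurable (lebesgue_on S)"
    using assms(1,2) unfolding square_integrable_def by (blast intro: measurable_restrict_mono)
  have "integrable (lebesgue_on T) (\<lambda>x. (cmod (u x))\<^sup>2)"
    using assms by (auto simp: square_integrable_def)
  then have "set_integrable lebesgue T (\<lambda>x. (cmod (u x))\<^sup>2)"
    using assms by (simp add: integrable_restrict_space set_integrable_def)
  then have "set_integrable lebesgue S (\<lambda>x. (cmod (u x))\<^sup>2)"
    by (rule set_integrable_subset) (use assms in auto)
  then show "integrable (lebesgue_on S) (\<lambda>x. (cmod (u x))\<^sup>2)"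
    using assms by (simp add: integrable_restrict_space set_integrable_def)
qed

lemma locally_square_integrable_measurable:
  assumes "locally_square_integrable u"
  shows "u \<in> borel_measurable lebesgue"
proof -
  have *: "(\<lambda>x. indicator {- real n..real n} x *\<^sub>R u x) \<in> borel_measurable lebesgue" for n
    using assms borel_measurable_restrict_space_iff[of "{- real n..real n}" lebesgue u]
    by (auto simp: locally_square_integrable_def square_integrable_def)
  have "(\<lambda>n. indicator {- real n..real n} x *\<^sub>R u x) \<longlonglongrightarrow> u x" for x
  proof (rule tendsto_eventually)
    obtain N where N: "\<bar>x\<bar> \<le> real N" using real_arch_simple by blast
    then show "\<forall>\<^sub>F n in sequentially. indicator {- real n..real n} x *\<^sub>R u x = u x"
      by (intro eventually_sequentiallyI[of N]) (auto simp: indicator_def abs_le_iff)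
  qed
  then show ?thesis by (rule borel_measurable_LIMSEQ_metric[OF *])
qed

lemma square_integrable_imp_integrable:
  assumes "square_integrable {a..b} u"
  shows "integrable (lebesgue_on {a..b}) u"
proof -
  interpret finite_measure "lebesgue_on {a..b}" by (rule finite_measure_lebesgue_on) simp
  have "integrable (lebesgue_on {a..b}) (\<lambda>x. 1 + (cmod (u x))\<^sup>2)"
    using assms by (auto simp: square_integrable_def)
  then show ?thesis
  proof (rule Bochner_Integration.integrable_bound)
    have "t \<le> 1 + t\<^sup>2" for t :: real using zero_le_power2[of "t - 1/2"]
      by (simp add: power2_eq_square algebra_simps)
    then show "AE x in lebesgue_on {a..b}. cmod (u x) \<le> norm (1 + (cmod (u x))\<^sup>2)"
      by (auto intro: order_trans)
  qed (use assms in \<open>auto simp: square_integrable_def\<close>)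
qed

lemma locally_square_integrable_mult_integrable:
  fixes \<psi> :: "real \<Rightarrow> real"
  assumes "locally_square_integrable u" "continuous_on UNIV \<psi>" "\<And>x. x \<notin> {a..b} \<Longrightarrow> \<psi> x = 0"
  shows "integrable lebesgue (\<lambda>x. \<psi> x *\<^sub>R u x)"
proof -
  have int: "integrable (lebesgue_on {a..b}) u"
    using assms(1) square_integrable_imp_integrable by (auto simp: locally_square_integrable_def)
  have "bounded (\<psi> ` {a..b})"
    using assms(2) by (intro compact_imp_bounded compact_continuous_image)
      (auto intro: continuous_on_subset)
  then obtain B where B: "\<And>x. x \<in> {a..b} \<Longrightarrow> \<bar>\<psi> x\<bar> \<le> B"
    unfolding bounded_iff by (metis imageI real_norm_def)
  have "\<psi> \<in> borel_measurable lebesgue"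
    using assms(2) by (simp add: borel_measurable_continuous_onI measurable_completion)
  then have "\<psi> \<in> borel_measurable (lebesgue_on {a..b})"
    by (rule measurable_restrict_space1)
  then have meas: "(\<lambda>x. \<psi> x *\<^sub>R u x) \<in> borel_measurable (lebesgue_on {a..b})"
    by (rule borel_measurable_scaleR[OF _ borel_measurable_integrable[OF int]])
  have le: "AE x in lebesgue_on {a..b}. norm (\<psi> x *\<^sub>R u x) \<le> norm (B *\<^sub>R u x)"
  proof (rule AE_I2)
    fix x assume "x \<in> space (lebesgue_on {a..b})"
    then have "\<bar>\<psi> x\<bar> \<le> \<bar>B\<bar>" using B[of x] by (simp add: space_restrict_space)
    then show "norm (\<psi> x *\<^sub>R u x) \<le> norm (B *\<^sub>R u x)" by (simp add: mult_right_mono)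
  qed
  have "integrable (lebesgue_on {a..b}) (\<lambda>x. \<psi> x *\<^sub>R u x)"
    by (rule Bochner_Integration.integrable_bound[OF _ meas le]) (simp add: int)
  then have "integrable lebesgue (\<lambda>x. if x \<in> {a..b} then \<psi> x *\<^sub>R u x else 0)"
    by (subst Lebesgue_Measure.integrable_restrict_UNIV) auto
  also have "(\<lambda>x. if x \<in> {a..b} then \<psi> x *\<^sub>R u x else 0) = (\<lambda>x. \<psi> x *\<^sub>R u x)"
    using assms(3) by auto
  finally show ?thesis .
qed

lemma test_function_continuous:
  assumes "\<phi> \<in> test_functions S"
  shows "continuous_on T ((deriv ^^ k) \<phi>)"
  using assms by (auto simp: test_functions_def intro!: continuous_at_imp_continuous_on
      differentiable_imp_continuous_within)

lemma test_function_vanish: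
  assumes "\<phi> \<in> test_functions S"
  obtains a b where "a < b" "\<And>k x. x \<notin> {a..b} \<Longrightarrow> (deriv ^^ k) \<phi> x = 0"
proof -
  have "bounded {x. \<phi> x \<noteq> 0}"
    using assms compact_imp_bounded bounded_subset closure_subset by (fastforce simp: test_functions_def)
  then obtain B where B: "B > 0" "\<And>x. \<phi> x \<noteq> 0 \<Longrightarrow> \<bar>x\<bar> \<le> B"
    by (auto simp: bounded_pos)
  have "(deriv ^^ k) \<phi> x = 0" if "x \<notin> {-B..B}" for k x
    using that
  proof (induction k arbitrary: x)
    case 0
    then show ?case using B(2)[of x] by (cases "\<phi> x = 0") (auto simp: abs_le_iff)
  next
    case (Suc k)
    have o: "open (- {-B..B})" "x \<in> - {-B..B}" using Suc.prems by auto
    have "((\<lambda>_. 0) has_real_derivative 0) (at x)" by simp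
    then have "((deriv ^^ k) \<phi> has_real_derivative 0) (at x)"
      by (rule has_field_derivative_transform_within_open[OF _ o]) (use Suc.IH in simp)
    then show ?case by (simp add: DERIV_imp_deriv)
  qed
  then show ?thesis using that[of "-B" B] B(1) by auto
qed

lemma test_function_mult_integrable:
  assumes "locally_square_integrable u" "\<phi> \<in> test_functions S"
  shows "integrable lebesgue (\<lambda>x. (deriv ^^ k) \<phi> x *\<^sub>R u x)"
proof -
  obtain a b where "a < b" "\<And>k x. x \<notin> {a..b} \<Longrightarrow> (deriv ^^ k) \<phi> x = 0"
    using test_function_vanish[OF assms(2)] by metis
  then show ?thesis
    by (intro locally_square_integrable_mult_integrable[OF assms(1), of _ a b]
        test_function_continuous[OF assms(2)])
qed

lemma AE_zero_if_test_integrals_zero: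
  assumes u: "locally_square_integrable u"
    and z: "\<And>\<phi>. \<phi> \<in> test_functions UNIV \<Longrightarrow> (LINT x|lebesgue. \<phi> x *\<^sub>R u x) = 0"
  shows "AE x in lebesgue. u x = 0"
proof -
  have int: "integrable (lebesgue_on {a..b}) u" for a b
    using u square_integrable_imp_integrable by (auto simp: locally_square_integrable_def)
  then have int': "integrable lebesgue (\<lambda>x. indicator {a..b} x *\<^sub>R u x)" for a b
    by (simp add: integrable_restrict_space)
  note [measurable] = locally_square_integrable_measurable[OF u]
  have zero: "integral {a..b} u = 0" for a b :: real
  proof (cases "a < b")
    case True
    have "(\<lambda>n. LINT x|lebesgue. bump a b (real (Suc n)) 1 0 x *\<^sub>R u x)
        \<longlonglongrightarrow> (LINT x|lebesgue. indicator {a<..<b} x *\<^sub>R u x)"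
    proof (rule integral_dominated_convergence[where w = "\<lambda>x. norm (indicator {a..b} x *\<^sub>R u x)"])
      show "AE x in lebesgue. (\<lambda>n. bump a b (real (Suc n)) 1 0 x *\<^sub>R u x)
          \<longlonglongrightarrow> indicator {a<..<b} x *\<^sub>R u x"
        by (intro AE_I2 tendsto_intros bump_tendsto_indicator True)
      show "AE x in lebesgue. norm (bump a b (real (Suc n)) 1 0 x *\<^sub>R u x)
          \<le> norm (indicator {a..b} x *\<^sub>R u x)" for n
        using bump_bounds[OF True, of "real (Suc n)"]
        by (intro AE_I2) (auto intro!: mult_right_mono simp del: of_nat_Suc)
      show "integrable lebesgue (\<lambda>x. norm (indicator {a..b} x *\<^sub>R u x))"
        using int' by (rule integrable_norm)
      show "(\<lambda>x. bump a b (real (Suc n)) 1 0 x *\<^sub>R u x) \<in> borel_measurable lebesgue" for n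
        using test_function_mult_integrable[OF u bump_in_test_functions[OF True], of "real (Suc n)" 0 1 0]
        by (auto dest: borel_measurable_integrable)
      show "(\<lambda>x. indicator {a<..<b} x *\<^sub>R u x) \<in> borel_measurable lebesgue"
        by (intro borel_measurable_scaleR borel_measurable_indicator
            locally_square_integrable_measurable[OF u]) simp
    qed
    moreover have "(LINT x|lebesgue. bump a b (real (Suc n)) 1 0 x *\<^sub>R u x) = 0" for n
      by (rule z[OF bump_in_test_functions[OF True]]) simp
    ultimately have "(LINT x|lebesgue. indicator {a<..<b} x *\<^sub>R u x) = 0"
      by (simp add: LIMSEQ_const_iff)
    moreover have "(LINT x|lebesgue. indicator {a<..<b} x *\<^sub>R u x)
        = (LINT x|lebesgue. indicator {a..b} x *\<^sub>R u x)"
    proof (rule integral_cong_AE)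
      have "AE x in lebesgue. x \<notin> {a, b}"
        by (intro AE_not_in) (simp flip: negligible_iff_null_sets)
      then show "AE x in lebesgue. indicator {a<..<b} x *\<^sub>R u x = indicator {a..b} x *\<^sub>R u x"
        by eventually_elim (auto simp: indicator_def)
    qed (intro borel_measurable_scaleR borel_measurable_indicator
        locally_square_integrable_measurable[OF u]; simp)+
    ultimately have "(LINT x|lebesgue_on {a..b}. u x) = 0"
      by (simp add: integral_restrict_space)
    then show ?thesis
      using has_integral_integral_lebesgue_on[OF int[of a b]] by (simp add: integral_unique)
  next
    case False
    then have "negligible {a..b}" by (cases "a = b") auto
    then show ?thesis by (intro integral_negligible)
  qed
  have mo: "u measurable_on UNIV"
    using lebesgue_measurable_imp_measurable_on[of u UNIV] by (simp add: lebesgue_on_UNIV_eq)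
  have io: "u integrable_on cbox a b" for a b
    using integrable_on_lebesgue_on[OF int[of a b]] by simp
  obtain N where N: "negligible N"
    "\<And>x e. \<lbrakk>x \<notin> N; 0 < e\<rbrakk> \<Longrightarrow> \<exists>d>0. \<forall>h. 0 < h \<and> h < d \<longrightarrow>
        norm (integral (cbox x (x + h *\<^sub>R One)) u /\<^sub>R h ^ DIM(real) - u x) < e"
    using integrable_ccontinuous_explicit[of u] io by blast
  have "u x = 0" if x: "x \<notin> N" for x
  proof (rule ccontr)
    assume "u x \<noteq> 0"
    then obtain d where "d > 0" "\<And>h. 0 < h \<and> h < d \<Longrightarrow>
        norm (integral (cbox x (x + h *\<^sub>R One)) u /\<^sub>R h ^ DIM(real) - u x) < norm (u x)"
      using N(2)[OF x, of "norm (u x)"] by auto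
    from this(2)[of "d/2"] this(1) show False by (simp add: zero)
  qed
  then show ?thesis
    using N(1) by (intro AE_I'[of N]) (auto simp: negligible_iff_null_sets)
qed

lemma locally_square_integrable_add:
  "locally_square_integrable u \<Longrightarrow> locally_square_integrable v \<Longrightarrow>
   locally_square_integrable (\<lambda>x. u x + v x)"
  unfolding locally_square_integrable_def by (blast intro: square_integrable_add)

lemma locally_square_integrable_scaleR:
  "locally_square_integrable u \<Longrightarrow> locally_square_integrable (\<lambda>x. c *\<^sub>R u x)"
  unfolding locally_square_integrable_def by (blast intro: square_integrable_scaleR)

lemma locally_square_integrable_const: "locally_square_integrable (\<lambda>x. c)"
  unfolding locally_square_integrable_def square_integrable_def
proof (intro allI conjI)
  fix a b :: real
  interpret finite_measure "lebesgue_on {a..b}" by (rule finite_measure_lebesgue_on) simp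
  show "(\<lambda>x. c) \<in> borel_measurable (lebesgue_on {a..b})" by (rule borel_measurable_const)
  show "integrable (lebesgue_on {a..b}) (\<lambda>x. (cmod c)\<^sup>2)" by (rule integrable_const)
qed

lemma has_weak_deriv_onD:
  assumes "has_weak_deriv_on UNIV k u v" "\<phi> \<in> test_functions UNIV"
  shows "(LINT x|lebesgue. (deriv ^^ k) \<phi> x *\<^sub>R u x) = (-1) ^ k * (LINT x|lebesgue. \<phi> x *\<^sub>R v x)"
  using assms unfolding has_weak_deriv_on_def lebesgue_on_UNIV_eq by (rule bspec)

lemma has_weak_deriv_on_cong_AE:
  assumes "has_weak_deriv_on UNIV k u v" "AE x in lebesgue. u x = u' x"
    and "locally_square_integrable u" "locally_square_integrable u'"
  shows "has_weak_deriv_on UNIV k u' v"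
  unfolding has_weak_deriv_on_def lebesgue_on_UNIV_eq
proof
  fix \<phi> :: "real \<Rightarrow> real" assume \<phi>: "\<phi> \<in> test_functions UNIV"
  have "(LINT x|lebesgue. (deriv ^^ k) \<phi> x *\<^sub>R u x) = (LINT x|lebesgue. (deriv ^^ k) \<phi> x *\<^sub>R u' x)"
  proof (rule integral_cong_AE)
    show "(\<lambda>x. (deriv ^^ k) \<phi> x *\<^sub>R u x) \<in> borel_measurable lebesgue"
      by (rule borel_measurable_integrable[OF test_function_mult_integrable[OF assms(3) \<phi>]])
    show "(\<lambda>x. (deriv ^^ k) \<phi> x *\<^sub>R u' x) \<in> borel_measurable lebesgue"
      by (rule borel_measurable_integrable[OF test_function_mult_integrable[OF assms(4) \<phi>]])
    show "AE x in lebesgue. (deriv ^^ k) \<phi> x *\<^sub>R u x = (deriv ^^ k) \<phi> x *\<^sub>R u' x"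
      using assms(2) by eventually_elim (rule arg_cong)
  qed
  then show "(LINT x|lebesgue. (deriv ^^ k) \<phi> x *\<^sub>R u' x) = (- 1) ^ k * (LINT x|lebesgue. \<phi> x *\<^sub>R v x)"
    by (simp only: has_weak_deriv_onD[OF assms(1) \<phi>])
qed

lemma has_weak_deriv_on_add:
  assumes "has_weak_deriv_on UNIV k u v" "has_weak_deriv_on UNIV k u' v'"
    and "locally_square_integrable u" "locally_square_integrable u'"
    and "locally_square_integrable v" "locally_square_integrable v'"
  shows "has_weak_deriv_on UNIV k (\<lambda>x. u x + u' x) (\<lambda>x. v x + v' x)"
  unfolding has_weak_deriv_on_def lebesgue_on_UNIV_eq
proof
  fix \<phi> :: "real \<Rightarrow> real" assume \<phi>: "\<phi> \<in> test_functions UNIV"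
  note i = test_function_mult_integrable[OF _ \<phi>]
  have "(LINT x|lebesgue. (deriv ^^ k) \<phi> x *\<^sub>R (u x + u' x)) =
      (LINT x|lebesgue. (deriv ^^ k) \<phi> x *\<^sub>R u x) + (LINT x|lebesgue. (deriv ^^ k) \<phi> x *\<^sub>R u' x)"
    unfolding scaleR_add_right by (rule Bochner_Integration.integral_add[OF i[OF assms(3)] i[OF assms(4)]])
  also have "\<dots> = (- 1) ^ k * (LINT x|lebesgue. \<phi> x *\<^sub>R v x) + (- 1) ^ k * (LINT x|lebesgue. \<phi> x *\<^sub>R v' x)"
    by (simp only: has_weak_deriv_onD[OF assms(1) \<phi>] has_weak_deriv_onD[OF assms(2) \<phi>])
  also have "\<dots> = (- 1) ^ k * (LINT x|lebesgue. \<phi> x *\<^sub>R (v x + v' x))"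
    unfolding scaleR_add_right
    using Bochner_Integration.integral_add[OF i[OF assms(5), of 0] i[OF assms(6), of 0]]
    by (simp only: funpow_0 distrib_left)
  finally show "(LINT x|lebesgue. (deriv ^^ k) \<phi> x *\<^sub>R (u x + u' x)) =
      (- 1) ^ k * (LINT x|lebesgue. \<phi> x *\<^sub>R (v x + v' x))" .
qed

lemma has_weak_deriv_on_scaleR:
  assumes "has_weak_deriv_on UNIV k u v"
  shows "has_weak_deriv_on UNIV k (\<lambda>x. c *\<^sub>R u x) (\<lambda>x. c *\<^sub>R v x)"
  unfolding has_weak_deriv_on_def lebesgue_on_UNIV_eq
  by (intro ballI, drule has_weak_deriv_onD[OF assms])
    (simp only: scaleR_left_commute[of _ c] integral_scaleR_right mult_scaleR_right)

lemma has_weak_deriv_on_unique: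
  assumes "has_weak_deriv_on UNIV k u v" "has_weak_deriv_on UNIV k u v'"
    and "locally_square_integrable v" "locally_square_integrable v'"
  shows "AE x in lebesgue. v x = v' x"
proof -
  have l: "locally_square_integrable (\<lambda>x. v x + (-1) *\<^sub>R v' x)"
    using assms(3,4) by (intro locally_square_integrable_add locally_square_integrable_scaleR)
  have "(LINT x|lebesgue. \<phi> x *\<^sub>R (v x + (-1) *\<^sub>R v' x)) = 0"
    if \<phi>: "\<phi> \<in> test_functions UNIV" for \<phi> :: "real \<Rightarrow> real"
  proof -
    have "(- 1) ^ k * (LINT x|lebesgue. \<phi> x *\<^sub>R v x) = (- 1) ^ k * (LINT x|lebesgue. \<phi> x *\<^sub>R v' x)"
      by (simp only: has_weak_deriv_onD[OF assms(1) \<phi>, symmetric] has_weak_deriv_onD[OF assms(2) \<phi>, symmetric])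
    then have eq: "(LINT x|lebesgue. \<phi> x *\<^sub>R v x) = (LINT x|lebesgue. \<phi> x *\<^sub>R v' x)" by simp
    have "(LINT x|lebesgue. \<phi> x *\<^sub>R v x + (-1) *\<^sub>R (\<phi> x *\<^sub>R v' x)) =
        (LINT x|lebesgue. \<phi> x *\<^sub>R v x) + (LINT x|lebesgue. (-1) *\<^sub>R (\<phi> x *\<^sub>R v' x))"
      using test_function_mult_integrable[OF assms(3) \<phi>, of 0] test_function_mult_integrable[OF assms(4) \<phi>, of 0]
      by (intro Bochner_Integration.integral_add integrable_scaleR_right) (simp_all only: funpow_0)
    then show ?thesis
      using eq by (simp add: scaleR_diff_right)
  qed
  from AE_zero_if_test_integrals_zero[OF l this] show ?thesis by simp
qed

lemma has_weak_deriv_on_const: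
  assumes "k > 0"
  shows "has_weak_deriv_on UNIV k (\<lambda>x. c) (\<lambda>x. 0)"
  unfolding has_weak_deriv_on_def lebesgue_on_UNIV_eq
proof
  fix \<phi> :: "real \<Rightarrow> real" assume \<phi>: "\<phi> \<in> test_functions UNIV"
  obtain j where j: "k = Suc j" using assms gr0_implies_Suc by blast
  obtain a b where ab: "a < b" "\<And>k x. x \<notin> {a..b} \<Longrightarrow> (deriv ^^ k) \<phi> x = 0"
    using test_function_vanish[OF \<phi>] by metis
  have "((deriv ^^ j) \<phi> has_real_derivative (deriv ^^ k) \<phi> x) (at x)" for x
    using \<phi> by (auto simp: test_functions_def j intro: DERIV_deriv_iff_real_differentiable[THEN iffD2])
  then have "((deriv ^^ j) \<phi> has_vector_derivative (deriv ^^ k) \<phi> x) (at x within {a - 1..b + 1})" for x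
    by (metis has_real_derivative_iff_has_vector_derivative has_vector_derivative_at_within)
  then have "integral\<^sup>L lborel (\<lambda>x. indicator {a - 1..b + 1} x *\<^sub>R (deriv ^^ k) \<phi> x) =
      (deriv ^^ j) \<phi> (b + 1) - (deriv ^^ j) \<phi> (a - 1)"
    using ab(1) by (intro integral_FTC_atLeastAtMost test_function_continuous[OF \<phi>]) simp_all
  also have "(deriv ^^ j) \<phi> (b + 1) = 0" by (rule ab(2)) simp
  also have "(deriv ^^ j) \<phi> (a - 1) = 0" by (rule ab(2)) simp
  also have "(\<lambda>x. indicator {a - 1..b + 1} x *\<^sub>R (deriv ^^ k) \<phi> x) = (deriv ^^ k) \<phi>"
  proof
    fix x
    show "indicator {a - 1..b + 1} x *\<^sub>R (deriv ^^ k) \<phi> x = (deriv ^^ k) \<phi> x"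
      using ab(2)[of x k] by (cases "x \<in> {a..b}") (simp_all add: indicator_def)
  qed
  finally have "(LINT x|lborel. (deriv ^^ k) \<phi> x) = 0" by simp
  moreover have "(deriv ^^ k) \<phi> \<in> borel_measurable lborel"
    using test_function_continuous[OF \<phi>] by (simp add: borel_measurable_continuous_onI)
  ultimately have "(LINT x|lebesgue. (deriv ^^ k) \<phi> x) = 0"
    by (simp add: integral_completion)
  moreover have "(LINT x|lebesgue. (deriv ^^ k) \<phi> x *\<^sub>R c) = (LINT x|lebesgue. (deriv ^^ k) \<phi> x) *\<^sub>R c"
  proof (cases "c = 0")
    case False
    have "integrable lebesgue (\<lambda>x. Re ((deriv ^^ k) \<phi> x *\<^sub>R 1))"
      by (rule integrable_Re[OF test_function_mult_integrable[OF locally_square_integrable_const \<phi>]])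
    then show ?thesis by simp
  qed simp
  ultimately show "(LINT x|lebesgue. (deriv ^^ k) \<phi> x *\<^sub>R c) = (- 1) ^ k * (LINT x|lebesgue. \<phi> x *\<^sub>R 0)"
    by simp
qed

lemma H2per_funs_add:
  assumes "u \<in> H2per_funs" "v \<in> H2per_funs"
  shows "(\<lambda>x. u x + v x) \<in> H2per_funs"
  unfolding H2per_funs_def
proof (intro CollectI conjI ballI allI)
  show "u (x + 2 * pi) + v (x + 2 * pi) = u x + v x" for x
    using assms by (simp add: H2per_funs_def)
  show "locally_square_integrable (\<lambda>x. u x + v x)"
    using assms by (intro locally_square_integrable_add) (simp_all add: H2per_funs_def)
  fix k :: nat assume k: "k \<in> {1, 2}"
  then obtain u' v' where "locally_square_integrable u'" "has_weak_deriv_on UNIV k u u'"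
    "locally_square_integrable v'" "has_weak_deriv_on UNIV k v v'"
    using assms unfolding H2per_funs_def by blast
  moreover have "locally_square_integrable u" "locally_square_integrable v"
    using assms by (simp_all add: H2per_funs_def)
  ultimately show "\<exists>w. locally_square_integrable w \<and> has_weak_deriv_on UNIV k (\<lambda>x. u x + v x) w"
    by (blast intro: locally_square_integrable_add has_weak_deriv_on_add)
qed

lemma H2per_funs_scaleR:
  assumes "u \<in> H2per_funs"
  shows "(\<lambda>x. c *\<^sub>R u x) \<in> H2per_funs"
  unfolding H2per_funs_def
proof (intro CollectI conjI ballI allI)
  show "c *\<^sub>R u (x + 2 * pi) = c *\<^sub>R u x" for x
    using assms by (simp add: H2per_funs_def)
  show "locally_square_integrable (\<lambda>x. c *\<^sub>R u x)"
    using assms by (intro locally_square_integrable_scaleR) (simp add: H2per_funs_def)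
  fix k :: nat assume k: "k \<in> {1, 2}"
  then obtain u' where "locally_square_integrable u'" "has_weak_deriv_on UNIV k u u'"
    using assms unfolding H2per_funs_def by blast
  then show "\<exists>w. locally_square_integrable w \<and> has_weak_deriv_on UNIV k (\<lambda>x. c *\<^sub>R u x) w"
    by (blast intro: locally_square_integrable_scaleR has_weak_deriv_on_scaleR)
qed

lemma H2per_funs_const: "(\<lambda>x. c) \<in> H2per_funs"
  unfolding H2per_funs_def
proof (intro CollectI conjI ballI allI)
  fix k :: nat assume "k \<in> {1, 2}"
  then have "k > 0" by auto
  then show "\<exists>w. locally_square_integrable w \<and> has_weak_deriv_on UNIV k (\<lambda>x. c) w"
    by (intro exI[of _ "\<lambda>x. 0"] conjI locally_square_integrable_const has_weak_deriv_on_const)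
qed (rule refl locally_square_integrable_const)+

definition L2_norm_per :: "(real \<Rightarrow> complex) \<Rightarrow> real" where
  "L2_norm_per f = sqrt (LINT x|lebesgue_on {0<..<2*pi}. (cmod (f x))\<^sup>2)"

lemma locally_imp_square_integrable:
  "locally_square_integrable f \<Longrightarrow> square_integrable {0<..<2*pi} f"
  unfolding locally_square_integrable_def
  by (rule square_integrable_subset[of "{0..2*pi}"]) auto

lemma AE_lebesgue_imp_lebesgue_on: "AE x in lebesgue. P x \<Longrightarrow> AE x in lebesgue_on {0<..<2*pi}. P x"
  by (subst AE_restrict_space_iff) auto

lemma L2_norm_per_cong_AE:
  assumes "locally_square_integrable f" "locally_square_integrable g" "AE x in lebesgue. f x = g x"
  shows "L2_norm_per f = L2_norm_per g"
proof -
  have "(LINT x|lebesgue_on {0<..<2*pi}. (cmod (f x))\<^sup>2) = (LINT x|lebesgue_on {0<..<2*pi}. (cmod (g x))\<^sup>2)"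
  proof (rule integral_cong_AE)
    show "AE x in lebesgue_on {0<..<2*pi}. (cmod (f x))\<^sup>2 = (cmod (g x))\<^sup>2"
      using AE_lebesgue_imp_lebesgue_on[OF assms(3)] by eventually_elim (rule arg_cong)
  qed (use assms(1,2)[THEN locally_imp_square_integrable] in
      \<open>unfold square_integrable_def, blast dest: borel_measurable_integrable\<close>)+
  then show ?thesis by (simp add: L2_norm_per_def)
qed

lemma L2_norm_per_nonneg: "L2_norm_per f \<ge> 0"
  by (simp add: L2_norm_per_def)

lemma L2_norm_per_scaleR: "L2_norm_per (\<lambda>x. c *\<^sub>R f x) = \<bar>c\<bar> * L2_norm_per f"
  by (simp add: L2_norm_per_def power_mult_distrib real_sqrt_mult)

lemma L2_norm_per_triangle:
  assumes "locally_square_integrable f" "locally_square_integrable g"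
  shows "L2_norm_per (\<lambda>x. f x + g x) \<le> L2_norm_per f + L2_norm_per g"
proof (rule field_le_epsilon)
  fix e :: real assume e: "e > 0"
  define M where "M = lebesgue_on {0<..<2*pi::real}"
  define F where "F = (LINT x|M. (cmod (f x))\<^sup>2)"
  define G where "G = (LINT x|M. (cmod (g x))\<^sup>2)"
  define a where "a = sqrt F + e / 2"
  define b where "b = sqrt G + e / 2"
  have F0: "F \<ge> 0" and G0: "G \<ge> 0" by (auto simp: F_def G_def)
  have ab: "a > 0" "b > 0"
    using F0 G0 e by (auto simp: a_def b_def intro: add_nonneg_pos)
  have F: "F \<le> a\<^sup>2" and G: "G \<le> b\<^sup>2"
    using F0 G0 e power_mono[of "sqrt F" a 2] power_mono[of "sqrt G" b 2] by (auto simp: a_def b_def)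
  have if2: "integrable M (\<lambda>x. (cmod (f x))\<^sup>2)" and ig: "integrable M (\<lambda>x. (cmod (g x))\<^sup>2)"
    using assms[THEN locally_imp_square_integrable] unfolding square_integrable_def M_def by blast+
  have isum: "integrable M (\<lambda>x. (cmod (f x + g x))\<^sup>2)"
    using locally_imp_square_integrable[OF locally_square_integrable_add[OF assms]]
    unfolding square_integrable_def M_def by blast
  have pw: "(cmod (y + z))\<^sup>2 \<le> (a + b) / a * (cmod y)\<^sup>2 + (a + b) / b * (cmod z)\<^sup>2" for y z
  proof -
    have "(cmod (y + z))\<^sup>2 \<le> (cmod y + cmod z)\<^sup>2"
      by (intro power_mono norm_triangle_ineq) auto
    also have "\<dots> \<le> (cmod y + cmod z)\<^sup>2 + (b * cmod y - a * cmod z)\<^sup>2 / (a * b)"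
      using ab by simp
    also have "\<dots> = (a + b) / a * (cmod y)\<^sup>2 + (a + b) / b * (cmod z)\<^sup>2"
      using ab by (simp add: field_simps power2_eq_square)
    finally show ?thesis .
  qed
  have "(LINT x|M. (cmod (f x + g x))\<^sup>2)
      \<le> (LINT x|M. (a + b) / a * (cmod (f x))\<^sup>2 + (a + b) / b * (cmod (g x))\<^sup>2)"
    by (intro integral_mono Bochner_Integration.integrable_add integrable_mult_right if2 ig isum pw)
  also have "\<dots> = (a + b) / a * F + (a + b) / b * G"
    unfolding F_def G_def
    using Bochner_Integration.integral_add[OF integrable_mult_right[OF if2, of "(a + b) / a"]
        integrable_mult_right[OF ig, of "(a + b) / b"]]
    by (simp only: integral_mult_right_zero)
  also have "\<dots> \<le> (a + b) / a * a\<^sup>2 + (a + b) / b * b\<^sup>2"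
    using F G ab by (intro add_mono mult_left_mono) auto
  also have "\<dots> = (a + b)\<^sup>2"
    using ab by (simp add: field_simps power2_eq_square)
  finally have "L2_norm_per (\<lambda>x. f x + g x) \<le> a + b"
    using ab unfolding L2_norm_per_def M_def by (intro real_le_lsqrt) auto
  then show "L2_norm_per (\<lambda>x. f x + g x) \<le> L2_norm_per f + L2_norm_per g + e"
    by (simp add: a_def b_def F_def G_def M_def L2_norm_per_def)
qed

lemma AE_lebesgue_iff_negligible:
  fixes P :: "'a::euclidean_space \<Rightarrow> bool"
  shows "(AE x in lebesgue. P x) \<longleftrightarrow> negligible {x. \<not> P x}"
  using completion.AE_iff_null_sets[where M = lborel and P = P]
  by (simp only: negligible_iff_null_sets space_completion space_lborel space_borel UNIV_I simp_thms)

lemma L2_norm_per_eq_0: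
  assumes l: "locally_square_integrable f" and per: "\<And>x. f (x + 2 * pi) = f x"
    and 0: "L2_norm_per f = 0"
  shows "AE x in lebesgue. f x = 0"
proof -
  have "square_integrable {0<..<2*pi} f" by (rule locally_imp_square_integrable[OF l])
  then have "AE x in lebesgue_on {0<..<2*pi}. (cmod (f x))\<^sup>2 = 0"
    using 0 unfolding L2_norm_per_def square_integrable_def
    by (subst (asm) real_sqrt_eq_zero_cancel_iff, subst (asm) integral_nonneg_eq_0_iff_AE) auto
  then have "AE x in lebesgue. x \<in> {0<..<2*pi} \<longrightarrow> f x = 0"
    by (subst (asm) AE_restrict_space_iff) auto
  then have N: "negligible {x \<in> {0<..<2*pi}. f x \<noteq> 0}" (is "negligible ?N")
    unfolding AE_lebesgue_iff_negligible by (simp only: not_imp)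
  let ?T = "\<lambda>k::int. (+) (2 * pi * real_of_int k) ` insert 0 ?N"
  have "f (x + 2 * pi * real n) = f x" for x n
  proof (induction n)
    case (Suc n)
    then show ?case using per[of "x + 2 * pi * real n"] by (simp add: algebra_simps)
  qed simp
  then have perk: "f (x + 2 * pi * real_of_int k) = f x" for x k
  proof (cases k rule: int_cases2)
    case (nonneg n) then show ?thesis using \<open>\<And>x n. f (x + 2 * pi * real n) = f x\<close> by simp
  next
    case (nonpos n)
    then show ?thesis
      using \<open>\<And>x n. f (x + 2 * pi * real n) = f x\<close>[of "x - 2 * pi * real n" n] by simp
  qed
  have "{x. f x \<noteq> 0} \<subseteq> (\<Union>k. ?T k)"
  proof
    fix x assume x: "x \<in> {x. f x \<noteq> 0}"
    define k where "k = \<lfloor>x / (2 * pi)\<rfloor>"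
    define y where "y = x - 2 * pi * real_of_int k"
    have xy: "x = 2 * pi * real_of_int k + y" by (simp add: y_def)
    have "real_of_int k \<le> x / (2 * pi)" "x / (2 * pi) < real_of_int k + 1"
      unfolding k_def by linarith+
    then have "0 \<le> y" "y < 2 * pi" by (auto simp: y_def field_simps)
    moreover have "f y \<noteq> 0" using x perk[of y k] by (simp add: xy add.commute)
    ultimately have "y \<in> insert 0 ?N" by auto
    then have "x \<in> ?T k" unfolding xy by (rule imageI)
    then show "x \<in> (\<Union>k. ?T k)" by blast
  qed
  moreover have "negligible (\<Union>k. ?T k)"
  proof (rule negligible_countable_Union)
    show "countable (range ?T)" by simp
    fix S assume "S \<in> range ?T"
    then show "negligible S" using N by (auto intro!: negligible_translation)
  qed
  ultimately have "negligible {x. f x \<noteq> 0}" by (rule negligible_subset[rotated])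
  then show ?thesis unfolding AE_lebesgue_iff_negligible .
qed

section \<open>The normed space \<open>H\<^sup>2\<^sub>p\<^sub>e\<^sub>r(0,2\<pi>)\<close>\<close>

definition H2per_rel :: "(real \<Rightarrow> complex) \<Rightarrow> (real \<Rightarrow> complex) \<Rightarrow> bool" where
  "H2per_rel u v \<longleftrightarrow> u \<in> H2per_funs \<and> v \<in> H2per_funs \<and> (AE x in lebesgue. u x = v x)"

quotient_type h2per = "real \<Rightarrow> complex" / partial: H2per_rel
proof (rule part_equivpI)
  show "\<exists>u. H2per_rel u u"
    by (rule exI[of _ "\<lambda>_. 0"]) (simp add: H2per_rel_def H2per_funs_const)
  show "symp H2per_rel"
    by (rule sympI) (auto simp: H2per_rel_def elim: eventually_mono)
  show "transp H2per_rel"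
  proof (rule transpI)
    fix u v w assume "H2per_rel u v" "H2per_rel v w"
    then show "H2per_rel u w"
      unfolding H2per_rel_def by (auto elim: eventually_elim2)
  qed
qed

instantiation h2per :: real_vector
begin

lift_definition zero_h2per :: h2per is "\<lambda>_. 0"
  by (simp add: H2per_rel_def H2per_funs_const)

lift_definition plus_h2per :: "h2per \<Rightarrow> h2per \<Rightarrow> h2per" is "\<lambda>u v x. u x + v x"
  unfolding H2per_rel_def by (auto intro: H2per_funs_add elim: eventually_elim2)

lift_definition scaleR_h2per :: "real \<Rightarrow> h2per \<Rightarrow> h2per" is "\<lambda>c u x. c *\<^sub>R u x"
  unfolding H2per_rel_def by (auto intro: H2per_funs_scaleR elim: eventually_mono)

definition uminus_h2per :: "h2per \<Rightarrow> h2per" where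
  "uminus_h2per u = (-1) *\<^sub>R u"

definition minus_h2per :: "h2per \<Rightarrow> h2per \<Rightarrow> h2per" where
  "minus_h2per u v = u + - v"

instance
proof
  fix u v w :: h2per and a b :: real
  show "u + v + w = u + (v + w)"
    by transfer (auto simp: H2per_rel_def add.assoc intro!: H2per_funs_add)
  show "u + v = v + u"
    by transfer (auto simp: H2per_rel_def add.commute intro!: H2per_funs_add)
  show "0 + u = u"
    by transfer (auto simp: H2per_rel_def)
  show "- u + u = 0"
    unfolding uminus_h2per_def
    by transfer (auto simp: H2per_rel_def H2per_funs_const)
  show "u - v = u + - v" by (rule minus_h2per_def)
  show "a *\<^sub>R (u + v) = a *\<^sub>R u + a *\<^sub>R v"
    by transfer (auto simp: H2per_rel_def scaleR_add_right intro!: H2per_funs_add H2per_funs_scaleR)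
  show "(a + b) *\<^sub>R u = a *\<^sub>R u + b *\<^sub>R u"
    by transfer (auto simp: H2per_rel_def scaleR_add_left intro!: H2per_funs_add H2per_funs_scaleR)
  show "a *\<^sub>R b *\<^sub>R u = (a * b) *\<^sub>R u"
    by transfer (auto simp: H2per_rel_def intro!: H2per_funs_scaleR)
  show "1 *\<^sub>R u = u"
    by transfer (auto simp: H2per_rel_def)
qed

end

text \<open>\<open>H2per_deriv k u\<close> is a representative of the weak derivative \<open>u\<^bsup>(k)\<^esup>\<close>, for \<open>k \<le> 2\<close>.\<close>

definition H2per_deriv :: "nat \<Rightarrow> h2per \<Rightarrow> real \<Rightarrow> complex" where
  "H2per_deriv k u = (SOME v. locally_square_integrable v \<and> has_weak_deriv_on UNIV k (rep_h2per u) v)"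

lemma rep_h2per_in_H2per_funs: "rep_h2per u \<in> H2per_funs"
  using Quotient3_rep_reflp[OF Quotient3_h2per, of u] by (simp add: H2per_rel_def)

lemma rep_h2per_locally_square_integrable: "locally_square_integrable (rep_h2per u)"
  using rep_h2per_in_H2per_funs by (simp add: H2per_funs_def)

lemma rep_h2per_periodic: "rep_h2per u (x + 2 * pi) = rep_h2per u x"
  using rep_h2per_in_H2per_funs by (simp add: H2per_funs_def)

lemma rep_abs_h2per:
  assumes "u \<in> H2per_funs"
  shows "AE x in lebesgue. rep_h2per (abs_h2per u) x = u x"
  using rep_abs_rsp[OF Quotient3_h2per, of u u] assms
  by (auto simp: H2per_rel_def)

lemma h2per_eqI:
  assumes "AE x in lebesgue. rep_h2per u x = rep_h2per v x"
  shows "u = v"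
  using assms Quotient3_rel_rep[OF Quotient3_h2per, of u v] rep_h2per_in_H2per_funs
  by (simp add: H2per_rel_def)

lemma rep_h2per_add: "AE x in lebesgue. rep_h2per (u + v) x = rep_h2per u x + rep_h2per v x"
  unfolding plus_h2per_def map_fun_apply
  by (rule rep_abs_h2per) (intro H2per_funs_add rep_h2per_in_H2per_funs)

lemma rep_h2per_scaleR: "AE x in lebesgue. rep_h2per (c *\<^sub>R u) x = c *\<^sub>R rep_h2per u x"
  unfolding scaleR_h2per_def map_fun_apply id_apply
  by (rule rep_abs_h2per) (intro H2per_funs_scaleR rep_h2per_in_H2per_funs)

lemma rep_h2per_zero: "AE x in lebesgue. rep_h2per 0 x = 0"
  unfolding zero_h2per_def by (rule rep_abs_h2per) (rule H2per_funs_const)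

lemma H2per_deriv:
  assumes "k \<le> 2"
  shows "locally_square_integrable (H2per_deriv k u)"
    and "has_weak_deriv_on UNIV k (rep_h2per u) (H2per_deriv k u)"
proof -
  have "\<exists>v. locally_square_integrable v \<and> has_weak_deriv_on UNIV k (rep_h2per u) v"
  proof (cases "k = 0")
    case True
    then have "has_weak_deriv_on UNIV k (rep_h2per u) (rep_h2per u)"
      by (simp add: has_weak_deriv_on_def)
    then show ?thesis using rep_h2per_locally_square_integrable by blast
  next
    case False
    then have "k \<in> {1, 2}" using assms by auto
    then show ?thesis using rep_h2per_in_H2per_funs[of u] unfolding H2per_funs_def by blast
  qed
  from someI_ex[OF this]
  show "locally_square_integrable (H2per_deriv k u)"
    and "has_weak_deriv_on UNIV k (rep_h2per u) (H2per_deriv k u)"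
    by (simp_all add: H2per_deriv_def)
qed

lemma H2per_deriv_AE_eqI:
  assumes "k \<le> 2" "locally_square_integrable u'" "locally_square_integrable v"
    "AE x in lebesgue. rep_h2per u x = u' x" "has_weak_deriv_on UNIV k u' v"
  shows "AE x in lebesgue. H2per_deriv k u x = v x"
proof (rule has_weak_deriv_on_unique[OF _ assms(5)])
  show "has_weak_deriv_on UNIV k u' (H2per_deriv k u)"
    by (rule has_weak_deriv_on_cong_AE[OF H2per_deriv(2)[OF assms(1)] assms(4)
          rep_h2per_locally_square_integrable assms(2)])
qed (rule H2per_deriv(1)[OF assms(1)] assms(3))+

lemma H2per_deriv_0: "AE x in lebesgue. H2per_deriv 0 u x = rep_h2per u x"
  by (rule H2per_deriv_AE_eqI[OF _ rep_h2per_locally_square_integrable[of u] rep_h2per_locally_square_integrable[of u]])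
    (simp_all add: has_weak_deriv_on_def)

lemma H2per_deriv_add:
  assumes "k \<le> 2"
  shows "AE x in lebesgue. H2per_deriv k (u + v) x = H2per_deriv k u x + H2per_deriv k v x"
  by (rule H2per_deriv_AE_eqI[OF assms _ _ rep_h2per_add])
    (intro locally_square_integrable_add has_weak_deriv_on_add H2per_deriv[OF assms]
       rep_h2per_locally_square_integrable)+

lemma H2per_deriv_scaleR:
  assumes "k \<le> 2"
  shows "AE x in lebesgue. H2per_deriv k (c *\<^sub>R u) x = c *\<^sub>R H2per_deriv k u x"
  by (rule H2per_deriv_AE_eqI[OF assms _ _ rep_h2per_scaleR])
    (intro locally_square_integrable_scaleR has_weak_deriv_on_scaleR H2per_deriv[OF assms]
       rep_h2per_locally_square_integrable)+

instantiation h2per :: real_normed_vector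
begin

definition norm_h2per :: "h2per \<Rightarrow> real" where
  "norm_h2per u = sqrt (\<Sum>j\<le>2. (L2_norm_per (H2per_deriv j u))\<^sup>2)"

definition sgn_h2per :: "h2per \<Rightarrow> h2per" where
  "sgn_h2per u = u /\<^sub>R norm u"

definition dist_h2per :: "h2per \<Rightarrow> h2per \<Rightarrow> real" where
  "dist_h2per u v = norm (u - v)"

definition uniformity_h2per :: "(h2per \<times> h2per) filter" where
  "uniformity_h2per = (INF e\<in>{0<..}. principal {(u, v). dist u v < e})"

definition open_h2per :: "h2per set \<Rightarrow> bool" where
  "open_h2per U \<longleftrightarrow> (\<forall>u\<in>U. \<forall>\<^sub>F (u', v) in uniformity. u' = u \<longrightarrow> v \<in> U)"

instance
proof
  fix u v :: h2per and c :: real and U :: "h2per set"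
  have norm: "norm w = L2_set (\<lambda>j. L2_norm_per (H2per_deriv j w)) {..2}" for w :: h2per
    by (simp add: norm_h2per_def L2_set_def)
  show "dist u v = norm (u - v)" by (rule dist_h2per_def)
  show "sgn u = u /\<^sub>R norm u" by (rule sgn_h2per_def)
  show "uniformity = (INF e\<in>{0<..}. principal {(u :: h2per, v). dist u v < e})"
    by (rule uniformity_h2per_def)
  show "open U \<longleftrightarrow> (\<forall>u\<in>U. \<forall>\<^sub>F (u', v) in uniformity. u' = u \<longrightarrow> v \<in> U)"
    by (rule open_h2per_def)
  have scale: "L2_norm_per (H2per_deriv j (c *\<^sub>R u)) = \<bar>c\<bar> * L2_norm_per (H2per_deriv j u)"
    if j: "j \<in> {..2}" for j c u
  proof -
    have "j \<le> 2" using j by simp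
    then have "L2_norm_per (H2per_deriv j (c *\<^sub>R u)) = L2_norm_per (\<lambda>x. c *\<^sub>R H2per_deriv j u x)"
      by (intro L2_norm_per_cong_AE H2per_deriv H2per_deriv_scaleR locally_square_integrable_scaleR)
    then show ?thesis by (simp only: L2_norm_per_scaleR)
  qed
  show scale': "norm (c *\<^sub>R u) = \<bar>c\<bar> * norm u" for c and u :: h2per
    unfolding norm using scale by (subst L2_set_right_distrib) (auto intro!: L2_set_cong)
  show "norm u = 0 \<longleftrightarrow> u = 0"
  proof
    assume "norm u = 0"
    then have "L2_norm_per (H2per_deriv 0 u) = 0" unfolding norm by (subst (asm) L2_set_eq_0_iff) auto
    moreover have "L2_norm_per (H2per_deriv 0 u) = L2_norm_per (rep_h2per u)"
      by (intro L2_norm_per_cong_AE H2per_deriv H2per_deriv_0 rep_h2per_locally_square_integrable) simp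
    ultimately have "AE x in lebesgue. rep_h2per u x = 0"
      by (intro L2_norm_per_eq_0 rep_h2per_locally_square_integrable rep_h2per_periodic) simp
    then show "u = 0"
      using rep_h2per_zero by (intro h2per_eqI) (auto elim: eventually_elim2)
  next
    assume "u = 0"
    then have "u = 0 *\<^sub>R u" by simp
    then show "norm u = 0" using scale'[of 0 u] by simp
  qed
  have "norm (u + v) \<le> L2_set (\<lambda>j. L2_norm_per (H2per_deriv j u) + L2_norm_per (H2per_deriv j v)) {..2}"
    unfolding norm
  proof (rule L2_set_mono)
    fix j :: nat assume "j \<in> {..2}"
    then have j: "j \<le> 2" by simp
    have "L2_norm_per (H2per_deriv j (u + v)) = L2_norm_per (\<lambda>x. H2per_deriv j u x + H2per_deriv j v x)"
      using j by (intro L2_norm_per_cong_AE H2per_deriv H2per_deriv_add locally_square_integrable_add)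
    also have "\<dots> \<le> L2_norm_per (H2per_deriv j u) + L2_norm_per (H2per_deriv j v)"
      using j by (intro L2_norm_per_triangle H2per_deriv)
    finally show "L2_norm_per (H2per_deriv j (u + v)) \<le>
        L2_norm_per (H2per_deriv j u) + L2_norm_per (H2per_deriv j v)" .
  qed (rule L2_norm_per_nonneg)
  also have "\<dots> \<le> norm u + norm v" unfolding norm by (rule L2_set_triangle_ineq)
  finally show "norm (u + v) \<le> norm u + norm v" .
qed

end

lift_definition const_h2per :: "complex \<Rightarrow> h2per" is "\<lambda>c _. c"
  by (simp add: H2per_rel_def H2per_funs_const)


section \<open>The equation\<close>

definition periodic_extension :: "(real \<Rightarrow> complex) \<Rightarrow> real \<Rightarrow> complex" where
  "periodic_extension e s = e (s - 2 * pi * of_int \<lfloor>s / (2 * pi)\<rfloor>)"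

definition LLE_solutions ::
    "real \<Rightarrow> real \<Rightarrow> real \<Rightarrow> real \<Rightarrow> (real \<Rightarrow> complex) \<Rightarrow> (real \<times> h2per) set" where
  "LLE_solutions d \<zeta> \<omega> f0 e = {(f1, u). AE s in lebesgue.
     - of_real d * H2per_deriv 2 u s + \<i> * of_real \<omega> * H2per_deriv 1 u s
     + (of_real \<zeta> - \<i>) * rep_h2per u s
     - of_real ((cmod (rep_h2per u s))\<^sup>2) * rep_h2per u s
     + \<i> * of_real f0 + \<i> * of_real f1 * periodic_extension e s = 0}"

definition LLE_linearization ::
    "real \<Rightarrow> real \<Rightarrow> real \<Rightarrow> h2per \<Rightarrow> h2per \<Rightarrow> real \<Rightarrow> complex" where
  "LLE_linearization d \<zeta> \<omega> u \<phi> s =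
     - of_real d * H2per_deriv 2 \<phi> s + \<i> * of_real \<omega> * H2per_deriv 1 \<phi> s
     + (of_real \<zeta> - \<i> - 2 * of_real ((cmod (rep_h2per u s))\<^sup>2)) * rep_h2per \<phi> s
     - (rep_h2per u s)\<^sup>2 * cnj (rep_h2per \<phi> s)"

text \<open>The element \<open>w\<close> is \<open>u'\<close>, which belongs to \<open>H\<^sup>2\<^sub>p\<^sub>e\<^sub>r(0,2\<pi>)\<close> whenever \<open>u\<close> is a solution
  for \<open>f\<^sub>1 = 0\<close>.\<close>

definition nondegenerate :: "real \<Rightarrow> real \<Rightarrow> real \<Rightarrow> h2per \<Rightarrow> bool" where
  "nondegenerate d \<zeta> \<omega> u \<longleftrightarrow>
     (\<exists>w. (AE s in lebesgue. rep_h2per w s = H2per_deriv 1 u s) \<and>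
          {\<phi>. AE s in lebesgue. LLE_linearization d \<zeta> \<omega> u \<phi> s = 0} = span {w})"


section \<open>Continua and smooth curves\<close>

definition maximal_continuum :: "'a::topological_space set \<Rightarrow> 'a \<Rightarrow> 'a set \<Rightarrow> bool" where
  "maximal_continuum A x C \<longleftrightarrow>
     closed C \<and> connected C \<and> C \<subseteq> A \<and> x \<in> C \<and>
     (\<forall>D. closed D \<and> connected D \<and> D \<subseteq> A \<and> x \<in> D \<longrightarrow> D \<subseteq> C)"

text \<open>\<open>D k\<close> is the \<open>k\<close>-th derivative of \<open>g\<close>; it is one-sided at boundary points belonging to \<open>T\<close>.\<close>

definition smooth_curve_on :: "real set \<Rightarrow> (real \<Rightarrow> 'a::real_normed_vector) \<Rightarrow> bool" where
  "smooth_curve_on T g \<longleftrightarrow>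
     (\<exists>D. (\<forall>t\<in>T. D 0 t = g t) \<and>
          (\<forall>k. \<forall>t\<in>T. (D k has_vector_derivative D (Suc k) t) (at t within T)))"

end

theory Submission
  imports Defs "HOL-Complex_Analysis.Great_Picard"
begin

text \<open>Why the theorem holds. The nonlinearity of the equation only sees the values of \<open>u\<close> and \<open>u'\<close>.
  These form a pair \<open>\<iota> u\<close> of continuous functions on \<open>[0,2\<pi>]\<close>, and \<open>\<iota>\<close> is compact on
  \<open>H\<^sup>2\<^sub>p\<^sub>e\<^sub>r\<close> (\<open>compact_map_h2_trace\<close>). Solving for \<open>u''\<close>, subtracting the mean of \<open>u\<close> on both sides and
  inverting \<open>v \<mapsto> v'' - mean v\<close> on periodic functions (\<open>solve\<close>) turns the equation into
  \<open>u = f\<^sub>1 E + M (\<iota> u)\<close>, where \<open>M\<close> is a cubic map from pairs of continuous functions into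
  \<open>H\<^sup>2\<^sub>p\<^sub>e\<^sub>r\<close> (\<open>LLE_solutions_iff\<close>). This is a compact perturbation of the identity depending on the real
  parameter \<open>f\<^sub>1\<close>, and the claim is a global continuation theorem of Rabinowitz type for it, proved
  abstractly in \<open>continuation\<close>. It rests on two facts about the equation.

  Boundedness: testing the equation with \<open>cnj u\<close>, the damping term \<open>-\<i>u\<close> makes the imaginary part control
  the \<open>L\<^sup>2\<close> norm of \<open>u\<close>; the real part then controls \<open>u'\<close>, and the equation itself controls \<open>u''\<close>
  (\<open>a_priori_bound\<close>). This gives (ii) and makes the set of solutions with \<open>f\<^sub>1\<close> in a bounded interval
  compact.

  Non-degeneracy: the linearization of \<open>u - M (\<iota> u)\<close> at \<open>u\<^sub>0\<close> is injective, hence invertible by the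
  Riesz theory of compact operators (\<open>riesz_fredholm\<close>). Composing with the inverse gives
  \<open>x = t w + N x\<close> with \<open>N\<close> compact, \<open>N 0 = 0\<close> and \<open>DN\<close> small near \<open>0\<close>
  (\<open>preconditioned_equation\<close>). The contraction principle yields the local curve, and differentiating
  the fixed point equation shows inductively that it is smooth (\<open>local_solution_curve\<close>), which is (i).

  Let \<open>C\<close> be the connected component of \<open>(0,u\<^sub>0)\<close> among the solutions with \<open>f\<^sub>1 \<ge> 0\<close>. If both (a) and (b)
  fail, then \<open>C\<close> stays below some level \<open>f\<^sub>1 = T\<close> and meets \<open>f\<^sub>1 = 0\<close> only in \<open>u\<^sub>0\<close>. In the compact set
  of solutions with \<open>0 \<le> f\<^sub>1 \<le> T\<close>, components can be separated by open and closed sets, so \<open>C\<close> is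
  contained in a compact piece \<open>Z\<close> of the solution set with the same two properties, whose
  complement is compact as well. Usually this contradicts the homotopy invariance of the Leray-Schauder degree.
  Here it contradicts Schauder's theorem directly: a map on \<open>\<real> \<times> X\<close> is
  written down whose fixed points would have to lie both in \<open>Z\<close> and on the level \<open>T\<close>
  (\<open>no_isolated_compact_solution_set\<close>). Schauder's theorem comes from the combinatorial lemma of Kuhn.

  The continuum \<open>C\<^sup>-\<close> is obtained from the same statement for the reflected parameter \<open>-f\<^sub>1\<close>.\<close>

section \<open>The fixed point theorems of Brouwer and Schauder\<close>

text \<open>Kuhn's lemma is applied to the grid of mesh \<open>1 / p\<close>, a grid point being labelled in
  direction \<open>i\<close> by whether \<open>f\<close> moves it down. The cell it provides has, for every \<open>i\<close>, corners where the
  \<open>i\<close>-th coordinate of \<open>f w - w\<close> has different signs, so this coordinate is small on the whole cell.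
  The cube is modelled by functions on \<open>{..<n}\<close> because the dimension \<open>n\<close> is chosen during the proof
  of Schauder's theorem.\<close>

lemma brouwer_cube_approx:
  fixes f :: "(nat \<Rightarrow> real) \<Rightarrow> nat \<Rightarrow> real"
  assumes range: "\<And>w i. (\<forall>j<n. w j \<in> {0..1}) \<Longrightarrow> i < n \<Longrightarrow> f w i \<in> {0..1}"
    and cont: "\<And>\<epsilon>. \<epsilon> > 0 \<Longrightarrow> \<exists>\<delta>>0. \<forall>w w'. (\<forall>j<n. w j \<in> {0..1} \<and> w' j \<in> {0..1} \<and> \<bar>w j - w' j\<bar> < \<delta>)
        \<longrightarrow> (\<forall>i<n. \<bar>f w i - f w' i\<bar> < \<epsilon>)"
    and e: "\<epsilon> > 0"
  shows "\<exists>w. (\<forall>j<n. w j \<in> {0..1}) \<and> (\<forall>i<n. \<bar>f w i - w i\<bar> < \<epsilon>)"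
proof -
  obtain \<delta> where \<delta>: "\<delta> > 0" and uc: "\<And>w w'. (\<forall>j<n. w j \<in> {0..1} \<and> w' j \<in> {0..1} \<and> \<bar>w j - w' j\<bar> < \<delta>)
        \<Longrightarrow> (\<forall>i<n. \<bar>f w i - f w' i\<bar> < \<epsilon> / 2)"
    using cont[of "\<epsilon> / 2"] e by auto
  obtain p :: nat where p: "1 / real p < min \<delta> (\<epsilon> / 2)" "p > 0"
    using \<delta> e ex_inverse_of_nat_less[of "min \<delta> (\<epsilon> / 2)"]
    by (auto simp: inverse_eq_divide)
  define W where "W x j = real (x j) / real p" for x :: "nat \<Rightarrow> nat" and j
  \<comment> \<open>The clause \<open>x i = p\<close> gives the upper face the label that the boundary condition of the lemma prescribes.\<close>
  define lab :: "(nat \<Rightarrow> nat) \<Rightarrow> nat \<Rightarrow> nat"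
    where "lab x i = (if x i = p \<or> f (W x) i < W x i then 1 else 0)" for x i
  have W01: "\<forall>j<n. W x j \<in> {0..1}" if "\<forall>i<n. x i \<le> p" for x
    using that p(2) by (auto simp: W_def divide_le_eq)
  obtain q where q: "\<forall>i<n. q i < p"
    and qrs: "\<forall>i<n. \<exists>r s. (\<forall>j<n. q j \<le> r j \<and> r j \<le> q j + 1) \<and> (\<forall>j<n. q j \<le> s j \<and> s j \<le> q j + 1) \<and> lab r i \<noteq> lab s i"
  proof (rule kuhn_lemma[of p n lab])
    show "\<forall>x. (\<forall>i<n. x i \<le> p) \<longrightarrow> (\<forall>i<n. x i = 0 \<longrightarrow> lab x i = 0)"
    proof (intro allI impI)
      fix x i assume x: "\<forall>i<n. x i \<le> p" "i < n" "x i = 0"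
      have "f (W x) i \<ge> 0" using range[OF W01[OF x(1)] x(2)] by auto
      then show "lab x i = 0" using x p(2) by (auto simp: lab_def W_def)
    qed
  qed (auto simp: lab_def p(2))
  have "\<bar>f (W q) i - W q i\<bar> < \<epsilon>" if i: "i < n" for i
  proof -
    have close: "\<bar>f (W x) i - f (W q) i\<bar> < \<epsilon> / 2 \<and> \<bar>W x i - W q i\<bar> < \<epsilon> / 2 \<and> f (W x) i \<in> {0..1}"
      if x: "\<forall>j<n. q j \<le> x j \<and> x j \<le> q j + 1" for x
    proof -
      have qp: "\<forall>j<n. q j \<le> p" using q by (simp add: less_imp_le)
      have xp: "\<forall>j<n. x j \<le> p"
      proof (intro allI impI)
        fix j assume "j < n"
        then have "x j \<le> q j + 1" "q j < p" using x q by blast+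
        then show "x j \<le> p" by linarith
      qed
      have d: "\<bar>W x j - W q j\<bar> \<le> 1 / real p" if "j < n" for j
      proof -
        have "\<bar>real (x j) - real (q j)\<bar> \<le> 1" using x that by auto
        then show ?thesis using p(2) by (simp add: W_def diff_divide_distrib[symmetric] divide_right_mono)
      qed
      have "\<forall>i<n. \<bar>f (W x) i - f (W q) i\<bar> < \<epsilon> / 2"
      proof (rule uc, intro allI impI)
        fix j assume "j < n"
        then show "W x j \<in> {0..1} \<and> W q j \<in> {0..1} \<and> \<bar>W x j - W q j\<bar> < \<delta>"
          using W01[OF xp] W01[OF qp] d[of j] p by simp
      qed
      then show ?thesis using d[OF i] i p range[OF W01[OF xp] i] by auto
    qed
    obtain r s where rs: "\<forall>j<n. q j \<le> r j \<and> r j \<le> q j + 1" "\<forall>j<n. q j \<le> s j \<and> s j \<le> q j + 1"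
      "lab r i = 0" "lab s i = 1"
    proof -
      obtain r s where rs: "\<forall>j<n. q j \<le> r j \<and> r j \<le> q j + 1" "\<forall>j<n. q j \<le> s j \<and> s j \<le> q j + 1"
        "lab r i \<noteq> lab s i" using qrs i by blast
      have "lab x i = 0 \<or> lab x i = 1" for x by (simp add: lab_def)
      then show ?thesis using that[of r s] that[of s r] rs by metis
    qed
    have "f (W r) i \<ge> W r i" using rs(3) by (auto simp: lab_def split: if_splits)
    moreover have "f (W s) i \<le> W s i"
      using rs(4) close[OF rs(2)] p(2) by (auto simp: lab_def W_def split: if_splits)
    ultimately show ?thesis using close[OF rs(1)] close[OF rs(2)] by linarith
  qed
  moreover have "\<forall>j<n. W q j \<in> {0..1}" using W01 q by (simp add: less_imp_le)
  ultimately show ?thesis by blast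
qed

lemma compact_cube_combinations:
  fixes y :: "nat \<Rightarrow> 'a::real_normed_vector"
  shows "compact {\<Sum>j<m. w j *\<^sub>R y j | w. \<forall>j<m. w j \<in> {0..1}}"
proof (induction m)
  case 0
  then show ?case by simp
next
  case (Suc m)
  let ?K = "\<lambda>m. {\<Sum>j<m. w j *\<^sub>R y j | w. \<forall>j<m. w j \<in> {0..1::real}}"
  have "compact ((\<lambda>s. s *\<^sub>R y m) ` {0..1})"
    by (intro compact_continuous_image continuous_intros) auto
  from compact_sums[OF Suc this]
  have "compact {a + b |a b. a \<in> ?K m \<and> b \<in> (\<lambda>s. s *\<^sub>R y m) ` {0..1}}" .
  moreover have "{a + b |a b. a \<in> ?K m \<and> b \<in> (\<lambda>s. s *\<^sub>R y m) ` {0..1}} = ?K (Suc m)"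
  proof (intro equalityI subsetI)
    fix z assume "z \<in> {a + b |a b. a \<in> ?K m \<and> b \<in> (\<lambda>s. s *\<^sub>R y m) ` {0..1}}"
    then obtain w s where w: "\<forall>j<m. w j \<in> {0..1}" "s \<in> {0..1}" "z = (\<Sum>j<m. w j *\<^sub>R y j) + s *\<^sub>R y m"
      by auto
    have "z = (\<Sum>j<Suc m. (w(m := s)) j *\<^sub>R y j)" using w(3) by simp
    moreover have "\<forall>j<Suc m. (w(m := s)) j \<in> {0..1}" using w by auto
    ultimately show "z \<in> ?K (Suc m)" by blast
  next
    fix z assume "z \<in> ?K (Suc m)"
    then obtain w where w: "\<forall>j<Suc m. w j \<in> {0..1}" "z = (\<Sum>j<Suc m. w j *\<^sub>R y j)" by blast
    have "(\<Sum>j<m. w j *\<^sub>R y j) \<in> ?K m" using w(1) by (auto intro!: exI[of _ w])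
    moreover have "w m *\<^sub>R y m \<in> (\<lambda>s. s *\<^sub>R y m) ` {0..1}" using w(1) by blast
    moreover have "z = (\<Sum>j<m. w j *\<^sub>R y j) + w m *\<^sub>R y m" using w(2) by simp
    ultimately show "z \<in> {a + b |a b. a \<in> ?K m \<and> b \<in> (\<lambda>s. s *\<^sub>R y m) ` {0..1}}" by blast
  qed
  ultimately show ?case by simp
qed

text \<open>A partition of unity \<open>\<theta>\<close> subordinate to an \<open>\<epsilon> / 2\<close>-net \<open>y\<close> of \<open>K\<close> (the Schauder projection)
  reduces the problem to the weights: with \<open>Y w = \<Sum>j. w j *\<^sub>R y j\<close>, an approximate fixed point \<open>w\<close> of
  \<open>w \<mapsto> \<theta> (G (Y w))\<close> in the cube makes \<open>Y w\<close> an approximate fixed point of \<open>G\<close>. Working with all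
  weights in the cube, and not only with those of sum one, allows \<open>brouwer_cube_approx\<close> to be used.
  Compactness of \<open>K\<close> turns approximate fixed points into an exact one.\<close>

theorem schauder_fixed_point:
  fixes G :: "'a::real_normed_vector \<Rightarrow> 'a"
  assumes cont: "continuous_on UNIV G" and K: "compact K" and GK: "\<And>x. G x \<in> K"
  obtains x where "G x = x"
proof -
  have approx: "\<exists>x. dist (G x) x < \<epsilon>" if e: "\<epsilon> > 0" for \<epsilon>
  proof -
    have "\<forall>e>0. \<exists>k. finite k \<and> K \<subseteq> (\<Union>x\<in>k. ball x e)"
      using K unfolding compact_eq_totally_bounded by (rule conjunct2)
    then obtain F where F: "finite F" "K \<subseteq> (\<Union>x\<in>F. ball x (\<epsilon> / 2))"
      using e half_gt_zero by meson
    obtain y :: "nat \<Rightarrow> 'a" and m where y: "F = y ` {..<m}"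
      using finite_imp_nat_seg_image_inj_on[OF F(1)] unfolding lessThan_def by blast
    define b where "b z j = max 0 (\<epsilon> / 2 - dist (y j) z)" for z j
    define s where "s z = (\<Sum>j<m. b z j)" for z
    define \<theta> where "\<theta> z j = b z j / s z" for z j
    have b0: "b z j \<ge> 0" for z j by (simp add: b_def)
    have spos: "s z > 0" if "z \<in> K" for z
    proof -
      obtain j where j: "j < m" "dist (y j) z < \<epsilon> / 2" proof -
        have "z \<in> (\<Union>x\<in>F. ball x (\<epsilon> / 2))" using F(2) \<open>z \<in> K\<close> by blast
        then show ?thesis using that unfolding y by auto
      qed
      have "0 < b z j" using j by (simp add: b_def)
      also have "b z j \<le> s z" unfolding s_def using j b0 by (intro member_le_sum) auto
      finally show ?thesis .
    qed
    have \<theta>sum: "(\<Sum>j<m. \<theta> z j) = 1" if "z \<in> K" for z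
      using spos[OF that] by (simp add: \<theta>_def sum_divide_distrib[symmetric] s_def)
    have \<theta>0: "\<theta> z j \<ge> 0" if "z \<in> K" for z j
      using spos[OF that] b0 by (simp add: \<theta>_def)
    have \<theta>1: "\<theta> z j \<le> 1" if "z \<in> K" "j < m" for z j
    proof -
      have "\<theta> z j \<le> (\<Sum>j<m. \<theta> z j)" by (rule member_le_sum) (use that \<theta>0 in auto)
      then show ?thesis using \<theta>sum that by simp
    qed
    \<comment> \<open>Only net points within \<open>\<epsilon> / 2\<close> of \<open>z\<close> carry weight.\<close>
    have near: "dist z (\<Sum>j<m. \<theta> z j *\<^sub>R y j) \<le> \<epsilon> / 2" if z: "z \<in> K" for z
    proof -
      have "z - (\<Sum>j<m. \<theta> z j *\<^sub>R y j) = (\<Sum>j<m. \<theta> z j *\<^sub>R (z - y j))"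
        using \<theta>sum[OF z] by (simp add: scaleR_diff_right sum_subtractf scaleR_sum_left[symmetric])
      then have "dist z (\<Sum>j<m. \<theta> z j *\<^sub>R y j) \<le> (\<Sum>j<m. norm (\<theta> z j *\<^sub>R (z - y j)))"
        by (simp only: dist_norm norm_sum)
      also have "\<dots> \<le> (\<Sum>j<m. \<theta> z j * (\<epsilon> / 2))"
      proof (rule sum_mono)
        fix j assume "j \<in> {..<m}"
        show "norm (\<theta> z j *\<^sub>R (z - y j)) \<le> \<theta> z j * (\<epsilon> / 2)"
        proof (cases "dist (y j) z < \<epsilon> / 2")
          case True
          then have "norm (z - y j) \<le> \<epsilon> / 2" by (simp add: dist_norm norm_minus_commute)
          from mult_left_mono[OF this \<theta>0[OF z, of j]] show ?thesis
            using \<theta>0[OF z, of j] by simp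
        next
          case False
          then have "\<theta> z j = 0" by (simp add: \<theta>_def b_def)
          then show ?thesis by simp
        qed
      qed
      also have "\<dots> = \<epsilon> / 2" unfolding sum_distrib_right[symmetric] using \<theta>sum[OF z] by simp
      finally show ?thesis .
    qed
    have cb: "continuous_on K (\<lambda>z. \<theta> z j)" for j
      unfolding \<theta>_def
    proof (rule continuous_on_divide)
      show "\<forall>z\<in>K. s z \<noteq> 0" using spos by force
    qed (auto simp: b_def s_def intro!: continuous_intros)
    define Y where "Y w = (\<Sum>j<m. w j *\<^sub>R y j)" for w
    define Q where "Q = {\<Sum>j<m. w j *\<^sub>R y j | w. \<forall>j<m. w j \<in> {0..1::real}}"
    have Q: "compact Q" unfolding Q_def by (rule compact_cube_combinations)
    have YQ: "Y w \<in> Q" if "\<forall>j<m. w j \<in> {0..1}" for w using that by (auto simp: Y_def Q_def)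
    have "continuous_on Q (\<lambda>z. \<theta> (G z) i)" for i
      by (rule continuous_on_compose2[OF cb continuous_on_subset[OF cont]]) (use GK in auto)
    then have uc: "uniformly_continuous_on Q (\<lambda>z. \<theta> (G z) i)" for i
      using compact_uniformly_continuous Q by blast
    define R where "R = (\<Sum>j<m. norm (y j)) + 1"
    have R: "R > 0" unfolding R_def by (intro add_nonneg_pos sum_nonneg) auto
    have Ydist: "dist (Y w) (Y w') \<le> \<delta> * R" if "\<forall>j<m. \<bar>w j - w' j\<bar> < \<delta>" "\<delta> > 0" for w w' \<delta>
    proof -
      have "dist (Y w) (Y w') = norm (\<Sum>j<m. (w j - w' j) *\<^sub>R y j)"
        by (simp add: Y_def dist_norm sum_subtractf scaleR_diff_left)
      also have "\<dots> \<le> (\<Sum>j<m. norm ((w j - w' j) *\<^sub>R y j))" by (rule norm_sum)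
      also have "\<dots> \<le> (\<Sum>j<m. \<delta> * norm (y j))"
        using that by (intro sum_mono) (simp add: mult_right_mono less_imp_le)
      also have "\<dots> \<le> \<delta> * R" using that(2) by (simp add: R_def sum_distrib_left[symmetric])
      finally show ?thesis .
    qed
    have "\<exists>w. (\<forall>j<m. w j \<in> {0..1}) \<and> (\<forall>i<m. \<bar>\<theta> (G (Y w)) i - w i\<bar> < \<epsilon> / (2 * R))"
    proof (rule brouwer_cube_approx)
      show "\<theta> (G (Y w)) i \<in> {0..1}" if "i < m" for w i
        using \<theta>0 \<theta>1 GK that by auto
      fix \<eta> :: real assume \<eta>: "\<eta> > 0"
      have "\<exists>\<delta>>0. \<forall>z\<in>Q. \<forall>z'\<in>Q. dist z' z < \<delta> \<longrightarrow> \<bar>\<theta> (G z') i - \<theta> (G z) i\<bar> < \<eta>" for i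
        using uc[of i] \<eta> unfolding uniformly_continuous_on_def dist_real_def by blast
      then obtain \<delta> where \<delta>: "\<And>i. \<delta> i > 0"
        "\<And>i z z'. z \<in> Q \<Longrightarrow> z' \<in> Q \<Longrightarrow> dist z' z < \<delta> i \<Longrightarrow> \<bar>\<theta> (G z') i - \<theta> (G z) i\<bar> < \<eta>"
        by metis
      define \<delta>0 where "\<delta>0 = Min (insert 1 (\<delta> ` {..<m}))"
      have \<delta>0: "\<delta>0 > 0" "\<And>i. i < m \<Longrightarrow> \<delta>0 \<le> \<delta> i"
        using \<delta>(1) by (auto simp: \<delta>0_def)
      show "\<exists>\<delta>>0. \<forall>w w'. (\<forall>j<m. w j \<in> {0..1} \<and> w' j \<in> {0..1} \<and> \<bar>w j - w' j\<bar> < \<delta>)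
          \<longrightarrow> (\<forall>i<m. \<bar>\<theta> (G (Y w)) i - \<theta> (G (Y w')) i\<bar> < \<eta>)"
      proof (intro exI[of _ "\<delta>0 / (2 * R)"] conjI allI impI)
        show "\<delta>0 / (2 * R) > 0" using \<delta>0 R by simp
        fix w w' i assume w: "\<forall>j<m. w j \<in> {0..1} \<and> w' j \<in> {0..1} \<and> \<bar>w j - w' j\<bar> < \<delta>0 / (2 * R)" and i: "i < m"
        have "dist (Y w) (Y w') \<le> \<delta>0 / (2 * R) * R" using w \<delta>0 R by (intro Ydist) auto
        also have "\<dots> < \<delta> i" using \<delta>0(1) \<delta>0(2)[OF i] R by (simp add: field_simps)
        finally show "\<bar>\<theta> (G (Y w)) i - \<theta> (G (Y w')) i\<bar> < \<eta>"
          using w by (intro \<delta>(2) YQ) auto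
      qed
    qed (use e R in simp)
    then obtain w where w: "\<forall>j<m. \<bar>\<theta> (G (Y w)) j - w j\<bar> < \<epsilon> / (2 * R)" by blast
    \<comment> \<open>The estimate \<open>Ydist\<close> is not strict, so strictness is gained by shrinking the bound on the weights.\<close>
    have lt: "\<exists>e'<\<epsilon> / (2 * R). e' > 0 \<and> (\<forall>j<m. \<bar>\<theta> (G (Y w)) j - w j\<bar> < e')"
    proof -
      define M where "M = Max (insert 0 ((\<lambda>j. \<bar>\<theta> (G (Y w)) j - w j\<bar>) ` {..<m}))"
      have M: "M < \<epsilon> / (2 * R)" "M \<ge> 0" unfolding M_def using w e R by (auto simp: Max_less_iff)
      have M2: "\<bar>\<theta> (G (Y w)) j - w j\<bar> \<le> M" if "j < m" for j
        unfolding M_def using that by (intro Max_ge) auto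
      obtain e' where "M < e'" "e' < \<epsilon> / (2 * R)" using dense[OF M(1)] by blast
      then show ?thesis using M M2 by (intro exI[of _ e']) fastforce
    qed
    then obtain e' where e': "e' < \<epsilon> / (2 * R)" "e' > 0" "\<forall>j<m. \<bar>\<theta> (G (Y w)) j - w j\<bar> < e'" by blast
    have "dist (Y (\<theta> (G (Y w)))) (Y w) \<le> e' * R" using e' by (intro Ydist) auto
    also have "\<dots> < \<epsilon> / 2" using e' R by (simp add: field_simps)
    finally have "dist (Y (\<theta> (G (Y w)))) (Y w) < \<epsilon> / 2" .
    moreover have "dist (G (Y w)) (Y (\<theta> (G (Y w)))) \<le> \<epsilon> / 2" unfolding Y_def using near[OF GK] .
    ultimately have "dist (G (Y w)) (Y w) < \<epsilon>"
      using dist_triangle[of "G (Y w)" "Y w" "Y (\<theta> (G (Y w)))"] by linarith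
    then show ?thesis by blast
  qed
  then obtain x where x: "\<And>n. dist (G (x n)) (x n) < inverse (real (Suc n))"
  proof -
    have "\<forall>n. \<exists>x. dist (G x) x < inverse (real (Suc n))" by (intro allI approx) simp
    then show ?thesis using that by metis
  qed
  obtain l r where l: "l \<in> K" "strict_mono r" "((\<lambda>n. G (x n)) \<circ> r) \<longlonglongrightarrow> l"
    using K GK unfolding compact_def by (metis comp_apply)
  have "(\<lambda>n. G (x (r n)) - x (r n)) \<longlonglongrightarrow> 0"
  proof (rule Lim_null_comparison)
    show "(\<lambda>n. inverse (real (Suc (r n)))) \<longlonglongrightarrow> 0"
      using LIMSEQ_subseq_LIMSEQ[OF LIMSEQ_inverse_real_of_nat l(2)] by (simp add: o_def)
    show "\<forall>\<^sub>F n in sequentially. norm (G (x (r n)) - x (r n)) \<le> inverse (real (Suc (r n)))"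
      using x by (auto simp: dist_norm less_imp_le)
  qed
  from tendsto_diff[OF l(3) [unfolded o_def] this] have xl: "(\<lambda>n. x (r n)) \<longlonglongrightarrow> l" by simp
  have "(\<lambda>n. G (x (r n))) \<longlonglongrightarrow> G l"
    using cont xl by (auto simp: continuous_on_eq_continuous_at intro: isCont_tendsto_compose)
  then have "G l = l" using l(3) LIMSEQ_unique by (auto simp: o_def)
  then show ?thesis using that by blast
qed

section \<open>Riesz theory for injective compact perturbations of the identity\<close>

text \<open>The vector \<open>y\<close> is the normalized difference between \<open>z\<close> and an almost nearest point \<open>v\<close> of \<open>Y\<close>;
  the explicit formula for \<open>y\<close> keeps it in every subspace that contains both.\<close>

lemma riesz_almost_orthogonal:
  fixes Y :: "'a::real_normed_vector set"
  assumes Y: "closed Y" "subspace Y" and z: "z \<notin> Y"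
  obtains y v where "y = (1 / norm (z - v)) *\<^sub>R (z - v)" "v \<in> Y" "norm y = 1"
    "\<And>v. v \<in> Y \<Longrightarrow> 1 / 2 \<le> norm (y - v)"
proof -
  have ne: "Y \<noteq> {}" using subspace_0[OF Y(2)] by blast
  define \<delta> where "\<delta> = infdist z Y"
  have \<delta>: "\<delta> > 0"
    using in_closed_iff_infdist_zero[OF Y(1) ne, of z] infdist_nonneg[of z Y] z by (auto simp: \<delta>_def less_le)
  have "(INF v\<in>Y. dist z v) < 2 * \<delta>"
    using \<delta> ne by (simp add: \<delta>_def infdist_def)
  then obtain v where v: "v \<in> Y" "dist z v < 2 * \<delta>"
    using ne by (subst (asm) cINF_less_iff) (auto intro: bdd_belowI[of _ 0])
  define r where "r = norm (z - v)"
  have r: "r > 0" "r < 2 * \<delta>" using z v by (auto simp: r_def dist_norm)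
  define y where "y = (1 / r) *\<^sub>R (z - v)"
  have "1 / 2 \<le> norm (y - x)" if x: "x \<in> Y" for x
  proof -
    have "v + r *\<^sub>R x \<in> Y" using v x Y(2) by (intro subspace_add subspace_scale)
    then have "\<delta> \<le> dist z (v + r *\<^sub>R x)" unfolding \<delta>_def by (rule infdist_le)
    also have "\<dots> = norm (r *\<^sub>R (y - x))"
      using r by (simp add: y_def dist_norm scaleR_diff_right scaleR_add_right diff_diff_eq)
    also have "\<dots> = r * norm (y - x)" using r by simp
    finally have "\<delta> \<le> r * norm (y - x)" .
    also have "\<dots> \<le> 2 * \<delta> * norm (y - x)" using r by (intro mult_right_mono) auto
    finally show ?thesis using \<delta> by (simp add: field_simps)
  qed
  moreover have "norm y = 1" using r by (simp add: y_def r_def)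
  ultimately show ?thesis using that[of y v] v by (simp add: y_def r_def)
qed

text \<open>Let \<open>P = 1 - T\<close>. Injectivity and compactness make \<open>P\<close> bounded below, so all ranges
  \<open>Y n\<close> of the powers of \<open>P\<close> are closed. If \<open>P\<close> were not onto, these ranges would decrease strictly, and
  unit vectors of \<open>Y n\<close> almost orthogonal to \<open>Y (n + 1)\<close> would have images under \<open>T\<close> that stay
  at distance \<open>1 / 2\<close> from each other, contradicting compactness of \<open>T\<close>.\<close>

theorem riesz_fredholm:
  fixes T :: "'a::banach \<Rightarrow> 'a"
  assumes T: "bounded_linear T"
    and compact: "\<And>x :: nat \<Rightarrow> 'a. bounded (range x) \<Longrightarrow> \<exists>l r. strict_mono r \<and> (\<lambda>n. T (x (r n))) \<longlonglongrightarrow> l"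
    and inj: "\<And>x. T x = x \<Longrightarrow> x = 0"
  obtains S where "bounded_linear S" "\<And>x. S x - T (S x) = x" "\<And>x. S (x - T x) = x"
proof -
  interpret T: bounded_linear T by (rule T)
  define P where "P x = x - T x" for x
  have P: "bounded_linear P"
    unfolding P_def by (intro bounded_linear_sub bounded_linear_ident T)
  interpret P: bounded_linear P by (rule P)
  have "\<exists>c>0. \<forall>x. c * norm x \<le> norm (P x)"
  proof (rule ccontr)
    assume "\<not> ?thesis"
    then have "\<forall>n. \<exists>x. norm (P x) < inverse (real (Suc n)) * norm x"
      by (metis inverse_positive_iff_positive not_less of_nat_0_less_iff zero_less_Suc)
    then obtain x where x: "\<And>n. norm (P (x n)) < inverse (real (Suc n)) * norm (x n)" by metis
    define u where "u n = (1 / norm (x n)) *\<^sub>R x n" for n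
    have x0: "norm (x n) > 0" for n using x[of n] by (cases "x n = 0") (auto simp: P.zero)
    have u1: "norm (u n) = 1" for n using x0[of n] by (simp add: u_def)
    have "norm (P (u n)) \<le> inverse (real (Suc n))" for n
      using x[of n] x0[of n] by (simp add: u_def P.scaleR divide_le_eq less_imp_le)
    then have Pu: "(\<lambda>n. P (u n)) \<longlonglongrightarrow> 0"
      by (intro Lim_null_comparison[OF _ LIMSEQ_inverse_real_of_nat] always_eventually allI)
    have "bounded (range u)" using u1 by (auto simp: bounded_iff intro!: exI[of _ 1])
    then obtain l r where r: "strict_mono r" "(\<lambda>n. T (u (r n))) \<longlonglongrightarrow> l" using compact by blast
    have "(\<lambda>n. P (u (r n)) + T (u (r n))) \<longlonglongrightarrow> 0 + l"
      using LIMSEQ_subseq_LIMSEQ[OF Pu r(1)] r(2) by (intro tendsto_add) (auto simp: o_def)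
    then have ul: "(\<lambda>n. u (r n)) \<longlonglongrightarrow> l" by (simp add: P_def)
    have "T l = l" using LIMSEQ_unique[OF T.tendsto[OF ul] r(2)] .
    then have "l = 0" by (rule inj)
    moreover have "norm l = 1" using tendsto_norm[OF ul] u1 by (simp add: LIMSEQ_const_iff)
    ultimately show False by simp
  qed
  then obtain c where c: "c > 0" "\<And>x. c * norm x \<le> norm (P x)" by blast
  have Pinj: "P x = P y \<Longrightarrow> x = y" for x y
    using c(2)[of "x - y"] c(1) by (simp add: P.diff mult_le_0_iff)
  have Pn: "bounded_linear (P ^^ n) \<and> (\<forall>x. c ^ n * norm x \<le> norm ((P ^^ n) x))" for n
  proof (induction n)
    case 0
    then show ?case by (simp add: bounded_linear_ident id_def)
  next
    case (Suc n)
    have "c ^ Suc n * norm x \<le> norm ((P ^^ Suc n) x)" for x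
    proof -
      have "c * (c ^ n * norm x) \<le> c * norm ((P ^^ n) x)" using Suc c(1) by (intro mult_left_mono) auto
      also have "\<dots> \<le> norm (P ((P ^^ n) x))" by (rule c(2))
      finally show ?thesis by (simp add: mult.assoc)
    qed
    moreover have "bounded_linear (P ^^ Suc n)"
      using bounded_linear_compose[OF P, of "P ^^ n"] Suc by (simp add: o_def)
    ultimately show ?case by blast
  qed
  define Y where "Y n = range (P ^^ n)" for n
  have Ysub: "subspace (Y n)" for n
    unfolding Y_def using Pn[of n] by (intro linear_subspace_image) (auto simp: bounded_linear.linear)
  have Yclosed: "closed (Y n)" for n
    unfolding Y_def using complete_isometric_image[of "c ^ n" UNIV "P ^^ n"] Pn[of n] c(1)
    by (intro complete_imp_closed) (auto simp: complete_UNIV subspace_UNIV)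
  have Ymono: "Y m \<subseteq> Y n" if "n \<le> m" for m n
  proof -
    have "P ^^ m = P ^^ n \<circ> P ^^ (m - n)" using that funpow_add[of n "m - n" P] by simp
    then show ?thesis by (auto simp: Y_def)
  qed
  have PY: "P x \<in> Y (Suc n)" if "x \<in> Y n" for x n using that by (auto simp: Y_def)
  have surj: "\<exists>x. P x = z" for z
  proof (rule ccontr)
    assume nz: "\<nexists>x. P x = z"
    have nY: "(P ^^ n) z \<notin> Y (Suc n)" for n
    proof
      assume "(P ^^ n) z \<in> Y (Suc n)"
      then obtain x where "(P ^^ n) z = (P ^^ n) (P x)" by (auto simp: Y_def funpow_swap1)
      moreover have "inj (P ^^ n)" using Pinj by (intro inj_fn) (auto simp: inj_def)
      ultimately show False using nz by (auto simp: inj_def)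
    qed
    have "\<exists>y. y \<in> Y n \<and> norm y = 1 \<and> (\<forall>v\<in>Y (Suc n). 1 / 2 \<le> norm (y - v))" for n
    proof -
      obtain y v where y: "y = (1 / norm ((P ^^ n) z - v)) *\<^sub>R ((P ^^ n) z - v)" "v \<in> Y (Suc n)" "norm y = 1"
        "\<And>v. v \<in> Y (Suc n) \<Longrightarrow> 1 / 2 \<le> norm (y - v)"
        using riesz_almost_orthogonal[OF Yclosed Ysub nY, of n] by metis
      have "y \<in> Y n"
        unfolding y(1) using y(2) Ymono[of n "Suc n"] Ysub[of n]
        by (intro subspace_scale subspace_diff) (auto simp: Y_def)
      then show ?thesis using y by blast
    qed
    then obtain y where y: "\<And>n. y n \<in> Y n" "\<And>n. norm (y n) = 1"
      "\<And>n v. v \<in> Y (Suc n) \<Longrightarrow> 1 / 2 \<le> norm (y n - v)" by metis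
    have far: "1 / 2 \<le> norm (T (y n) - T (y m))" if "n < m" for n m
    proof -
      have "P (y n) + y m - P (y m) \<in> Y (Suc n)"
      proof (intro subspace_diff[OF Ysub] subspace_add[OF Ysub] PY)
        show "y n \<in> Y n" by (rule y)
        show "y m \<in> Y (Suc n)" using y(1)[of m] Ymono[of "Suc n" m] that by auto
        show "y m \<in> Y n" using y(1)[of m] Ymono[of n m] that by auto
      qed
      from y(3)[OF this] show ?thesis by (simp add: P_def algebra_simps)
    qed
    have "bounded (range y)" using y(2) by (auto simp: bounded_iff intro!: exI[of _ 1])
    then obtain l r where r: "strict_mono r" "(\<lambda>n. T (y (r n))) \<longlonglongrightarrow> l" using compact by blast
    then have "Cauchy (\<lambda>n. T (y (r n)))" by (auto intro: LIMSEQ_imp_Cauchy)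
    then obtain M where "\<forall>m\<ge>M. \<forall>n\<ge>M. norm (T (y (r m)) - T (y (r n))) < 1 / 2"
      by (metis CauchyD half_gt_zero_iff zero_less_one)
    then have "norm (T (y (r M)) - T (y (r (Suc M)))) < 1 / 2" by simp
    then show False using far[of "r M" "r (Suc M)"] r(1) by (simp add: strict_mono_def)
  qed
  define S where "S z = (SOME x. P x = z)" for z
  have PS: "P (S z) = z" for z unfolding S_def by (rule someI_ex) (rule surj)
  have SP: "S (P x) = x" for x using PS Pinj by blast
  have "bounded_linear S"
  proof (rule bounded_linear_intro[where K = "1 / c"])
    show "S (x + y) = S x + S y" for x y by (rule Pinj) (simp add: P.add PS)
    show "S (a *\<^sub>R x) = a *\<^sub>R S x" for a x by (rule Pinj) (simp add: P.scaleR PS)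
    show "norm (S x) \<le> norm x * (1 / c)" for x using c(2)[of "S x"] c(1) by (simp add: PS field_simps)
  qed
  then show ?thesis using that[of S] PS SP by (simp add: P_def)
qed

section \<open>Curves of class \<open>C\<^sup>k\<close>\<close>

text \<open>The derivative is quantified anew at every level. In this form, closure under an operation is proved
  by one induction on \<open>k\<close> using the first-order rule only; the coherent family of derivatives
  that \<open>smooth_curve_on\<close> asks for is recovered in \<open>Ck_curves_smooth\<close>.\<close>

fun Ck_curve :: "nat \<Rightarrow> real set \<Rightarrow> (real \<Rightarrow> 'a::real_normed_vector) \<Rightarrow> bool" where
  "Ck_curve 0 T g \<longleftrightarrow> continuous_on T g"
| "Ck_curve (Suc k) T g \<longleftrightarrow>
     (\<exists>g'. (\<forall>t\<in>T. (g has_vector_derivative g' t) (at t within T)) \<and> Ck_curve k T g')"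

lemma Ck_curve_SucI:
  "(\<And>t. t \<in> T \<Longrightarrow> (g has_vector_derivative g' t) (at t within T)) \<Longrightarrow> Ck_curve k T g' \<Longrightarrow> Ck_curve (Suc k) T g"
  by auto

lemma Ck_curve_SucE:
  assumes "Ck_curve (Suc k) T g"
  obtains g' where "\<And>t. t \<in> T \<Longrightarrow> (g has_vector_derivative g' t) (at t within T)" "Ck_curve k T g'"
  using assms by auto

lemma has_vector_derivative_imp_continuous_on:
  "(\<And>t. t \<in> T \<Longrightarrow> (g has_vector_derivative g' t) (at t within T)) \<Longrightarrow> continuous_on T g"
  by (auto simp: continuous_on_eq_continuous_within intro: has_vector_derivative_continuous)

lemma Ck_curve_continuous: "Ck_curve k T g \<Longrightarrow> continuous_on T g"
  by (cases k) (auto intro: has_vector_derivative_imp_continuous_on)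

lemma Ck_curve_Suc: "Ck_curve (Suc k) T g \<Longrightarrow> Ck_curve k T g"
proof (induction k arbitrary: g)
  case 0
  then show ?case by (auto intro: has_vector_derivative_imp_continuous_on)
next
  case (Suc k)
  then show ?case by (metis Ck_curve.simps(2))
qed

lemma Ck_curve_cong:
  assumes "\<And>t. t \<in> T \<Longrightarrow> g t = h t" "Ck_curve k T g"
  shows "Ck_curve k T h"
proof (cases k)
  case 0
  then show ?thesis using assms continuous_on_cong[of T T g h] by simp
next
  case (Suc j)
  have "(h has_vector_derivative D) (at t within T)"
    if "t \<in> T" "(g has_vector_derivative D) (at t within T)" for t D
    using that assms(1) by (metis has_vector_derivative_transform)
  then show ?thesis using assms(2) unfolding Suc Ck_curve.simps by blast
qed

lemma Ck_curve_const: "Ck_curve k T (\<lambda>_. c)"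
  by (induction k arbitrary: c) (auto intro!: exI[of _ "\<lambda>_. 0"])

lemma Ck_curve_ident: "Ck_curve k T (\<lambda>t. t)"
  by (cases k) (auto intro!: exI[of _ "\<lambda>_. 1"] Ck_curve_const has_vector_derivative_id)

lemma Ck_curve_add:
  "Ck_curve k T g \<Longrightarrow> Ck_curve k T h \<Longrightarrow> Ck_curve k T (\<lambda>t. g t + h t)"
proof (induction k arbitrary: g h)
  case 0
  then show ?case by (auto intro: continuous_on_add)
next
  case (Suc k)
  from Suc.prems obtain g' h' where
    "\<And>t. t \<in> T \<Longrightarrow> (g has_vector_derivative g' t) (at t within T)" "Ck_curve k T g'"
    "\<And>t. t \<in> T \<Longrightarrow> (h has_vector_derivative h' t) (at t within T)" "Ck_curve k T h'"
    by (metis Ck_curve_SucE)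
  then show ?case
    by (intro Ck_curve_SucI[of _ _ "\<lambda>t. g' t + h' t"] has_vector_derivative_add Suc.IH) auto
qed

lemma Ck_curve_linear:
  assumes L: "bounded_linear L"
  shows "Ck_curve k T g \<Longrightarrow> Ck_curve k T (\<lambda>t. L (g t))"
proof (induction k arbitrary: g)
  case 0
  then show ?case using bounded_linear.continuous_on[OF L] by auto
next
  case (Suc k)
  from Suc.prems obtain g' where
    "\<And>t. t \<in> T \<Longrightarrow> (g has_vector_derivative g' t) (at t within T)" "Ck_curve k T g'"
    by (metis Ck_curve_SucE)
  then show ?case
    by (intro Ck_curve_SucI[of _ _ "\<lambda>t. L (g' t)"] bounded_linear.has_vector_derivative[OF L] Suc.IH) auto
qed

lemma Ck_curve_bilinear:
  assumes B: "bounded_bilinear B"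
  shows "Ck_curve k T g \<Longrightarrow> Ck_curve k T h \<Longrightarrow> Ck_curve k T (\<lambda>t. B (g t) (h t))"
proof (induction k arbitrary: g h)
  case 0
  then show ?case using bounded_bilinear.continuous_on[OF B] by auto
next
  case (Suc k)
  from Suc.prems obtain g' h' where d:
    "\<And>t. t \<in> T \<Longrightarrow> (g has_vector_derivative g' t) (at t within T)" "Ck_curve k T g'"
    "\<And>t. t \<in> T \<Longrightarrow> (h has_vector_derivative h' t) (at t within T)" "Ck_curve k T h'"
    by (metis Ck_curve_SucE)
  have "Ck_curve k T g" "Ck_curve k T h" using Suc.prems by (simp_all only: Ck_curve_Suc)
  then show ?case using d
    by (intro Ck_curve_SucI[of _ _ "\<lambda>t. B (g t) (h' t) + B (g' t) (h t)"]
        bounded_bilinear.has_vector_derivative[OF B] Suc.IH Ck_curve_add) auto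
qed

text \<open>On the open set \<open>T\<close> derivatives are unique, so iterating \<open>vector_derivative\<close> selects the same
  functions as the witnesses hidden in \<open>Ck_curve\<close> at all levels.\<close>

lemma Ck_curves_smooth:
  assumes g: "\<And>k. Ck_curve k T g" and T: "open T" and ST: "S \<subseteq> T"
  shows "smooth_curve_on S g"
proof -
  define D where "D k = ((\<lambda>h t. vector_derivative h (at t)) ^^ k) g" for k
  have D: "(\<forall>t\<in>T. (D k has_vector_derivative D (Suc k) t) (at t)) \<and> Ck_curve n T (D k)" for k n
  proof (induction k arbitrary: n)
    have step: "\<forall>t\<in>T. (h has_vector_derivative vector_derivative h (at t)) (at t)"
      "Ck_curve n T (\<lambda>t. vector_derivative h (at t))" if h: "\<And>n. Ck_curve n T h" for h :: "real \<Rightarrow> 'a" and n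
    proof -
      obtain h' where h': "\<And>t. t \<in> T \<Longrightarrow> (h has_vector_derivative h' t) (at t within T)" "Ck_curve n T h'"
        using h Ck_curve_SucE by metis
      have d: "(h has_vector_derivative h' t) (at t)" if "t \<in> T" for t
        using h'(1)[OF that] at_within_open[OF that T] by simp
      then have eq: "vector_derivative h (at t) = h' t" if "t \<in> T" for t
        using vector_derivative_at that by blast
      show "\<forall>t\<in>T. (h has_vector_derivative vector_derivative h (at t)) (at t)" using d eq by auto
      show "Ck_curve n T (\<lambda>t. vector_derivative h (at t))"
        by (rule Ck_curve_cong[OF _ h'(2)]) (simp add: eq)
    qed
    {
      case 0
      then show ?case using step[OF g] g by (simp add: D_def)
    next
      case (Suc k)
      have "\<And>n. Ck_curve n T (D (Suc k))" using step(2)[of "D k"] Suc by (simp add: D_def)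
      then show ?case using step(1)[of "D (Suc k)"] by (simp add: D_def)
    }
  qed
  show ?thesis
    unfolding smooth_curve_on_def
  proof (intro exI[of _ D] conjI allI ballI)
    show "D 0 t = g t" for t by (simp add: D_def)
    show "(D k has_vector_derivative D (Suc k) t) (at t within S)" if "t \<in> S" for k t
      using D that ST by (blast intro: has_vector_derivative_at_within)
  qed
qed

section \<open>Regularity of fixed points depending on a parameter\<close>

lemma contractive_linear_fixed_point:
  fixes A :: "'a::banach \<Rightarrow>\<^sub>L 'a"
  assumes "norm A \<le> 1 / 2"
  shows "\<exists>!z. z = c + A z"
proof -
  have "\<forall>x y. dist (c + A x) (c + A y) \<le> 1 / 2 * dist x y"
  proof (intro allI)
    fix x y
    have "norm (A (x - y)) \<le> norm A * norm (x - y)" by (rule norm_blinfun)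
    also have "\<dots> \<le> 1 / 2 * norm (x - y)" using assms by (intro mult_right_mono) auto
    finally show "dist (c + A x) (c + A y) \<le> 1 / 2 * dist x y" by (simp add: dist_norm blinfun.diff_right)
  qed
  then have "\<exists>!z. c + A z = z" by (intro banach_fix_type[of "1 / 2"]) auto
  then show ?thesis by metis
qed

text \<open>Every estimate for a fixed point of a contraction below ends with a term bounded by half of the
  quantity being estimated; this absorbs it.\<close>

lemma norm_le_of_half_absorbed:
  fixes x :: "'a::real_normed_vector"
  assumes "x = a + b + w" "norm a \<le> p" "norm b \<le> q" "norm w \<le> 1 / 2 * norm x"
  shows "norm x \<le> 2 * (p + q)"
proof -
  have "norm x \<le> norm (a + b) + norm w" by (subst assms(1)) (rule norm_triangle_ineq)
  moreover have "norm (a + b) \<le> norm a + norm b" by (rule norm_triangle_ineq)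
  ultimately have "norm x \<le> (p + q) + 1 / 2 * norm x" using assms(2-4) by linarith
  then show ?thesis by simp
qed

text \<open>Formal differentiation of \<open>z = c + A z\<close> gives \<open>z' = (c' + A' z) + A z'\<close>, which is an equation of the
  same form with data of one order less. Its solution \<open>y\<close> exists because \<open>A\<close> is a contraction, it is the
  derivative of \<open>z\<close> because the difference quotients satisfy the same equation up to vanishing
  terms, and the induction hypothesis gives its regularity.\<close>

lemma Ck_curve_linear_fixed_point:
  fixes A :: "real \<Rightarrow> ('a::banach \<Rightarrow>\<^sub>L 'a)"
  assumes "Ck_curve k T c" "Ck_curve k T A" "\<And>t. t \<in> T \<Longrightarrow> norm (A t) \<le> 1 / 2"
    and "\<And>t. t \<in> T \<Longrightarrow> z t = c t + A t (z t)"
  shows "Ck_curve k T z"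
  using assms(1,2,4)
proof (induction k arbitrary: c z)
  have half: "norm (A t x) \<le> 1 / 2 * norm x" if "t \<in> T" for t x
    using norm_blinfun[of "A t" x] mult_right_mono[OF assms(3)[OF that], of "norm x"] by simp
  have ev: "\<forall>\<^sub>F s in at t within T. Q s" if "\<And>s. s \<in> T \<Longrightarrow> s \<noteq> t \<Longrightarrow> Q s" for Q and t :: real
    using that by (simp add: eventually_at_filter)
  {
    case 0
    have "continuous (at t within T) z" if t: "t \<in> T" for t
    proof -
      have le: "norm (z s - z t) \<le> 2 * (norm (c s - c t) + norm (A s - A t) * norm (z t))" if s: "s \<in> T" for s
      proof (rule norm_le_of_half_absorbed)
        show "z s - z t = (c s - c t) + (A s - A t) (z t) + A s (z s - z t)"
          by (subst 0(3)[OF s], subst 0(3)[OF t]) (simp add: blinfun.diff_left blinfun.diff_right)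
      qed (rule order.refl norm_blinfun half[OF s])+
      have "(c \<longlongrightarrow> c t) (at t within T)" "(A \<longlongrightarrow> A t) (at t within T)"
        using 0(1,2) t by (simp_all add: continuous_on_def)
      then have "((\<lambda>s. 2 * (norm (c s - c t) + norm (A s - A t) * norm (z t)))
          \<longlongrightarrow> 2 * (norm (c t - c t) + norm (A t - A t) * norm (z t))) (at t within T)"
        by (intro tendsto_intros)
      then have lim: "((\<lambda>s. 2 * (norm (c s - c t) + norm (A s - A t) * norm (z t))) \<longlongrightarrow> 0) (at t within T)" by simp
      have "((\<lambda>s. z s - z t) \<longlongrightarrow> 0) (at t within T)"
        by (rule Lim_null_comparison[OF _ lim]) (rule ev, rule le)
      then show ?thesis by (simp add: continuous_within LIM_zero_iff)
    qed
    then show ?case by (simp add: continuous_on_eq_continuous_within)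
  next
    case (Suc k)
    have z: "Ck_curve k T z"
      by (rule Suc.IH[OF Suc.prems(1)[THEN Ck_curve_Suc] Suc.prems(2)[THEN Ck_curve_Suc] Suc.prems(3)])
    obtain c' where c': "\<And>t. t \<in> T \<Longrightarrow> (c has_vector_derivative c' t) (at t within T)" "Ck_curve k T c'"
      using Suc.prems(1) by (metis Ck_curve_SucE)
    obtain A' where A': "\<And>t. t \<in> T \<Longrightarrow> (A has_vector_derivative A' t) (at t within T)" "Ck_curve k T A'"
      using Suc.prems(2) by (metis Ck_curve_SucE)
    define y where "y t = (THE y. y = (c' t + A' t (z t)) + A t y)" for t
    have y: "y t = (c' t + A' t (z t)) + A t (y t)" if "t \<in> T" for t
      unfolding y_def by (rule theI'[OF contractive_linear_fixed_point[OF assms(3)[OF that]]])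
    have yC: "Ck_curve k T y"
    proof (rule Suc.IH)
      show "Ck_curve k T (\<lambda>t. c' t + A' t (z t))"
        by (intro Ck_curve_add c' Ck_curve_bilinear[OF bounded_bilinear_blinfun_apply] A' z)
      show "Ck_curve k T A" using Suc.prems(2) by (rule Ck_curve_Suc)
      show "\<And>t. t \<in> T \<Longrightarrow> y t = (c' t + A' t (z t)) + A t (y t)" by (rule y)
    qed
    have "(z has_vector_derivative y t) (at t within T)" if t: "t \<in> T" for t
    proof -
      \<comment> \<open>Normalized remainders of the first-order expansions at \<open>t\<close>.\<close>
      define R where "R f f' s = (1 / norm (s - t)) *\<^sub>R (f s - (f t + (s - t) *\<^sub>R f'))"
        for f :: "real \<Rightarrow> 'a" and f' s
      define R2 where "R2 s = (1 / norm (s - t)) *\<^sub>R (A s - (A t + (s - t) *\<^sub>R A' t))" for s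
      define \<sigma> where "\<sigma> s = (s - t) / norm (s - t)" for s
      have le: "norm (R z (y t) s) \<le> 2 * ((norm (R c (c' t) s)
          + norm (R2 s) * norm (z t)) + norm (A s - A t) * norm (y t))"
        if s: "s \<in> T" "s \<noteq> t" for s
      proof (rule norm_le_of_half_absorbed)
        have "z s - (z t + (s - t) *\<^sub>R y t) = ((c s - (c t + (s - t) *\<^sub>R c' t)) + (A s - (A t + (s - t) *\<^sub>R A' t)) (z t))
            + (s - t) *\<^sub>R (A s - A t) (y t) + A s (z s - (z t + (s - t) *\<^sub>R y t))"
        proof -
          have 1: "A s (z s - (z t + (s - t) *\<^sub>R y t)) = A s (z s) - A s (z t) - (s - t) *\<^sub>R A s (y t)"
            by (simp add: blinfun.diff_right blinfun.add_right blinfun.scaleR_right)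
          have 2: "(A s - (A t + (s - t) *\<^sub>R A' t)) (z t) = A s (z t) - A t (z t) - (s - t) *\<^sub>R A' t (z t)"
            by (simp add: blinfun.diff_left blinfun.add_left blinfun.scaleR_left)
          have 3: "(s - t) *\<^sub>R (A s - A t) (y t) = (s - t) *\<^sub>R A s (y t) - (s - t) *\<^sub>R A t (y t)"
            by (simp add: blinfun.diff_left scaleR_diff_right)
          have 4: "(s - t) *\<^sub>R y t = (s - t) *\<^sub>R c' t + (s - t) *\<^sub>R A' t (z t) + (s - t) *\<^sub>R A t (y t)"
            by (subst y[OF t]) (simp add: scaleR_add_right)
          have 5: "A s (z s) = z s - c s" "A t (z t) = z t - c t"
            using Suc.prems(3)[OF s(1)] Suc.prems(3)[OF t] by (simp_all add: algebra_simps)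
          show ?thesis unfolding 1 2 3 5 by (simp add: 4)
        qed
        then have "R z (y t) s = (1 / norm (s - t)) *\<^sub>R (((c s - (c t + (s - t) *\<^sub>R c' t)) + (A s - (A t + (s - t) *\<^sub>R A' t)) (z t))
            + (s - t) *\<^sub>R (A s - A t) (y t) + A s (z s - (z t + (s - t) *\<^sub>R y t)))"
          unfolding R_def by (rule arg_cong)
        also have "\<dots> = (R c (c' t) s + R2 s (z t)) + \<sigma> s *\<^sub>R (A s - A t) (y t) + A s (R z (y t) s)"
          by (simp add: R_def R2_def \<sigma>_def scaleR_add_right blinfun.scaleR_left blinfun.scaleR_right)
        finally show "R z (y t) s = (R c (c' t) s + R2 s (z t)) + \<sigma> s *\<^sub>R (A s - A t) (y t) + A s (R z (y t) s)" .
        have "norm (R c (c' t) s + R2 s (z t)) \<le> norm (R c (c' t) s) + norm (R2 s (z t))" by (rule norm_triangle_ineq)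
        then show "norm (R c (c' t) s + R2 s (z t)) \<le> norm (R c (c' t) s) + norm (R2 s) * norm (z t)"
          using norm_blinfun[of "R2 s" "z t"] by linarith
        show "norm (\<sigma> s *\<^sub>R (A s - A t) (y t)) \<le> norm (A s - A t) * norm (y t)"
          using s norm_blinfun[of "A s - A t" "y t"] by (simp add: \<sigma>_def)
      qed (rule half[OF s(1)])
      have 1: "(R c (c' t) \<longlongrightarrow> 0) (at t within T)"
        using c'(1)[OF t] unfolding has_vector_derivative_def has_derivative_within R_def by simp
      have 2: "(R2 \<longlongrightarrow> 0) (at t within T)"
        using A'(1)[OF t] unfolding has_vector_derivative_def has_derivative_within R2_def by simp
      have 3: "(A \<longlongrightarrow> A t) (at t within T)"
        using Ck_curve_continuous[OF Suc.prems(2)] t by (simp add: continuous_on_def)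
      have "((\<lambda>s. 2 * ((norm (R c (c' t) s) + norm (R2 s) * norm (z t)) + norm (A s - A t) * norm (y t)))
          \<longlongrightarrow> 2 * ((norm (0::'a) + norm (0::'a \<Rightarrow>\<^sub>L 'a) * norm (z t)) + norm (A t - A t) * norm (y t))) (at t within T)"
        by (intro tendsto_intros 1 2 3)
      then have lim: "((\<lambda>s. 2 * ((norm (R c (c' t) s) + norm (R2 s) * norm (z t)) + norm (A s - A t) * norm (y t))) \<longlongrightarrow> 0) (at t within T)"
        by simp
      have "(R z (y t) \<longlongrightarrow> 0) (at t within T)"
        by (rule Lim_null_comparison[OF _ lim]) (rule ev, rule le)
      then show ?thesis
        unfolding has_vector_derivative_def has_derivative_within R_def
        by (simp add: bounded_linear_scaleR_left)
    qed
    then show ?case using yC by (rule Ck_curve_SucI)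
  }
qed

section \<open>Compact maps and a replacement for the Leray-Schauder degree\<close>

definition compact_map :: "('a::real_normed_vector \<Rightarrow> 'b::real_normed_vector) \<Rightarrow> bool" where
  "compact_map F \<longleftrightarrow>
     (\<forall>x :: nat \<Rightarrow> 'a. bounded (range x) \<longrightarrow> (\<exists>l r. strict_mono r \<and> (\<lambda>n. F (x (r n))) \<longlonglongrightarrow> l))"

lemma compact_mapE:
  assumes "compact_map F" "bounded (range x)"
  obtains l and r :: "nat \<Rightarrow> nat" where "strict_mono r" "(\<lambda>n. F (x (r n))) \<longlonglongrightarrow> l"
  using assms unfolding compact_map_def by blast

lemma compact_map_closure:
  assumes F: "compact_map F" and S: "bounded S"
  shows "compact (closure (F ` S))"
  unfolding compact_def
proof (intro allI impI)
  fix y :: "nat \<Rightarrow> 'b" assume y: "\<forall>n. y n \<in> closure (F ` S)"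
  have "\<exists>x\<in>S. dist (F x) (y n) < inverse (real (Suc n))" for n
  proof -
    have "\<forall>e>0. \<exists>z\<in>F ` S. dist z (y n) < e"
      using y unfolding closure_approachable by blast
    moreover have "inverse (real (Suc n)) > 0" by simp
    ultimately show ?thesis by blast
  qed
  then obtain x where x: "\<And>n. x n \<in> S" "\<And>n. dist (F (x n)) (y n) < inverse (real (Suc n))" by metis
  have "bounded (range x)" using x(1) by (intro bounded_subset[OF S]) auto
  then obtain l and r :: "nat \<Rightarrow> nat" where r: "strict_mono r" "(\<lambda>n. F (x (r n))) \<longlonglongrightarrow> l"
    using compact_mapE[OF F] by blast
  have "(\<lambda>n. y (r n) - F (x (r n))) \<longlonglongrightarrow> 0"
  proof (rule Lim_null_comparison)
    show "(\<lambda>n. inverse (real (Suc (r n)))) \<longlonglongrightarrow> 0"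
      using LIMSEQ_subseq_LIMSEQ[OF LIMSEQ_inverse_real_of_nat r(1)] by (simp add: o_def)
    show "\<forall>\<^sub>F n in sequentially. norm (y (r n) - F (x (r n))) \<le> inverse (real (Suc (r n)))"
      using x(2) by (intro always_eventually allI) (simp add: dist_norm norm_minus_commute less_imp_le)
  qed
  from tendsto_add[OF this r(2)] have yl: "(\<lambda>n. y (r n)) \<longlonglongrightarrow> l" by simp
  moreover have "l \<in> closure (F ` S)"
    using closed_sequentially[OF closed_closure _ yl] y by blast
  ultimately show "\<exists>l\<in>closure (F ` S). \<exists>r. strict_mono r \<and> (y \<circ> r) \<longlonglongrightarrow> l"
    using r(1) by (auto simp: o_def)
qed

lemma compact_closed_separated:
  fixes Z W :: "'a::metric_space set"
  assumes "compact Z" "closed W" "Z \<inter> W = {}"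
  obtains \<delta> where "\<delta> > 0" "\<And>w. w \<in> W \<Longrightarrow> Z \<noteq> {} \<Longrightarrow> \<delta> \<le> infdist w Z"
proof (cases "Z = {} \<or> W = {}")
  case True
  then show ?thesis using that[of 1] by auto
next
  case False
  have "continuous_on Z (\<lambda>z. infdist z W)" by (intro continuous_intros)
  then obtain z0 where z0: "z0 \<in> Z" "\<And>z. z \<in> Z \<Longrightarrow> infdist z0 W \<le> infdist z W"
    using continuous_attains_inf[OF assms(1)] False by metis
  have "infdist z0 W \<noteq> 0" using in_closed_iff_infdist_zero[OF assms(2)] False z0(1) assms(3) by blast
  then have pos: "infdist z0 W > 0" using infdist_nonneg[of z0 W] by linarith
  have "infdist z0 W \<le> infdist w Z" if w: "w \<in> W" for w
  proof -
    have "infdist z0 W \<le> dist w z" if "z \<in> Z" for z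
      using z0(2)[OF that] infdist_le[OF w, of z] by (simp add: dist_commute)
    then show ?thesis using False by (auto simp: infdist_def intro!: cINF_greatest)
  qed
  then show ?thesis using that pos by blast
qed

text \<open>This takes the place of homotopy invariance of the degree: over \<open>[0,T]\<close>, the solution set of
  \<open>x = t w + N x\<close> has no compact relatively open piece \<open>Z\<close> that stays below \<open>T\<close> and meets \<open>t = 0\<close> only
  in the solution \<open>0\<close>, near which \<open>N\<close> halves norms.

  The map \<open>G (t, x) = (\<alpha>, \<mu> (t w + N x))\<close> has values in a compact set, so it has a fixed point \<open>p\<close>.
  The weights depend on the distance \<open>q\<close> to \<open>Z\<close>: \<open>\<alpha>\<close> falls from \<open>T\<close> on \<open>Z\<close> to \<open>0\<close> at distance \<open>\<delta>\<close>, and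
  \<open>\<mu>\<close> is \<open>1\<close> up to distance \<open>\<delta>\<close> and \<open>0\<close> from \<open>2 \<delta>\<close> on. Within distance \<open>\<delta>\<close>, \<open>p\<close> solves the equation, hence
  lies in \<open>Z\<close>, so its first component is \<open>T\<close>, which \<open>Z\<close> excludes. Beyond distance \<open>\<delta>\<close> the first
  component is \<open>0\<close> and the second one is \<open>\<mu> N x\<close>, which forces \<open>x = 0\<close>; but \<open>(0, 0)\<close> belongs to \<open>Z\<close>.\<close>

lemma no_isolated_compact_solution_set:
  fixes N :: "'a::real_normed_vector \<Rightarrow> 'a"
  assumes contN: "continuous_on UNIV N" and compN: "compact_map N"
    and Z: "compact Z" and W: "compact W" and disj: "Z \<inter> W = {}"
    and ZW: "{(t, x). 0 \<le> t \<and> t \<le> T \<and> x = t *\<^sub>R w + N x} = Z \<union> W"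
    and ZT: "\<And>t x. (t, x) \<in> Z \<Longrightarrow> t < T"
    and Z0: "(0, 0) \<in> Z" "\<And>x. (0, x) \<in> Z \<Longrightarrow> x = 0"
    and r: "r > 0" "\<And>x. norm x \<le> r \<Longrightarrow> norm (N x) \<le> norm x / 2"
  shows False
proof -
  have Zne: "Z \<noteq> {}" using Z0 by blast
  have T: "T > 0" using ZT[OF Z0(1)] .
  obtain \<delta>1 where \<delta>1: "\<delta>1 > 0" "\<And>p. p \<in> W \<Longrightarrow> \<delta>1 \<le> infdist p Z"
    using compact_closed_separated[OF Z compact_imp_closed[OF W] disj] Zne by metis
  \<comment> \<open>Points with \<open>t = 0\<close> and \<open>r \<le> norm x\<close>, where \<open>N\<close> may increase norms, stay at least \<open>2 * \<delta>\<close> away from \<open>Z\<close>.\<close>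
  have "closed ({0::real} \<times> {x::'a. r \<le> norm x})"
    by (intro closed_Times closed_Collect_le continuous_intros closed_singleton)
  moreover have "Z \<inter> {0} \<times> {x. r \<le> norm x} = {}" using Z0(2) r(1) by fastforce
  ultimately obtain \<delta>2 where \<delta>2: "\<delta>2 > 0" "\<And>p. p \<in> {0} \<times> {x. r \<le> norm x} \<Longrightarrow> \<delta>2 \<le> infdist p Z"
    using compact_closed_separated[OF Z] Zne by metis
  define \<delta> where "\<delta> = min \<delta>1 \<delta>2 / 2"
  have \<delta>: "\<delta> > 0" "\<delta> < \<delta>1" "2 * \<delta> \<le> \<delta>2" using \<delta>1 \<delta>2 by (auto simp: \<delta>_def)
  define q where "q p = infdist p Z" for p
  have qc: "continuous_on UNIV q" unfolding q_def by (intro continuous_intros)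
  define \<alpha> where "\<alpha> p = T * max 0 (1 - q p / \<delta>)" for p
  define \<mu> where "\<mu> p = max 0 (min 1 (2 - q p / \<delta>))" for p
  define G where "G p = (\<alpha> p, \<mu> p *\<^sub>R (fst p *\<^sub>R w + N (snd p)))" for p
  have q0: "q p \<ge> 0" for p by (simp add: q_def infdist_nonneg)
  have \<alpha>01: "0 \<le> \<alpha> p \<and> \<alpha> p \<le> T" for p
    using T q0[of p] \<delta>(1) by (auto simp: \<alpha>_def max_def mult_le_cancel_left1 field_simps)
  have \<mu>01: "0 \<le> \<mu> p \<and> \<mu> p \<le> 1" for p by (simp add: \<mu>_def)
  have \<mu>0: "\<mu> p = 0" if "q p \<ge> 2 * \<delta>" for p using that \<delta>(1) by (simp add: \<mu>_def field_simps)
  have \<mu>1: "\<mu> p = 1" if "q p \<le> \<delta>" for p using that \<delta>(1) by (simp add: \<mu>_def field_simps)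
  have \<alpha>0: "\<alpha> p = 0" if "q p \<ge> \<delta>" for p using that \<delta>(1) by (simp add: \<alpha>_def field_simps)
  obtain B where B: "\<And>p. p \<in> Z \<Longrightarrow> norm p \<le> B" using compact_imp_bounded[OF Z] by (auto simp: bounded_iff)
  define R where "R = B + 2 * \<delta>"
  have near: "\<bar>fst p\<bar> \<le> R \<and> norm (snd p) \<le> R" if "q p < 2 * \<delta>" for p
  proof -
    obtain z where z: "z \<in> Z" "dist p z < 2 * \<delta>"
    proof -
      have "(INF z\<in>Z. dist p z) < 2 * \<delta>" using \<open>q p < 2 * \<delta>\<close> Zne by (simp add: q_def infdist_def)
      then show ?thesis
        using that Zne by (subst (asm) cINF_less_iff) (auto intro: bdd_belowI[of _ 0])
    qed
    have "norm p \<le> norm z + dist p z" using norm_triangle_sub[of p z] by (simp add: dist_norm)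
    then have "norm p \<le> R" using B[OF z(1)] z(2) by (simp add: R_def)
    then show ?thesis using norm_fst_le[of "fst p" "snd p"] norm_snd_le[of "snd p" "fst p"] by auto
  qed
  define A where "A = (\<lambda>t. t *\<^sub>R w) ` {-R..R}"
  define D where "D = closure (N ` cball 0 R)"
  define C where "C = {a + b | a b. a \<in> A \<and> b \<in> D}"
  define K where "K = {0..T} \<times> (\<lambda>(s, v). s *\<^sub>R v) ` ({0..1} \<times> C)"
  have "compact C" unfolding C_def A_def D_def
    by (intro compact_sums compact_continuous_image continuous_intros compact_map_closure[OF compN]) auto
  then have K: "compact K" unfolding K_def
    by (intro compact_Times compact_continuous_image) (auto simp: case_prod_unfold intro!: continuous_intros)
  have inC: "t *\<^sub>R w + N x \<in> C" if "\<bar>t\<bar> \<le> R" "norm x \<le> R" for t x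
  proof -
    have "t *\<^sub>R w \<in> A" using that unfolding A_def by (intro imageI) auto
    moreover have "N x \<in> D" using that closure_subset[of "N ` cball 0 R"] by (auto simp: D_def)
    ultimately show ?thesis unfolding C_def by blast
  qed
  have "G p \<in> K" for p
  proof (cases "q p < 2 * \<delta>")
    case True
    then have "fst p *\<^sub>R w + N (snd p) \<in> C" using near inC by blast
    then have "\<mu> p *\<^sub>R (fst p *\<^sub>R w + N (snd p)) \<in> (\<lambda>(s, v). s *\<^sub>R v) ` ({0..1} \<times> C)"
      using \<mu>01[of p] by (intro image_eqI[of _ _ "(\<mu> p, fst p *\<^sub>R w + N (snd p))"]) auto
    then show ?thesis using \<alpha>01[of p] by (simp add: G_def K_def)
  next
    case False
    have "q (0, 0) = 0" using Z0(1) by (simp add: q_def)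
    then have "0 *\<^sub>R w + N 0 \<in> C" using near[of "(0,0)"] \<delta>(1) by (intro inC) auto
    then have "0 \<in> (\<lambda>(s, v). s *\<^sub>R v) ` ({0..1} \<times> C)" by (intro image_eqI[of _ _ "(0, 0 *\<^sub>R w + N 0)"]) auto
    then show ?thesis using \<mu>0[of p] False \<alpha>01[of p] by (simp add: G_def K_def)
  qed
  moreover have "continuous_on UNIV G"
    unfolding G_def \<alpha>_def \<mu>_def
    by (intro continuous_intros continuous_on_compose2[OF contN] continuous_on_compose2[OF qc])
      (use \<delta> in auto)
  ultimately obtain p where "G p = p" using schauder_fixed_point K by metis
  then obtain t x where p: "p = (t, x)" "t = \<alpha> p" "x = \<mu> p *\<^sub>R (t *\<^sub>R w + N x)"
  proof -
    obtain t x where tx: "p = (t, x)" by (cases p)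
    have "t = fst (G p)" "x = snd (G p)" unfolding \<open>G p = p\<close> by (simp_all add: tx)
    then have "t = \<alpha> p" "x = \<mu> p *\<^sub>R (fst p *\<^sub>R w + N (snd p))" unfolding G_def by (simp_all only: fst_conv snd_conv)
    moreover have "fst p = t" "snd p = x" unfolding tx by (simp_all only: fst_conv snd_conv)
    ultimately show ?thesis using that[OF tx] by (simp only:)
  qed
  show False
  proof (cases "q p \<le> \<delta>")
    case True
    then have "\<mu> p = 1" by (rule \<mu>1)
    with p(3) have "x = t *\<^sub>R w + N x" by (simp only: scaleR_one)
    then have "p \<in> Z \<union> W" using \<alpha>01[of p] unfolding ZW[symmetric] p(2)[symmetric] by (simp add: p(1))
    then have "p \<in> Z" using \<delta>1(2)[of p] True \<delta>(2) by (auto simp: q_def)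
    then have "\<alpha> p = T" by (simp add: \<alpha>_def q_def)
    then show False using ZT[of t x] \<open>p \<in> Z\<close> p(1) p(2)[symmetric] by simp
  next
    case False
    then have "\<alpha> p = 0" by (intro \<alpha>0) simp
    then have t: "t = 0" using p(2) by (simp only:)
    have "x = 0"
    proof (cases "q p < 2 * \<delta>")
      case True
      have "norm x < r"
      proof (rule ccontr)
        assume "\<not> norm x < r"
        then have "\<delta>2 \<le> q p" unfolding q_def by (intro \<delta>2(2)) (simp add: p(1) t)
        then show False using True \<delta>(3) by linarith
      qed
      then have "norm (N x) \<le> norm x / 2" using r(2) by simp
      moreover have "norm x \<le> norm (N x)"
      proof -
        have "norm x = \<mu> p * norm (N x)" using \<mu>01[of p] by (subst p(3)) (simp add: t)
        then show ?thesis using \<mu>01[of p] mult_right_mono[of "\<mu> p" 1 "norm (N x)"] by simp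
      qed
      ultimately have "norm x \<le> 0" by linarith
      then show ?thesis by simp
    next
      case False
      then have "\<mu> p = 0" by (intro \<mu>0) simp
      with p(3) show ?thesis by (simp only: scaleR_zero_left)
    qed
    then have "q p = 0" using Z0(1) t p(1) by (simp add: q_def)
    then show False using False \<delta>(1) by simp
  qed
qed

section \<open>The local branch\<close>

text \<open>Existence and uniqueness come from the contraction principle on the ball of radius \<open>r / 2\<close>. The
  derivative \<open>y\<close> of the branch \<open>\<xi>\<close> solves the linear equation \<open>y = w + DN (\<xi> t) y\<close>, whose data are as regular
  as \<open>\<xi>\<close>, so \<open>Ck_curve_linear_fixed_point\<close> gains one derivative at a time.\<close>

lemma local_solution_curve:
  fixes N :: "'a::banach \<Rightarrow> 'a"
  assumes DN: "\<And>x. (N has_derivative blinfun_apply (DN x)) (at x)"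
    and r: "r > 0" "\<And>x. norm x \<le> r \<Longrightarrow> norm (DN x) \<le> 1 / 2"
    and N0: "N 0 = 0"
    and Ck: "\<And>k T x. Ck_curve k T x \<Longrightarrow> Ck_curve k T (\<lambda>t. DN (x t))"
  obtains \<epsilon> \<xi> where "\<epsilon> > 0" "\<And>k. Ck_curve k {-\<epsilon><..<\<epsilon>} \<xi>" "\<xi> 0 = 0"
    "\<And>t. \<bar>t\<bar> < \<epsilon> \<Longrightarrow> norm (\<xi> t) < r"
    "\<And>t x. \<bar>t\<bar> < \<epsilon> \<Longrightarrow> norm x < r \<Longrightarrow> x = t *\<^sub>R w + N x \<longleftrightarrow> x = \<xi> t"
proof -
  have lip: "norm (N x - N y) \<le> 1 / 2 * norm (x - y)" if "norm x \<le> r" "norm y \<le> r" for x y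
  proof (rule differentiable_bound[of "cball 0 r" N "\<lambda>x. blinfun_apply (DN x)"])
    show "(N has_derivative blinfun_apply (DN x)) (at x within cball 0 r)" for x
      using DN by (rule has_derivative_at_withinI)
    show "onorm (blinfun_apply (DN x)) \<le> 1 / 2" if "x \<in> cball 0 r" for x
      using r(2)[of x] that by (simp add: norm_blinfun.rep_eq)
  qed (use that in auto)
  \<comment> \<open>With this choice \<open>t *\<^sub>R w\<close> has norm at most \<open>r / 4\<close>, and the ball of radius \<open>r / 2\<close> is mapped to itself.\<close>
  define \<epsilon> where "\<epsilon> = r / (4 * (norm w + 1))"
  have \<epsilon>: "\<epsilon> > 0" using r(1) by (simp add: \<epsilon>_def add_nonneg_pos)
  have tw: "norm (t *\<^sub>R w) \<le> r / 4" if "\<bar>t\<bar> < \<epsilon>" for t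
  proof -
    have "\<bar>t\<bar> * norm w \<le> \<epsilon> * (norm w + 1)" using that \<epsilon> by (intro mult_mono) auto
    also have "\<dots> = r / 4"
      using add_nonneg_pos[OF norm_ge_zero[of w] zero_less_one] unfolding \<epsilon>_def
      by (simp del: distrib_left_numeral)
    finally show ?thesis by simp
  qed
  have Nle: "norm (N x) \<le> 1 / 2 * norm x" if "norm x \<le> r" for x
    using lip[of x 0] that r(1) N0 by simp
  have ex1: "\<exists>!x. x \<in> cball 0 (r / 2) \<and> t *\<^sub>R w + N x = x" if t: "\<bar>t\<bar> < \<epsilon>" for t
  proof (rule Banach_fix[of _ "1 / 2"])
    show "complete (cball (0::'a) (r / 2))" by (simp add: complete_eq_closed)
    show "cball (0::'a) (r / 2) \<noteq> {}" using r(1) by simp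
    show "(\<lambda>x. t *\<^sub>R w + N x) ` cball 0 (r / 2) \<subseteq> cball 0 (r / 2)"
    proof (intro subsetI, elim imageE)
      fix y x assume x: "y = t *\<^sub>R w + N x" "x \<in> cball 0 (r / 2)"
      have "norm y \<le> norm (t *\<^sub>R w) + norm (N x)" unfolding x(1) by (rule norm_triangle_ineq)
      then show "y \<in> cball 0 (r / 2)" using tw[OF t] Nle[of x] x(2) r(1) by simp
    qed
    show "dist (t *\<^sub>R w + N x) (t *\<^sub>R w + N y) \<le> 1 / 2 * dist x y"
      if "x \<in> cball 0 (r / 2)" "y \<in> cball 0 (r / 2)" for x y
      using lip[of x y] that r(1) by (simp add: dist_norm)
  qed auto
  define \<xi> where "\<xi> t = (THE x. x \<in> cball 0 (r / 2) \<and> t *\<^sub>R w + N x = x)" for t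
  have \<xi>: "norm (\<xi> t) \<le> r / 2" "\<xi> t = t *\<^sub>R w + N (\<xi> t)" if "\<bar>t\<bar> < \<epsilon>" for t
    using theI'[OF ex1[OF that]] unfolding \<xi>_def[symmetric] by auto
  have uniq: "x = \<xi> t" if "\<bar>t\<bar> < \<epsilon>" "norm x < r" "x = t *\<^sub>R w + N x" for t x
  proof -
    have "norm x \<le> norm (t *\<^sub>R w) + norm (N x)" by (subst that(3)) (rule norm_triangle_ineq)
    then have "norm x \<le> r / 2" using tw[OF that(1)] Nle[of x] that(2) by simp
    then show ?thesis using ex1[OF that(1)] \<xi>[OF that(1)] that(3) by (metis dist_0_norm mem_cball)
  qed
  have \<xi>lip: "norm (\<xi> s - \<xi> t) \<le> 2 * (norm w * \<bar>s - t\<bar>)" if "\<bar>s\<bar> < \<epsilon>" "\<bar>t\<bar> < \<epsilon>" for s t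
  proof -
    have "\<xi> s - \<xi> t = (s - t) *\<^sub>R w + 0 + (N (\<xi> s) - N (\<xi> t))"
      by (subst \<xi>(2)[OF that(1)], subst \<xi>(2)[OF that(2)]) (simp add: scaleR_diff_left)
    then have "norm (\<xi> s - \<xi> t) \<le> 2 * (norm w * \<bar>s - t\<bar> + 0)"
    proof (rule norm_le_of_half_absorbed)
      show "norm (N (\<xi> s) - N (\<xi> t)) \<le> 1 / 2 * norm (\<xi> s - \<xi> t)"
        using \<xi>(1)[OF that(1)] \<xi>(1)[OF that(2)] r(1) by (intro lip) auto
    qed auto
    then show ?thesis by simp
  qed
  let ?I = "{-\<epsilon><..<\<epsilon>}"
  define y where "y t = (THE y. y = w + DN (\<xi> t) y)" for t
  have A12: "norm (DN (\<xi> t)) \<le> 1 / 2" if "\<bar>t\<bar> < \<epsilon>" for t using \<xi>(1)[OF that] r by simp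
  have y: "y t = w + DN (\<xi> t) (y t)" if "\<bar>t\<bar> < \<epsilon>" for t
    unfolding y_def by (rule theI'[OF contractive_linear_fixed_point[OF A12[OF that]]])
  have deriv: "(\<xi> has_vector_derivative y t) (at t within ?I)" if t': "t \<in> ?I" for t
    unfolding has_vector_derivative_def has_derivative_within_alt
  proof (intro conjI allI impI bounded_linear_scaleR_left)
    have t: "\<bar>t\<bar> < \<epsilon>" using t' by auto
    fix e :: real assume e: "e > 0"
    define e' where "e' = e / (4 * (norm w + 1))"
    have e': "e' > 0" using e by (simp add: e'_def add_nonneg_pos)
    obtain d where d: "d > 0" "\<And>x. norm (x - \<xi> t) < d \<Longrightarrow>
        norm (N x - N (\<xi> t) - DN (\<xi> t) (x - \<xi> t)) \<le> e' * norm (x - \<xi> t)"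
      using DN[of "\<xi> t", unfolded has_derivative_at_alt] e' by blast
    define d' where "d' = d / (2 * (norm w + 1))"
    have d': "d' > 0" using d(1) by (simp add: d'_def add_nonneg_pos)
    show "\<exists>d>0. \<forall>s\<in>?I. norm (s - t) < d \<longrightarrow>
        norm (\<xi> s - \<xi> t - (s - t) *\<^sub>R y t) \<le> e * norm (s - t)"
    proof (intro exI[of _ d'] conjI ballI impI d')
      fix s assume s': "s \<in> ?I" and sd: "norm (s - t) < d'"
      have s: "\<bar>s\<bar> < \<epsilon>" using s' by auto
      have w1: "norm w + 1 > 0" by (simp add: add_nonneg_pos)
      have "norm (\<xi> s - \<xi> t) \<le> 2 * (norm w * \<bar>s - t\<bar>)" by (rule \<xi>lip[OF s t])
      also have "\<dots> \<le> 2 * ((norm w + 1) * \<bar>s - t\<bar>)" by (simp add: mult_right_mono)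
      finally have l: "norm (\<xi> s - \<xi> t) \<le> 2 * (norm w + 1) * \<bar>s - t\<bar>" by (simp only: mult.assoc)
      also have "\<dots> < d" using sd w1 by (simp add: d'_def field_simps)
      finally have "norm (N (\<xi> s) - N (\<xi> t) - DN (\<xi> t) (\<xi> s - \<xi> t)) \<le> e' * norm (\<xi> s - \<xi> t)" by (rule d(2))
      also have "\<dots> \<le> e' * (2 * (norm w + 1) * \<bar>s - t\<bar>)" using l e' by (intro mult_left_mono) auto
      also have "\<dots> = e / 2 * \<bar>s - t\<bar>" using w1 by (simp add: e'_def field_simps)
      finally have q: "norm (N (\<xi> s) - N (\<xi> t) - DN (\<xi> t) (\<xi> s - \<xi> t)) \<le> e / 2 * \<bar>s - t\<bar>" .
      have "norm (\<xi> s - \<xi> t - (s - t) *\<^sub>R y t) \<le> 2 * (e / 2 * \<bar>s - t\<bar> + 0)"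
      proof (rule norm_le_of_half_absorbed)
        show "\<xi> s - \<xi> t - (s - t) *\<^sub>R y t = (N (\<xi> s) - N (\<xi> t) - DN (\<xi> t) (\<xi> s - \<xi> t)) + 0
            + DN (\<xi> t) (\<xi> s - \<xi> t - (s - t) *\<^sub>R y t)"
        proof -
          have 1: "\<xi> s - \<xi> t = (s - t) *\<^sub>R w + (N (\<xi> s) - N (\<xi> t))"
            by (subst \<xi>(2)[OF s], subst \<xi>(2)[OF t]) (simp add: scaleR_diff_left)
          have 2: "(s - t) *\<^sub>R y t = (s - t) *\<^sub>R w + (s - t) *\<^sub>R DN (\<xi> t) (y t)"
            by (subst y[OF t]) (simp add: scaleR_add_right)
          have 3: "DN (\<xi> t) (\<xi> s - \<xi> t - (s - t) *\<^sub>R y t)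
              = DN (\<xi> t) (\<xi> s - \<xi> t) - (s - t) *\<^sub>R DN (\<xi> t) (y t)"
            by (simp add: blinfun.diff_right[of _ "\<xi> s - \<xi> t"] blinfun.scaleR_right)
          have "\<xi> s - \<xi> t - (s - t) *\<^sub>R y t
              = (N (\<xi> s) - N (\<xi> t)) - (s - t) *\<^sub>R DN (\<xi> t) (y t)"
            unfolding 2 using 1 by (simp add: algebra_simps)
          then show ?thesis unfolding 3 by simp
        qed
        show "norm (DN (\<xi> t) (\<xi> s - \<xi> t - (s - t) *\<^sub>R y t)) \<le> 1 / 2 * norm (\<xi> s - \<xi> t - (s - t) *\<^sub>R y t)"
          by (rule order_trans[OF norm_blinfun mult_right_mono[OF A12[OF t]]]) simp
      qed (use q in auto)
      then show "norm (\<xi> s - \<xi> t - (s - t) *\<^sub>R y t) \<le> e * norm (s - t)" by simp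
    qed
  qed
  have smooth: "Ck_curve k ?I \<xi>" for k
  proof (induction k)
    case 0
    show ?case using has_vector_derivative_imp_continuous_on[OF deriv] by simp
  next
    case (Suc k)
    have "Ck_curve k ?I y"
    proof (rule Ck_curve_linear_fixed_point[OF Ck_curve_const Ck[OF Suc]])
      show "y t = w + DN (\<xi> t) (y t)" if "t \<in> ?I" for t using that by (intro y) auto
    qed (use A12 in auto)
    with deriv show ?case by (rule Ck_curve_SucI)
  qed
  have "\<xi> 0 = 0" using uniq[of 0 0] \<epsilon> r(1) N0 by simp
  moreover have "norm (\<xi> t) < r" if "\<bar>t\<bar> < \<epsilon>" for t using \<xi>(1)[OF that] r(1) by simp
  moreover have "x = t *\<^sub>R w + N x \<longleftrightarrow> x = \<xi> t" if "\<bar>t\<bar> < \<epsilon>" "norm x < r" for t x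
    using uniq[OF that] \<xi>(2)[OF that(1)] by auto
  ultimately show ?thesis using that[of \<epsilon> \<xi>] \<epsilon> smooth by blast
qed

section \<open>Global continuation for compact nonlinear equations\<close>

lemma compact_map_continuous_compose:
  assumes "compact_map F" "continuous_on UNIV g"
  shows "compact_map (\<lambda>x. g (F x))"
  unfolding compact_map_def
proof (intro allI impI)
  fix x :: "nat \<Rightarrow> 'a" assume "bounded (range x)"
  then obtain l and r :: "nat \<Rightarrow> nat" where "strict_mono r" "(\<lambda>n. F (x (r n))) \<longlonglongrightarrow> l"
    using compact_mapE[OF assms(1)] by blast
  moreover have "isCont g l" using assms(2) by (simp add: continuous_on_eq_continuous_at)
  ultimately show "\<exists>l r. strict_mono r \<and> (\<lambda>n. g (F (x (r n)))) \<longlonglongrightarrow> l"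
    using isCont_tendsto_compose[of l g] by blast
qed

lemma compact_map_compose_bounded:
  assumes "compact_map F" "\<And>S. bounded S \<Longrightarrow> bounded (g ` S)"
  shows "compact_map (\<lambda>x. F (g x))"
  unfolding compact_map_def
proof (intro allI impI)
  fix x :: "nat \<Rightarrow> 'c" assume "bounded (range x)"
  then have "bounded (range (\<lambda>n. g (x n)))" using assms(2) by (metis image_image)
  then show "\<exists>l r. strict_mono r \<and> (\<lambda>n. F (g (x (r n)))) \<longlonglongrightarrow> l"
    using assms(1) unfolding compact_map_def by blast
qed

lemma compact_map_diff:
  assumes "compact_map F" "compact_map G"
  shows "compact_map (\<lambda>x. F x - G x)"
  unfolding compact_map_def
proof (intro allI impI)
  fix x :: "nat \<Rightarrow> 'a" assume x: "bounded (range x)"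
  then obtain l and r :: "nat \<Rightarrow> nat" where r: "strict_mono r" "(\<lambda>n. F (x (r n))) \<longlonglongrightarrow> l"
    using compact_mapE[OF assms(1)] by blast
  have "bounded (range (\<lambda>n. x (r n)))" by (rule bounded_subset[OF x]) auto
  then obtain m and s :: "nat \<Rightarrow> nat" where s: "strict_mono s" "(\<lambda>n. G (x (r (s n)))) \<longlonglongrightarrow> m"
    using compact_mapE[OF assms(2)] by blast
  have "(\<lambda>n. F (x (r (s n)))) \<longlonglongrightarrow> l" using LIMSEQ_subseq_LIMSEQ[OF r(2) s(1)] by (simp add: o_def)
  from tendsto_diff[OF this s(2)] strict_mono_o[OF r(1) s(1)]
  show "\<exists>l r. strict_mono r \<and> (\<lambda>n. F (x (r n)) - G (x (r n))) \<longlonglongrightarrow> l"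
    by (intro exI[of _ "l - m"] exI[of _ "r \<circ> s"]) (auto simp: o_def)
qed

lemma maximal_continuum_component:
  assumes "closed A" "x \<in> A"
  shows "maximal_continuum A x (connected_component_set A x)"
  unfolding maximal_continuum_def
proof (intro conjI allI impI)
  show "closed (connected_component_set A x)" using assms(1) by (rule closed_connected_component)
  show "x \<in> connected_component_set A x" using assms(2) by simp
  show "D \<subseteq> connected_component_set A x" if "closed D \<and> connected D \<and> D \<subseteq> A \<and> x \<in> D" for D
    using that by (intro connected_component_maximal) auto
qed (simp_all add: connected_component_subset)

definition continuum_alternative :: "(real \<times> 'a::real_normed_vector) set \<Rightarrow> 'a \<Rightarrow> bool" where
  "continuum_alternative A u \<longleftrightarrow>
    (\<exists>C. maximal_continuum (A \<inter> {0..} \<times> UNIV) (0, u) C \<and>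
        (\<exists>\<epsilon>>0. \<exists>U g. open U \<and> (0, u) \<in> U \<and> smooth_curve_on {0..<\<epsilon>} g \<and>
           C \<inter> U = (\<lambda>t. (t, g t)) ` {0..<\<epsilon>}) \<and>
        (\<forall>M>0. bounded (C \<inter> {0..M} \<times> UNIV)) \<and>
        (fst ` C = {0..} \<or> (\<exists>v. v \<noteq> u \<and> (0, v) \<in> C)))"

text \<open>The equation is \<open>u = t E + M (\<iota> u)\<close>. The map \<open>M\<close> gains the regularity that the compact map \<open>\<iota>\<close>
  loses, so the equation can be studied for \<open>u\<close> in \<open>'y\<close> or for \<open>\<iota> u\<close> in the Banach space \<open>'x\<close>. Contractions and
  Riesz theory are used in \<open>'x\<close>; solutions and
  their curve are read off in \<open>'y\<close>. Smoothness of \<open>M\<close> is expressed through its action on curves.\<close>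

locale continuation_problem =
  fixes \<iota> :: "'y::real_normed_vector \<Rightarrow> 'x::banach"
    and M :: "'x \<Rightarrow> 'y" and DM :: "'x \<Rightarrow> 'x \<Rightarrow>\<^sub>L 'y" and E U0 :: 'y
  assumes \<iota>: "bounded_linear \<iota>" and \<iota>_compact: "compact_map \<iota>"
    and DM: "\<And>x. (M has_derivative blinfun_apply (DM x)) (at x)"
    and DM_cont: "continuous_on UNIV DM"
    and M_Ck: "\<And>k T x. Ck_curve k T x \<Longrightarrow> Ck_curve k T (\<lambda>t. M (x t))"
    and DM_Ck: "\<And>k T x. Ck_curve k T x \<Longrightarrow> Ck_curve k T (\<lambda>t. DM (x t))"
    and M_bounded: "\<And>S. bounded S \<Longrightarrow> bounded (M ` S)"
    and U0: "M (\<iota> U0) = U0"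
    and nondegenerate: "\<And>\<phi>. DM (\<iota> U0) (\<iota> \<phi>) = \<phi> \<Longrightarrow> \<phi> = 0"
    and a_priori: "\<And>R. bounded {(t, u). \<bar>t\<bar> \<le> R \<and> u = t *\<^sub>R E + M (\<iota> u)}"
begin

definition solutions :: "(real \<times> 'y) set" where
  "solutions = {(t, u). u = t *\<^sub>R E + M (\<iota> u)}"

sublocale \<iota>: bounded_linear \<iota> by (rule \<iota>)

lemma bounded_solutions: "bounded (solutions \<inter> {a..b} \<times> UNIV)"
proof (rule bounded_subset)
  have "solutions \<inter> {p. \<bar>fst p\<bar> \<le> R} = {(t, u). \<bar>t\<bar> \<le> R \<and> u = t *\<^sub>R E + M (\<iota> u)}" for R
    unfolding solutions_def case_prod_unfold by blast
  then show "bounded (solutions \<inter> {p. \<bar>fst p\<bar> \<le> max \<bar>a\<bar> \<bar>b\<bar>})" using a_priori by simp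
qed auto

lemma M_cont: "continuous_on UNIV M"
  using has_derivative_continuous[OF DM] by (simp add: continuous_on_eq_continuous_at)

lemma closed_solutions: "closed solutions"
  unfolding solutions_def case_prod_unfold
  by (intro closed_Collect_eq continuous_intros continuous_on_compose2[OF M_cont] \<iota>.continuous_on) auto

lemma compact_solutions: "compact (solutions \<inter> {a..b} \<times> UNIV)"
  unfolding compact_def
proof (intro allI impI)
  fix p :: "nat \<Rightarrow> real \<times> 'y" assume p: "\<forall>n. p n \<in> solutions \<inter> {a..b} \<times> UNIV"
  define t where "t n = fst (p n)" for n
  define u where "u n = snd (p n)" for n
  have tu: "t n \<in> {a..b}" "u n = t n *\<^sub>R E + M (\<iota> (u n))" for n
    using p[rule_format, of n] unfolding solutions_def t_def u_def case_prod_unfold by auto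
  have "bounded (range p)" by (rule bounded_subset[OF bounded_solutions[of a b]]) (use p in blast)
  then have "bounded (snd ` range p)" by (rule bounded_snd)
  then have "bounded (range u)" by (simp add: image_image u_def)
  then obtain l and r :: "nat \<Rightarrow> nat" where r: "strict_mono r" "(\<lambda>n. \<iota> (u (r n))) \<longlonglongrightarrow> l"
    using compact_mapE[OF \<iota>_compact] by blast
  have "\<forall>n. t (r n) \<in> {a..b}" using tu by blast
  then obtain t0 s where s: "t0 \<in> {a..b}" "strict_mono s" "((\<lambda>n. t (r n)) \<circ> s) \<longlonglongrightarrow> t0"
    using compact_Icc[of a b] unfolding compact_def by metis
  have t_lim: "(\<lambda>n. t (r (s n))) \<longlonglongrightarrow> t0" using s(3) by (simp add: o_def)
  have "(\<lambda>n. \<iota> (u (r (s n)))) \<longlonglongrightarrow> l" using LIMSEQ_subseq_LIMSEQ[OF r(2) s(2)] by (simp add: o_def)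
  then have "(\<lambda>n. M (\<iota> (u (r (s n))))) \<longlonglongrightarrow> M l"
    using M_cont by (auto simp: continuous_on_eq_continuous_at intro: isCont_tendsto_compose)
  then have "(\<lambda>n. t (r (s n)) *\<^sub>R E + M (\<iota> (u (r (s n))))) \<longlonglongrightarrow> t0 *\<^sub>R E + M l"
    by (intro tendsto_intros t_lim)
  then have "(\<lambda>n. u (r (s n))) \<longlonglongrightarrow> t0 *\<^sub>R E + M l" unfolding tu(2)[symmetric] .
  from tendsto_Pair[OF t_lim this] have lim: "(p \<circ> (r \<circ> s)) \<longlonglongrightarrow> (t0, t0 *\<^sub>R E + M l)"
    by (simp add: o_def t_def u_def)
  have "closed (solutions \<inter> {a..b} \<times> UNIV)"
    by (intro closed_Int closed_solutions closed_Times) auto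
  from closed_sequentially[OF this _ lim] p have "(t0, t0 *\<^sub>R E + M l) \<in> solutions \<inter> {a..b} \<times> UNIV" by auto
  then show "\<exists>l\<in>solutions \<inter> {a..b} \<times> UNIV. \<exists>r. strict_mono r \<and> (p \<circ> r) \<longlonglongrightarrow> l"
    using lim strict_mono_o[OF r(1) s(2)] by blast
qed

text \<open>With \<open>x = \<iota> u - \<iota> U0\<close> and \<open>T = \<iota> DM (\<iota> U0)\<close>, the equation \<open>\<iota> u = \<iota> (t E + M (\<iota> u))\<close> is multiplied by
  the inverse \<open>S\<close> of \<open>1 - T\<close>, which exists by \<open>riesz_fredholm\<close>. This removes the linear part of the
  nonlinearity at the origin: \<open>DN 0 = 0\<close>.\<close>

lemma preconditioned_equation:
  obtains w N DN r where
    "\<And>t x. x = t *\<^sub>R w + N x \<longleftrightarrow> \<iota> U0 + x = \<iota> (t *\<^sub>R E + M (\<iota> U0 + x))"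
    "\<And>x. (N has_derivative blinfun_apply (DN x)) (at x)" "N 0 = 0" "compact_map N"
    "\<And>k T x. Ck_curve k T x \<Longrightarrow> Ck_curve k T (\<lambda>t. DN (x t))"
    "r > 0" "\<And>x. norm x \<le> r \<Longrightarrow> norm (DN x) \<le> 1 / 2"
proof -
  define x0 where "x0 = \<iota> U0"
  define T where "T x = \<iota> (DM x0 x)" for x
  have T: "bounded_linear T"
    unfolding T_def by (intro bounded_linear_compose[OF \<iota>] blinfun.bounded_linear_right)
  have Tc: "compact_map T"
    unfolding T_def
    by (rule compact_map_compose_bounded[OF \<iota>_compact])
      (rule bounded_linear_image[OF _ blinfun.bounded_linear_right])
  have inj: "x = 0" if "T x = x" for x
  proof -
    have "DM x0 (\<iota> (DM x0 x)) = DM x0 x" using that by (simp add: T_def)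
    then have "DM x0 x = 0" unfolding x0_def by (rule nondegenerate)
    then show ?thesis using that by (simp add: T_def \<iota>.zero)
  qed
  obtain S where S: "bounded_linear S" "\<And>x. S x - T (S x) = x" "\<And>x. S (x - T x) = x"
    using riesz_fredholm[OF T _ inj] Tc unfolding compact_map_def by metis
  interpret S: bounded_linear S by (rule S(1))
  define w where "w = S (\<iota> E)"
  define N where "N x = S (\<iota> (M (x0 + x)) - x0) - S (T x)" for x
  define DN where "DN x = (Blinfun S o\<^sub>L Blinfun \<iota>) o\<^sub>L (DM (x0 + x) - DM x0)" for x
  have DN_apply: "DN x h = S (\<iota> (DM (x0 + x) h)) - S (T h)" for x h
    by (simp add: DN_def bounded_linear_Blinfun_apply S(1) \<iota> blinfun.diff_left \<iota>.diff S.diff T_def)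
  have eq: "x = t *\<^sub>R w + N x \<longleftrightarrow> x0 + x = \<iota> (t *\<^sub>R E + M (x0 + x))" for t x
  proof -
    have Sinj: "S a = S b \<longleftrightarrow> a = b" for a b using S(2) by metis
    have "t *\<^sub>R w + N x = S (t *\<^sub>R \<iota> E + (\<iota> (M (x0 + x)) - x0) - T x)"
      by (simp add: w_def N_def S.add S.diff S.scaleR)
    then have "x = t *\<^sub>R w + N x \<longleftrightarrow> S (x - T x) = S (t *\<^sub>R \<iota> E + (\<iota> (M (x0 + x)) - x0) - T x)"
      using S(3) by simp
    also have "\<dots> \<longleftrightarrow> x0 + x = \<iota> (t *\<^sub>R E + M (x0 + x))"
      unfolding Sinj \<iota>.add \<iota>.scaleR by (auto simp: algebra_simps)
    finally show ?thesis .
  qed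
  have N1: "(N has_derivative blinfun_apply (DN x)) (at x)" for x
  proof -
    have "((\<lambda>x. M (x0 + x)) has_derivative (\<lambda>h. DM (x0 + x) h)) (at x)"
    proof (rule has_derivative_compose[OF _ DM])
      show "((\<lambda>x. x0 + x) has_derivative (\<lambda>h. h)) (at x)"
        by (auto intro!: derivative_eq_intros)
    qed
    then have "((\<lambda>x. S (\<iota> (M (x0 + x)) - x0) - S (T x)) has_derivative
        (\<lambda>h. S (\<iota> (DM (x0 + x) h) - 0) - S (T h))) (at x)"
      by (intro has_derivative_diff bounded_linear.has_derivative[OF S(1)] bounded_linear.has_derivative[OF \<iota>]
          has_derivative_const bounded_linear.has_derivative[OF T] has_derivative_ident)
    then show ?thesis unfolding N_def DN_apply[abs_def] by simp
  qed
  have N2: "N 0 = 0"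
    using U0 by (simp add: N_def x0_def \<iota>.zero S.zero linear_0[OF bounded_linear.linear[OF T]])
  have N3: "compact_map N"
  proof -
    have "compact_map (\<lambda>x. \<iota> (M (x0 + x)))"
    proof (rule compact_map_compose_bounded[OF \<iota>_compact])
      fix S :: "'x set" assume "bounded S"
      then have "bounded (M ` ((+) x0 ` S))" by (intro M_bounded bounded_translation)
      then show "bounded ((\<lambda>x. M (x0 + x)) ` S)" by (simp add: image_image)
    qed
    then have "compact_map (\<lambda>x. S (\<iota> (M (x0 + x)) - x0))"
      by (rule compact_map_continuous_compose[where g = "\<lambda>y. S (y - x0)"])
        (intro S.continuous_on continuous_intros)
    moreover have "compact_map (\<lambda>x. S (T x))"
      using Tc by (rule compact_map_continuous_compose) (intro S.continuous_on continuous_intros)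
    ultimately show ?thesis unfolding N_def by (rule compact_map_diff)
  qed
  have N4: "Ck_curve k I (\<lambda>t. DN (x t))" if "Ck_curve k I x" for k I x
  proof -
    have x: "Ck_curve k I (\<lambda>t. x0 + x t)" by (intro Ck_curve_add Ck_curve_const that)
    have "Ck_curve k I (\<lambda>t. DM (x0 + x t) + (- DM x0))"
      by (rule Ck_curve_add[OF DM_Ck[OF x] Ck_curve_const])
    then have "Ck_curve k I (\<lambda>t. DM (x0 + x t) - DM x0)" unfolding diff_conv_add_uminus .
    then show ?thesis unfolding DN_def
      by (rule Ck_curve_linear[OF bounded_bilinear.bounded_linear_right[OF bounded_bilinear_blinfun_compose]])
  qed
  have "\<exists>r>0. \<forall>x. norm x \<le> r \<longrightarrow> norm (DN x) \<le> 1 / 2"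
  proof -
    have "continuous_on UNIV (\<lambda>x. DM (x0 + x) - DM x0)"
      by (intro continuous_intros continuous_on_compose2[OF DM_cont]) auto
    then have "continuous_on UNIV DN" unfolding DN_def
      by (intro bounded_linear.continuous_on[OF bounded_bilinear.bounded_linear_right[OF bounded_bilinear_blinfun_compose]])
    then have "isCont DN 0" by (simp add: continuous_on_eq_continuous_at)
    moreover have "DN 0 = 0" by (simp add: DN_def)
    ultimately obtain d where d: "d > 0" "\<And>x. norm x < d \<Longrightarrow> norm (DN x) < 1 / 2"
      unfolding continuous_at_eps_delta by (auto simp: dist_norm dest: spec[of _ "1 / 2"])
    have "norm (DN x) \<le> 1 / 2" if "norm x \<le> d / 2" for x
      using d(2)[of x] d(1) that by linarith
    then show ?thesis using d(1) by (intro exI[of _ "d / 2"]) auto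
  qed
  then obtain r where r: "r > 0" "\<forall>x. norm x \<le> r \<longrightarrow> norm (DN x) \<le> 1 / 2" by blast
  show ?thesis
  proof (rule that[of w N DN r])
    show "x = t *\<^sub>R w + N x \<longleftrightarrow> \<iota> U0 + x = \<iota> (t *\<^sub>R E + M (\<iota> U0 + x))" for t x
      using eq unfolding x0_def .
    show "norm (DN x) \<le> 1 / 2" if "norm x \<le> r" for x using r(2) that by blast
  qed (fact N1 N2 N3 N4 r(1))+
qed

text \<open>The component \<open>C\<close> contains the local branch because that branch is connected, and it coincides
  with it near the start by local uniqueness. The alternative is proved by contradiction as described at
  the beginning.\<close>

theorem continuation: "continuum_alternative solutions U0"
proof -
  obtain w N DN r where eq: "\<And>t x. x = t *\<^sub>R w + N x \<longleftrightarrow> \<iota> U0 + x = \<iota> (t *\<^sub>R E + M (\<iota> U0 + x))"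
    and DN: "\<And>x. (N has_derivative blinfun_apply (DN x)) (at x)" and N0: "N 0 = 0" and Nc: "compact_map N"
    and DNk: "\<And>k T x. Ck_curve k T x \<Longrightarrow> Ck_curve k T (\<lambda>t. DN (x t))"
    and r: "r > 0" "\<And>x. norm x \<le> r \<Longrightarrow> norm (DN x) \<le> 1 / 2"
  proof (rule preconditioned_equation, goal_cases)
    case (1 w N DN r)
    show ?thesis by (rule that[of w N DN r]) (fact 1)+
  qed
  define x0 where "x0 = \<iota> U0"
  have Ncont: "continuous_on UNIV N"
    using has_derivative_continuous[OF DN] by (simp add: continuous_on_eq_continuous_at)
  have Nhalf: "norm (N x) \<le> norm x / 2" if "norm x \<le> r" for x
  proof -
    have "norm (N x - N 0) \<le> 1 / 2 * norm (x - 0)"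
    proof (rule differentiable_bound[of "cball 0 r" N "\<lambda>x. blinfun_apply (DN x)"])
      show "(N has_derivative blinfun_apply (DN x)) (at x within cball 0 r)" for x
        using DN by (rule has_derivative_at_withinI)
      show "onorm (blinfun_apply (DN x)) \<le> 1 / 2" if "x \<in> cball 0 r" for x
        using r(2)[of x] that by (simp add: norm_blinfun.rep_eq)
    qed (use that r(1) in auto)
    then show ?thesis by (simp add: N0)
  qed
  have sol_iff: "(t, u) \<in> solutions \<longleftrightarrow> u = t *\<^sub>R E + M (\<iota> u)" for t u by (simp add: solutions_def)
  have sol_N: "\<iota> u - x0 = t *\<^sub>R w + N (\<iota> u - x0)" if "(t, u) \<in> solutions" for t u
  proof -
    have "\<iota> U0 + (\<iota> u - \<iota> U0) = \<iota> u" by simp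
    then show ?thesis
      unfolding eq x0_def using that unfolding sol_iff by (metis (no_types))
  qed
  have N_sol: "(t, t *\<^sub>R E + M (x0 + x)) \<in> solutions" "\<iota> (t *\<^sub>R E + M (x0 + x)) = x0 + x"
    if "x = t *\<^sub>R w + N x" for t x
  proof -
    have e: "\<iota> (t *\<^sub>R E + M (x0 + x)) = x0 + x" using that unfolding eq x0_def by (rule sym)
    show "(t, t *\<^sub>R E + M (x0 + x)) \<in> solutions" unfolding sol_iff e by (rule refl)
    show "\<iota> (t *\<^sub>R E + M (x0 + x)) = x0 + x" by (rule e)
  qed
  have start: "(0, U0) \<in> solutions" by (simp add: sol_iff U0)
  define A where "A = solutions \<inter> {0..} \<times> UNIV"
  define C where "C = connected_component_set A (0, U0)"
  have clA: "closed A" unfolding A_def by (intro closed_Int closed_solutions closed_Times) auto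
  have pA: "(0, U0) \<in> A" using start by (simp add: A_def)
  have C: "maximal_continuum A (0, U0) C" unfolding C_def by (rule maximal_continuum_component[OF clA pA])
  have CA: "C \<subseteq> A" unfolding C_def by (rule connected_component_subset)
  have pC: "(0, U0) \<in> C" using pA by (simp add: C_def)
  have Cmax: "D \<subseteq> C" if "connected D" "D \<subseteq> A" "(0, U0) \<in> D" for D
    unfolding C_def using that by (intro connected_component_maximal)
  have "\<exists>\<epsilon> \<xi>. \<epsilon> > 0 \<and> (\<forall>k. Ck_curve k {-\<epsilon><..<\<epsilon>} \<xi>) \<and> \<xi> 0 = 0 \<and>
      (\<forall>t. \<bar>t\<bar> < \<epsilon> \<longrightarrow> norm (\<xi> t) < r) \<and>
      (\<forall>t x. \<bar>t\<bar> < \<epsilon> \<longrightarrow> norm x < r \<longrightarrow> (x = t *\<^sub>R w + N x \<longleftrightarrow> x = \<xi> t))"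
  proof (rule local_solution_curve[of N DN r w])
    show "(N has_derivative blinfun_apply (DN x)) (at x)" for x by (rule DN)
    show "norm (DN x) \<le> 1 / 2" if "norm x \<le> r" for x using that by (rule r(2))
    show "Ck_curve k T (\<lambda>t. DN (x t))" if "Ck_curve k T x" for k T x using that by (rule DNk)
  qed (fact r(1) N0 | intro exI conjI allI impI; blast)+
  then obtain \<epsilon> \<xi> where \<epsilon>: "\<epsilon> > 0" and "\<forall>k. Ck_curve k {-\<epsilon><..<\<epsilon>} \<xi>" and \<xi>0: "\<xi> 0 = 0"
    and "\<forall>t. \<bar>t\<bar> < \<epsilon> \<longrightarrow> norm (\<xi> t) < r"
    and "\<forall>t x. \<bar>t\<bar> < \<epsilon> \<longrightarrow> norm x < r \<longrightarrow> (x = t *\<^sub>R w + N x \<longleftrightarrow> x = \<xi> t)"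
    by (elim exE conjE)
  then have \<xi>k: "\<And>k. Ck_curve k {-\<epsilon><..<\<epsilon>} \<xi>"
    and \<xi>r: "\<And>t. \<bar>t\<bar> < \<epsilon> \<Longrightarrow> norm (\<xi> t) < r"
    and \<xi>: "\<And>t x. \<bar>t\<bar> < \<epsilon> \<Longrightarrow> norm x < r \<Longrightarrow> x = t *\<^sub>R w + N x \<longleftrightarrow> x = \<xi> t"
    by simp_all
  have local: "\<exists>\<epsilon>>0. \<exists>U g. open U \<and> (0, U0) \<in> U \<and> smooth_curve_on {0..<\<epsilon>} g \<and>
           C \<inter> U = (\<lambda>t. (t, g t)) ` {0..<\<epsilon>}"
  proof -
    define g where "g t = t *\<^sub>R E + M (x0 + \<xi> t)" for t
    define U where "U = {p :: real \<times> 'y. \<bar>fst p\<bar> < \<epsilon> \<and> norm (\<iota> (snd p) - x0) < r}"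
    have "open U" unfolding U_def
      by (intro open_Collect_conj open_Collect_less continuous_intros \<iota>.continuous_on)
    moreover have "(0, U0) \<in> U" using \<epsilon> r(1) by (simp add: U_def x0_def)
    moreover have gk: "Ck_curve k {-\<epsilon><..<\<epsilon>} g" for k
      unfolding g_def
      by (intro Ck_curve_add M_Ck Ck_curve_const \<xi>k Ck_curve_linear[OF bounded_linear_scaleR_left] Ck_curve_ident)
    then have "smooth_curve_on {0..<\<epsilon>} g"
      by (rule Ck_curves_smooth) (use \<epsilon> in auto)
    moreover have "C \<inter> U = (\<lambda>t. (t, g t)) ` {0..<\<epsilon>}"
    proof
      show "C \<inter> U \<subseteq> (\<lambda>t. (t, g t)) ` {0..<\<epsilon>}"
      proof
        fix p assume p: "p \<in> C \<inter> U"
        obtain t u where tu: "p = (t, u)" by (cases p)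
        have s: "(t, u) \<in> solutions" "0 \<le> t" and t: "\<bar>t\<bar> < \<epsilon>" and x: "norm (\<iota> u - x0) < r"
          using p CA by (auto simp: tu A_def U_def)
        have "\<iota> u - x0 = \<xi> t" using sol_N[OF s(1)] \<xi>[OF t x] by blast
        then have e: "\<iota> u = x0 + \<xi> t" by (simp add: algebra_simps)
        have "u = g t" using s(1) unfolding sol_iff g_def e .
        then show "p \<in> (\<lambda>t. (t, g t)) ` {0..<\<epsilon>}" using tu s(2) t by auto
      qed
      have gsol: "(t, g t) \<in> solutions \<and> \<iota> (g t) = x0 + \<xi> t" if "\<bar>t\<bar> < \<epsilon>" for t
        unfolding g_def
        using N_sol[OF \<xi>[THEN iffD2, OF that \<xi>r[OF that] refl]] by (rule conjI)
      have "continuous_on {0..<\<epsilon>} g"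
        by (rule continuous_on_subset[OF Ck_curve_continuous[OF gk]]) (use \<epsilon> in auto)
      then have "connected ((\<lambda>t. (t, g t)) ` {0..<\<epsilon>})"
        by (intro connected_continuous_image continuous_intros) auto
      moreover have "g 0 = U0" by (simp add: g_def \<xi>0 x0_def U0)
      then have "(0, U0) \<in> (\<lambda>t. (t, g t)) ` {0..<\<epsilon>}" using \<epsilon> by (intro image_eqI[of _ _ 0]) auto
      moreover have "(\<lambda>t. (t, g t)) ` {0..<\<epsilon>} \<subseteq> A" using gsol by (auto simp: A_def)
      ultimately have "(\<lambda>t. (t, g t)) ` {0..<\<epsilon>} \<subseteq> C" by (intro Cmax)
      moreover have "(\<lambda>t. (t, g t)) ` {0..<\<epsilon>} \<subseteq> U" using gsol \<xi>r by (auto simp: U_def)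
      ultimately show "(\<lambda>t. (t, g t)) ` {0..<\<epsilon>} \<subseteq> C \<inter> U" by blast
    qed
    ultimately show ?thesis using \<epsilon> by blast
  qed
  have bdd: "bounded (C \<inter> {0..B} \<times> UNIV)" for B
    by (rule bounded_subset[OF bounded_solutions[of 0 B]]) (use CA in \<open>auto simp: A_def\<close>)
  have "fst ` C = {0..} \<or> (\<exists>v. v \<noteq> U0 \<and> (0, v) \<in> C)"
  proof (rule ccontr)
    assume neg: "\<not> ?thesis"
    have conn: "connected (fst ` C)"
      using C by (intro connected_continuous_image continuous_intros) (auto simp: maximal_continuum_def)
    have sub: "fst ` C \<subseteq> {0..}" using CA by (auto simp: A_def)
    have zero: "0 \<in> fst ` C" using pC by force
    have "\<exists>T. \<forall>c\<in>fst ` C. c < T"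
    proof (rule ccontr)
      assume "\<not> ?thesis"
      then have "\<exists>c\<in>fst ` C. t \<le> c" for t by (meson not_less)
      then have "{0..} \<subseteq> fst ` C"
        using connectedD_interval[OF conn zero] by (metis atLeast_iff subsetI)
      then show False using neg sub by blast
    qed
    then obtain T where T: "\<And>c. c \<in> fst ` C \<Longrightarrow> c < T" by blast
    define AT where "AT = solutions \<inter> {0..T} \<times> UNIV"
    have AT: "compact AT" unfolding AT_def by (rule compact_solutions)
    have ATA: "AT \<subseteq> A" by (auto simp: AT_def A_def)
    \<comment> \<open>\<open>V\<close> is an open neighbourhood of \<open>C\<close> that avoids the level \<open>T\<close> and, at \<open>t = 0\<close>, everything outside the ball where \<open>N\<close> contracts.\<close>
    define V where "V = {p :: real \<times> 'y. fst p < T \<and> (0 < fst p \<or> norm (\<iota> (snd p) - x0) < r)}"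
    have V: "open V" unfolding V_def
      by (intro open_Collect_conj open_Collect_disj open_Collect_less continuous_intros \<iota>.continuous_on)
    have CV: "C \<subseteq> V"
    proof
      fix p assume p: "p \<in> C"
      have "fst p \<ge> 0" using sub p by auto
      moreover have "snd p = U0" if "fst p = 0"
        using neg p that by (metis prod.collapse)
      ultimately show "p \<in> V"
        using T[of "fst p"] p r(1) by (cases "fst p = 0") (auto simp: V_def x0_def)
    qed
    have pAT: "(0, U0) \<in> AT" using start T[OF zero] by (auto simp: AT_def)
    \<comment> \<open>In a compact Hausdorff space, a point and a closed set that no connected set joins are separated by a partition into open and closed sets.\<close>
    have "separated_between (top_of_set AT) {(0, U0)} (AT - V)"
    proof (rule cut_wire_fence_theorem_gen)
      show "compact_space (top_of_set AT)" using AT by (simp add: compact_space_subtopology)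
      show "Hausdorff_space (top_of_set AT) \<or> regular_space (top_of_set AT) \<or> normal_space (top_of_set AT)"
        by (simp add: Hausdorff_space_subtopology Hausdorff_space_euclidean)
      show "compactin (top_of_set AT) {(0, U0)}" using pAT by (simp add: compactin_subtopology)
      show "closedin (top_of_set AT) (AT - V)" using V by (metis Diff_eq closedin_closed_Int closed_Compl)
      fix D assume D: "connectedin (top_of_set AT) D"
      then have D': "connected D" "D \<subseteq> AT" by (auto simp: connectedin_subtopology)
      show "disjnt D {(0, U0)} \<or> disjnt D (AT - V)"
      proof (cases "(0, U0) \<in> D")
        case True
        then have "D \<subseteq> C" using D' ATA by (intro Cmax) auto
        then show ?thesis using CV by (auto simp: disjnt_iff)
      qed (auto simp: disjnt_iff)
    qed
    then obtain K1 K2 where K: "openin (top_of_set AT) K1" "openin (top_of_set AT) K2" "K1 \<union> K2 = AT"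
      "K1 \<inter> K2 = {}" "(0, U0) \<in> K1" "AT - V \<subseteq> K2"
      unfolding separated_between_def disjnt_def by auto
    have "K1 = AT - K2" "K2 = AT - K1" using K(3,4) by auto
    then have "closedin (top_of_set AT) K1" "closedin (top_of_set AT) K2"
      using K(1,2) by (metis closedin_diff closedin_subtopology_refl topspace_euclidean UNIV_I subsetI)+
    then have comp: "compact K1" "compact K2" using closedin_compact[OF AT] by blast+
    have K1V: "K1 \<subseteq> V" using K by auto
    \<comment> \<open>The partition is transported from \<open>'y\<close> to \<open>'x\<close>; on solutions \<open>h\<close> is injective, so the two parts remain disjoint.\<close>
    define h :: "real \<times> 'y \<Rightarrow> real \<times> 'x" where "h p = (fst p, \<iota> (snd p) - x0)" for p
    have hc: "continuous_on S h" for S unfolding h_def by (intro continuous_intros \<iota>.continuous_on)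
    have hinj: "p = p'" if "p \<in> solutions" "p' \<in> solutions" "h p = h p'" for p p'
    proof -
      have "snd p = fst p *\<^sub>R E + M (\<iota> (snd p))" "snd p' = fst p' *\<^sub>R E + M (\<iota> (snd p'))"
        using that(1,2) unfolding solutions_def case_prod_unfold by blast+
      moreover have "fst p = fst p'" "\<iota> (snd p) = \<iota> (snd p')" using that(3) by (auto simp: h_def)
      ultimately show ?thesis by (metis prod_eqI)
    qed
    show False
    proof (rule no_isolated_compact_solution_set[OF Ncont Nc _ _ _ _ _ _ _ r(1) Nhalf])
      show "compact (h ` K1)" "compact (h ` K2)" using comp hc by (auto intro: compact_continuous_image)
      show "h ` K1 \<inter> h ` K2 = {}"
      proof (rule ccontr)
        assume "h ` K1 \<inter> h ` K2 \<noteq> {}"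
        then obtain p p' where p: "p \<in> K1" "p' \<in> K2" "h p = h p'" by blast
        then have "p = p'" using K(3) by (intro hinj) (auto simp: AT_def)
        then show False using p K(4) by blast
      qed
      show "{(t, x). 0 \<le> t \<and> t \<le> T \<and> x = t *\<^sub>R w + N x} = h ` K1 \<union> h ` K2"
        unfolding image_Un[symmetric] K(3)
      proof (intro equalityI subsetI)
        fix q assume "q \<in> {(t, x). 0 \<le> t \<and> t \<le> T \<and> x = t *\<^sub>R w + N x}"
        then obtain t x where q: "q = (t, x)" "0 \<le> t" "t \<le> T" "x = t *\<^sub>R w + N x" by blast
        show "q \<in> h ` AT"
          using N_sol[OF q(4)] q(1-3) by (intro image_eqI[of _ _ "(t, t *\<^sub>R E + M (x0 + x))"]) (simp_all add: h_def AT_def)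
      next
        fix q assume "q \<in> h ` AT"
        then obtain t u where "(t, u) \<in> AT" "q = h (t, u)" by auto
        moreover then have "\<iota> u - x0 = t *\<^sub>R w + N (\<iota> u - x0)" by (intro sol_N) (simp add: AT_def)
        ultimately show "q \<in> {(t, x). 0 \<le> t \<and> t \<le> T \<and> x = t *\<^sub>R w + N x}"
          unfolding h_def AT_def by auto
      qed
      show "t < T" if "(t, x) \<in> h ` K1" for t x using that K1V by (auto simp: h_def V_def)
      show "(0, 0) \<in> h ` K1" using K(5) by (force simp: h_def x0_def)
      show "x = 0" if x: "(0, x) \<in> h ` K1" for x
      proof -
        obtain u where u: "(0, u) \<in> K1" "x = \<iota> u - x0" using x by (auto simp: h_def)
        have "norm x < r" using u K1V by (auto simp: V_def)
        then have "norm (N x) \<le> norm x / 2" by (intro Nhalf) simp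
        moreover have "(0, u) \<in> solutions" using u(1) K(3) by (auto simp: AT_def)
        then have "N x = x" using sol_N[of 0 u] unfolding u(2)[symmetric] by (metis add_0 scaleR_zero_left)
        ultimately have "norm x \<le> norm x / 2" by (simp only:)
        then show ?thesis by simp
      qed
    qed
  qed
  with C[unfolded A_def] local bdd show ?thesis
    unfolding continuum_alternative_def by (intro exI[of _ C] conjI allI impI)
qed

end

section \<open>Primitives and integration by parts\<close>

text \<open>Both \<open>f\<close> and its norm are required to have Henstock-Kurzweil integrals, which amounts to local absolute integrability.\<close>

definition locally_integrable :: "(real \<Rightarrow> 'a::banach) \<Rightarrow> bool" where
  "locally_integrable f \<longleftrightarrow> (\<forall>a b. f integrable_on {a..b} \<and> (\<lambda>x. norm (f x)) integrable_on {a..b})"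

text \<open>One of the two integrals is always over a set with at most one point; together they are the
  integral from \<open>0\<close> to \<open>s\<close> for either sign of \<open>s\<close>.\<close>

definition primitive :: "(real \<Rightarrow> 'a::banach) \<Rightarrow> real \<Rightarrow> 'a" where
  "primitive f s = integral {0..s} f - integral {s..0} f"

lemma locally_integrableD:
  "locally_integrable f \<Longrightarrow> f integrable_on {a..b}"
  "locally_integrable f \<Longrightarrow> (\<lambda>x. norm (f x)) integrable_on {a..b}"
  by (auto simp: locally_integrable_def)

lemma continuous_imp_locally_integrable: "continuous_on UNIV f \<Longrightarrow> locally_integrable f"
  unfolding locally_integrable_def
  by (auto intro!: integrable_continuous_real continuous_on_norm intro: continuous_on_subset)

lemma locally_square_integrable_imp_absolutely_integrable:
  assumes "locally_square_integrable f"
  shows "f absolutely_integrable_on {a..b}"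
proof -
  have "integrable (lebesgue_on {a..b}) f"
    using assms square_integrable_imp_integrable by (auto simp: locally_square_integrable_def)
  then show ?thesis by (simp add: set_integrable_def integrable_restrict_space)
qed

lemma locally_square_integrable_imp_locally_integrable:
  "locally_square_integrable f \<Longrightarrow> locally_integrable f"
  using locally_square_integrable_imp_absolutely_integrable
  unfolding locally_integrable_def absolutely_integrable_on_def by blast

lemma primitive_combine:
  assumes "locally_integrable f" "s \<le> t"
  shows "primitive f t = primitive f s + integral {s..t} f"
proof -
  note i = locally_integrableD(1)[OF assms(1)]
  have z: "integral {x..y} f = 0" if "y \<le> x" for x y :: real
    using that by (cases "x = y") auto
  consider "0 \<le> s" | "s < 0" "0 \<le> t" | "t < 0" using assms(2) by linarith
  then show ?thesis
  proof cases
    case 1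
    then show ?thesis using Henstock_Kurzweil_Integration.integral_combine[OF 1 assms(2) i] z assms(2)
      by (simp add: primitive_def)
  next
    case 2
    then show ?thesis using Henstock_Kurzweil_Integration.integral_combine[of s 0 t f] i z
      by (simp add: primitive_def algebra_simps)
  next
    case 3
    then show ?thesis using Henstock_Kurzweil_Integration.integral_combine[of s t 0 f] i z assms(2)
      by (simp add: primitive_def algebra_simps)
  qed
qed

lemma primitive_0 [simp]: "primitive f 0 = 0" by (simp add: primitive_def)

lemma primitive_nonneg: "0 \<le> s \<Longrightarrow> primitive f s = integral {0..s} f"
  by (cases "s = 0") (auto simp: primitive_def)

lemma primitive_continuous:
  assumes "locally_integrable f"
  shows "continuous_on S (primitive f)"
proof -
  have "isCont (primitive f) x" for x
  proof -
    have "continuous_on {x - 1..x + 1} (\<lambda>s. primitive f (x - 1) + integral {x - 1..s} f)"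
      by (intro continuous_intros indefinite_integral_continuous_1 locally_integrableD assms)
    then have "continuous_on {x - 1..x + 1} (primitive f)"
      by (rule continuous_on_eq) (subst primitive_combine[OF assms, of "x - 1"], auto)
    then have "continuous_on {x - 1<..<x + 1} (primitive f)" by (rule continuous_on_subset) auto
    then show ?thesis by (simp add: continuous_on_eq_continuous_at)
  qed
  then show ?thesis by (simp add: continuous_at_imp_continuous_on)
qed

lemma primitive_has_vector_derivative:
  assumes f: "continuous_on UNIV f"
  shows "(primitive f has_vector_derivative f x) (at x)"
proof -
  have li: "locally_integrable f" by (rule continuous_imp_locally_integrable[OF f])
  have "((\<lambda>s. integral {x - 1..s} f) has_vector_derivative f x) (at x within {x - 1..x + 1})"
    by (rule integral_has_vector_derivative) (auto intro: continuous_on_subset[OF f])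
  then have "((\<lambda>s. primitive f (x - 1) + integral {x - 1..s} f) has_vector_derivative 0 + f x) (at x within {x - 1..x + 1})"
    by (intro has_vector_derivative_add has_vector_derivative_const)
  then have D: "((\<lambda>s. primitive f (x - 1) + integral {x - 1..s} f) has_vector_derivative f x) (at x within {x - 1..x + 1})"
    by simp
  have "(primitive f has_vector_derivative f x) (at x within {x - 1..x + 1})"
    by (rule has_vector_derivative_transform[OF _ _ D]) (auto intro: primitive_combine[OF li])
  then show ?thesis using at_within_interior[of x "{x - 1..x + 1}"] by simp
qed

text \<open>Since \<open>f\<close> is only integrable, \<open>F\<close> may fail to be differentiable at some points, and a pointwise product rule does
  not suffice. Instead, let \<open>Q t\<close> be the defect of the formula on \<open>[a,t]\<close>. With \<open>V\<close> the
  primitive of the norm of \<open>f\<close> and \<open>L\<close> a bound for \<open>g'\<close>, one has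
  \<open>norm (Q t - Q s) \<le> 2 L (t - s) (V t - V s)\<close>. As \<open>V\<close> is continuous, \<open>Q\<close> has derivative zero everywhere.\<close>

lemma integration_by_parts_primitive:
  fixes f F g g' :: "real \<Rightarrow> complex"
  assumes f: "f integrable_on {a..b}" "(\<lambda>x. norm (f x)) integrable_on {a..b}"
    and fg: "(\<lambda>x. f x * g x) integrable_on {a..b}"
    and F: "\<And>s. s \<in> {a..b} \<Longrightarrow> F s = F a + integral {a..s} f"
    and g: "\<And>s. s \<in> {a..b} \<Longrightarrow> (g has_vector_derivative g' s) (at s within {a..b})"
    and g': "continuous_on {a..b} g'" and ab: "a \<le> b"
  shows "integral {a..b} (\<lambda>s. f s * g s) + integral {a..b} (\<lambda>s. F s * g' s) = F b * g b - F a * g a"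
proof -
  have Fc: "continuous_on {a..b} F"
    by (rule continuous_on_eq[OF _ F[symmetric]]) (intro continuous_intros indefinite_integral_continuous_1 f)
  have Fg: "(\<lambda>s. F s * g' s) integrable_on {a..b}"
    by (intro integrable_continuous_real continuous_intros Fc g')
  have sub: "h integrable_on {s..t}" if "h integrable_on {a..b}" "a \<le> s" "t \<le> b" for h :: "real \<Rightarrow> complex" and s t
    using that by (auto intro: integrable_subinterval_real)
  have subr: "h integrable_on {s..t}" if "h integrable_on {a..b}" "a \<le> s" "t \<le> b" for h :: "real \<Rightarrow> real" and s t
    using that by (auto intro: integrable_subinterval_real)
  define V where "V t = integral {a..t} (\<lambda>x. norm (f x))" for t
  have Vc: "continuous_on {a..b} V" unfolding V_def by (rule indefinite_integral_continuous_1[OF f(2)])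
  have Vst: "V t - V s = integral {s..t} (\<lambda>x. norm (f x))" if "a \<le> s" "s \<le> t" "t \<le> b" for s t
    using Henstock_Kurzweil_Integration.integral_combine[of a s t "\<lambda>x. norm (f x)"] subr[OF f(2), of a t] that
    by (simp add: V_def algebra_simps)
  obtain L where L: "L > 0" "\<And>s. s \<in> {a..b} \<Longrightarrow> norm (g' s) \<le> L"
    using compact_imp_bounded[OF compact_continuous_image[OF g' compact_Icc]] unfolding bounded_pos by auto
  have Fst: "F t - F s = integral {s..t} f" if "a \<le> s" "s \<le> t" "t \<le> b" for s t
    using Henstock_Kurzweil_Integration.integral_combine[of a s t f] sub[OF f(1), of a t] that F[of s] F[of t]
    by (simp add: algebra_simps)
  have gst: "g t - g s = integral {s..t} g'" if "a \<le> s" "s \<le> t" "t \<le> b" for s t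
  proof -
    have "(g' has_integral (g t - g s)) {s..t}"
      by (rule fundamental_theorem_of_calculus[OF that(2)])
        (rule has_vector_derivative_within_subset[OF g], use that in auto)
    then show ?thesis by (simp add: integral_unique)
  qed
  have glip: "norm (g t - g s) \<le> L * (t - s)" if "a \<le> s" "s \<le> t" "t \<le> b" for s t
    unfolding gst[OF that]
    by (rule integral_bound) (use that L(2) in \<open>auto intro: continuous_on_subset[OF g']\<close>)
  define h where "h s = f s * g s + F s * g' s" for s
  have hi: "h integrable_on {a..b}" unfolding h_def by (intro integrable_add fg Fg)
  define Q where "Q t = integral {a..t} h - (F t * g t - F a * g a)" for t
  \<comment> \<open>Freezing \<open>g\<close> at \<open>t\<close> and \<open>F\<close> at \<open>s\<close> reproduces the boundary terms exactly; what is left is a product of two small factors.\<close>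
  have est: "norm (Q t - Q s) \<le> 2 * L * (t - s) * (V t - V s)" if st: "a \<le> s" "s \<le> t" "t \<le> b" for s t
  proof -
    have gs: "(\<lambda>x. f x * (g x - g t)) integrable_on {s..t}"
      unfolding right_diff_distrib
      by (intro integrable_diff sub[OF fg] integrable_on_mult_left sub[OF f(1)]) (use st in auto)
    have Fs: "(\<lambda>x. (F x - F s) * g' x) integrable_on {s..t}"
      unfolding left_diff_distrib
      by (intro integrable_diff sub[OF Fg] integrable_on_mult_right integrable_continuous_real continuous_on_subset[OF g'])
        (use st in auto)
    have "integral {s..t} h = integral {s..t} (\<lambda>x. (f x * (g x - g t) + (F x - F s) * g' x) + (f x * g t + F s * g' x))"
      unfolding h_def by (rule arg_cong[where f = "integral {s..t}"]) (simp add: fun_eq_iff algebra_simps)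
    also have "\<dots> = (integral {s..t} (\<lambda>x. f x * (g x - g t)) + integral {s..t} (\<lambda>x. (F x - F s) * g' x))
        + (integral {s..t} f * g t + F s * integral {s..t} g')"
    proof -
      have i: "f integrable_on {s..t}" "g' integrable_on {s..t}"
        using sub[OF f(1)] sub[OF integrable_continuous_real[OF g']] st by auto
      show ?thesis
        using gs Fs i by (simp add: integral_add integrable_add integrable_on_mult_left integrable_on_mult_right
            integral_mult_left integral_mult_right)
    qed
    also have "integral {s..t} f * g t + F s * integral {s..t} g' = F t * g t - F s * g s"
      unfolding Fst[OF st, symmetric] gst[OF st, symmetric] by (simp add: algebra_simps)
    finally have hst: "integral {s..t} h - (F t * g t - F s * g s)
        = integral {s..t} (\<lambda>x. f x * (g x - g t)) + integral {s..t} (\<lambda>x. (F x - F s) * g' x)" by simp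
    have "integral {a..t} h = integral {a..s} h + integral {s..t} h"
      using Henstock_Kurzweil_Integration.integral_combine[OF st(1,2) sub[OF hi]] st by simp
    then have "Q t - Q s = integral {s..t} (\<lambda>x. f x * (g x - g t)) + integral {s..t} (\<lambda>x. (F x - F s) * g' x)"
      unfolding Q_def using hst by (simp add: algebra_simps)
    moreover have Vmono: "0 \<le> V t - V s"
      unfolding Vst[OF st] by (rule integral_nonneg[OF subr[OF f(2)]]) (use st in auto)
    have n1: "norm (integral {s..t} (\<lambda>x. f x * (g x - g t))) \<le> integral {s..t} (\<lambda>x. L * (t - s) * norm (f x))"
    proof (rule integral_norm_bound_integral[OF gs])
      show "(\<lambda>x. L * (t - s) * norm (f x)) integrable_on {s..t}"
        by (intro integrable_on_mult_right subr[OF f(2)]) (use st in auto)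
      fix x assume x: "x \<in> {s..t}"
      have "norm (g x - g t) \<le> L * (t - x)" using glip[of x t] x st by (simp add: norm_minus_commute)
      also have "\<dots> \<le> L * (t - s)" using x L(1) by (intro mult_left_mono) auto
      finally show "norm (f x * (g x - g t)) \<le> L * (t - s) * norm (f x)"
        by (simp add: norm_mult mult.commute mult_left_mono)
    qed
    have e1: "integral {s..t} (\<lambda>x. L * (t - s) * norm (f x)) = L * (t - s) * (V t - V s)"
      unfolding Vst[OF st] by (rule integral_mult_right)
    have n2: "norm (integral {s..t} (\<lambda>x. (F x - F s) * g' x)) \<le> integral {s..t} (\<lambda>x. (V t - V s) * L)"
    proof (rule integral_norm_bound_integral[OF Fs])
      fix x assume x: "x \<in> {s..t}"
      have "norm (F x - F s) \<le> integral {s..x} (\<lambda>x. norm (f x))"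
        using Fst[of s x] x st by (simp add: integral_norm_bound_integral sub[OF f(1)] subr[OF f(2)])
      also have "\<dots> \<le> integral {s..t} (\<lambda>x. norm (f x))"
        by (intro integral_subset_le subr[OF f(2)]) (use x st in auto)
      finally have "norm (F x - F s) \<le> V t - V s" by (simp add: Vst[OF st])
      then show "norm ((F x - F s) * g' x) \<le> (V t - V s) * L"
        unfolding norm_mult by (rule mult_mono[OF _ L(2)])
          (use x st Vmono in auto)
    qed auto
    have e2: "integral {s..t} (\<lambda>x. (V t - V s) * L) = L * (t - s) * (V t - V s)"
      using st by (simp add: algebra_simps)
    ultimately show ?thesis
      using norm_triangle_ineq[of "integral {s..t} (\<lambda>x. f x * (g x - g t))" "integral {s..t} (\<lambda>x. (F x - F s) * g' x)"]
        n1[unfolded e1] n2[unfolded e2] by simp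
  qed
  have est2: "norm (Q y - Q x) \<le> 2 * L * norm (V y - V x) * norm (y - x)" if "x \<in> {a..b}" "y \<in> {a..b}" for x y
  proof (cases "x \<le> y")
    case True
    then have "norm (Q y - Q x) \<le> 2 * L * (y - x) * (V y - V x)" using est that by simp
    also have "\<dots> \<le> 2 * L * (y - x) * norm (V y - V x)" using True L(1) by (intro mult_left_mono) auto
    also have "y - x = norm (y - x)" using True by simp
    finally show ?thesis by (simp only: mult_ac)
  next
    case False
    then have "norm (Q x - Q y) \<le> 2 * L * (x - y) * (V x - V y)" using est that by simp
    also have "\<dots> \<le> 2 * L * (x - y) * norm (V x - V y)" using False L(1) by (intro mult_left_mono) auto
    also have "x - y = norm (y - x)" using False by simp
    finally show ?thesis by (simp only: mult_ac norm_minus_commute[of "Q x"] norm_minus_commute[of "V x"])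
  qed
  have "(Q has_derivative (\<lambda>h. 0)) (at x within {a..b})" if x: "x \<in> {a..b}" for x
    unfolding has_derivative_within_alt
  proof (intro conjI allI impI bounded_linear_zero)
    fix e :: real assume e: "e > 0"
    then have "e / (2 * L) > 0" using L(1) by simp
    then obtain d where d: "d > 0" "\<And>y. y \<in> {a..b} \<Longrightarrow> dist y x < d \<Longrightarrow> dist (V y) (V x) < e / (2 * L)"
      using Vc x unfolding continuous_on_iff by meson
    show "\<exists>d>0. \<forall>y\<in>{a..b}. norm (y - x) < d \<longrightarrow> norm (Q y - Q x - 0) \<le> e * norm (y - x)"
    proof (intro exI[of _ d] conjI ballI impI d(1))
      fix y assume y: "y \<in> {a..b}" "norm (y - x) < d"
      have "norm (V y - V x) < e / (2 * L)" using d(2)[OF y(1)] y(2) by (simp add: dist_norm)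
      then have "2 * L * norm (V y - V x) \<le> e" using L(1) by (simp add: field_simps)
      then have "2 * L * norm (V y - V x) * norm (y - x) \<le> e * norm (y - x)" by (rule mult_right_mono) simp
      then show "norm (Q y - Q x - 0) \<le> e * norm (y - x)" using est2[OF x y(1)] by simp
    qed
  qed
  then have "\<exists>c. \<forall>x\<in>{a..b}. Q x = c" by (intro has_derivative_zero_constant) auto
  then have "Q b = Q a" using ab by auto
  also have "Q a = 0" by (simp add: Q_def)
  finally have "integral {a..b} h = F b * g b - F a * g a" by (simp add: Q_def)
  then show ?thesis unfolding h_def using integral_add[OF fg Fg] by simp
qed

section \<open>Weak derivatives on the line\<close>

lemma continuous_imp_locally_square_integrable:
  assumes "continuous_on UNIV (f :: real \<Rightarrow> complex)"
  shows "locally_square_integrable f"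
  unfolding locally_square_integrable_def square_integrable_def
proof (intro allI conjI)
  fix a b :: real
  have c: "continuous_on {a..b} f" by (rule continuous_on_subset[OF assms]) simp
  show "f \<in> borel_measurable (lebesgue_on {a..b})"
    using c by (rule continuous_imp_measurable_on_sets_lebesgue) simp
  show "integrable (lebesgue_on {a..b}) (\<lambda>x. (cmod (f x))\<^sup>2)"
    by (intro continuous_imp_integrable_real continuous_intros c)
qed

lemma continuous_AE_eq_imp_eq:
  fixes f g :: "real \<Rightarrow> 'a::real_normed_vector"
  assumes "continuous_on UNIV f" "continuous_on UNIV g" "AE x in lebesgue. f x = g x"
  shows "f = g"
proof -
  have "open {x. f x \<noteq> g x}" using assms(1,2) by (intro open_Collect_neq)
  moreover have "negligible {x. f x \<noteq> g x}" using assms(3) by (simp add: AE_lebesgue_iff_negligible)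
  ultimately have "{x. f x \<noteq> g x} = {}" using open_not_negligible by blast
  then show ?thesis by auto
qed

lemma test_function_derivative:
  "\<phi> \<in> test_functions S \<Longrightarrow> ((deriv ^^ k) \<phi> has_real_derivative (deriv ^^ Suc k) \<phi> x) (at x)"
  by (auto simp: test_functions_def intro: DERIV_deriv_iff_real_differentiable[THEN iffD2])

lemma test_functionsI:
  assumes "\<And>n x. (deriv ^^ n) \<phi> differentiable at x" "\<And>x. x \<notin> {a..b} \<Longrightarrow> \<phi> x = 0"
  shows "\<phi> \<in> test_functions UNIV"
proof -
  have "{x. \<phi> x \<noteq> 0} \<subseteq> {a..b}" using assms(2) by blast
  then have "bounded {x. \<phi> x \<noteq> 0}" by (rule bounded_subset[rotated]) simp
  then show ?thesis using assms(1) by (simp add: test_functions_def)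
qed

lemma test_function_deriv:
  assumes "\<phi> \<in> test_functions UNIV"
  shows "deriv \<phi> \<in> test_functions UNIV"
proof -
  obtain a b where ab: "\<And>k x. x \<notin> {a..b} \<Longrightarrow> (deriv ^^ k) \<phi> x = 0"
    using test_function_vanish[OF assms] by metis
  have "(deriv ^^ n) (deriv \<phi>) = (deriv ^^ Suc n) \<phi>" for n by (simp add: funpow_swap1)
  then have "(deriv ^^ n) (deriv \<phi>) differentiable at x" for n x
    using assms by (simp add: test_functions_def del: funpow.simps)
  then show ?thesis using ab[of _ 1] by (intro test_functionsI[of _ a b]) auto
qed

lemma test_functions_combination:
  assumes "\<phi> \<in> test_functions UNIV" "\<psi> \<in> test_functions UNIV"
  shows "(\<lambda>x. \<phi> x + c * \<psi> x) \<in> test_functions UNIV"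
proof -
  have d: "(deriv ^^ n) (\<lambda>x. \<phi> x + c * \<psi> x) = (\<lambda>x. (deriv ^^ n) \<phi> x + c * (deriv ^^ n) \<psi> x)" for n
  proof (induction n)
    case (Suc n)
    have "deriv (\<lambda>x. (deriv ^^ n) \<phi> x + c * (deriv ^^ n) \<psi> x) x = (deriv ^^ Suc n) \<phi> x + c * (deriv ^^ Suc n) \<psi> x" for x
      by (rule DERIV_imp_deriv[OF DERIV_add[OF test_function_derivative[OF assms(1)]
            DERIV_cmult[OF test_function_derivative[OF assms(2)]]]])
    moreover have "(deriv ^^ Suc n) (\<lambda>x. \<phi> x + c * \<psi> x) = deriv (\<lambda>x. (deriv ^^ n) \<phi> x + c * (deriv ^^ n) \<psi> x)"
      by (simp add: Suc)
    ultimately show ?case by (simp add: fun_eq_iff del: funpow.simps)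
  qed simp
  obtain a b where ab: "\<And>k x. x \<notin> {a..b} \<Longrightarrow> (deriv ^^ k) \<phi> x = 0"
    using test_function_vanish[OF assms(1)] by metis
  obtain a' b' where ab': "\<And>k x. x \<notin> {a'..b'} \<Longrightarrow> (deriv ^^ k) \<psi> x = 0"
    using test_function_vanish[OF assms(2)] by metis
  show ?thesis
  proof (rule test_functionsI[of _ "min a a'" "max b b'"])
    show "(deriv ^^ n) (\<lambda>x. \<phi> x + c * \<psi> x) differentiable at x" for n x
      unfolding d using assms by (intro derivative_intros) (auto simp: test_functions_def)
    show "\<phi> x + c * \<psi> x = 0" if "x \<notin> {min a a'..max b b'}" for x
      using ab[of x 0] ab'[of x 0] that by (auto simp: min_def max_def split: if_splits)
  qed
qed

lemma test_integral_eq: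
  assumes "locally_square_integrable u" "\<phi> \<in> test_functions UNIV"
    and "\<And>x. x \<notin> {a..b} \<Longrightarrow> (deriv ^^ k) \<phi> x = 0"
  shows "(LINT x|lebesgue. (deriv ^^ k) \<phi> x *\<^sub>R u x) = integral {a..b} (\<lambda>x. (deriv ^^ k) \<phi> x *\<^sub>R u x)"
    "(\<lambda>x. (deriv ^^ k) \<phi> x *\<^sub>R u x) integrable_on {a..b}"
proof -
  have i: "integrable lebesgue (\<lambda>x. (deriv ^^ k) \<phi> x *\<^sub>R u x)"
    by (rule test_function_mult_integrable[OF assms(1,2)])
  have r: "(\<lambda>x. (deriv ^^ k) \<phi> x *\<^sub>R u x) = (\<lambda>x. if x \<in> {a..b} then (deriv ^^ k) \<phi> x *\<^sub>R u x else 0)"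
    using assms(3) by auto
  have h: "((\<lambda>x. (deriv ^^ k) \<phi> x *\<^sub>R u x) has_integral (LINT x|lebesgue. (deriv ^^ k) \<phi> x *\<^sub>R u x)) UNIV"
    using has_integral_integral_lebesgue[OF i] .
  then have "((\<lambda>x. if x \<in> {a..b} then (deriv ^^ k) \<phi> x *\<^sub>R u x else 0) has_integral (LINT x|lebesgue. (deriv ^^ k) \<phi> x *\<^sub>R u x)) UNIV"
    using r by simp
  then have h: "((\<lambda>x. (deriv ^^ k) \<phi> x *\<^sub>R u x) has_integral (LINT x|lebesgue. (deriv ^^ k) \<phi> x *\<^sub>R u x)) {a..b}"
    by (simp only: has_integral_restrict_UNIV)
  then show "(LINT x|lebesgue. (deriv ^^ k) \<phi> x *\<^sub>R u x) = integral {a..b} (\<lambda>x. (deriv ^^ k) \<phi> x *\<^sub>R u x)"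
    by (simp add: integral_unique)
  show "(\<lambda>x. (deriv ^^ k) \<phi> x *\<^sub>R u x) integrable_on {a..b}" using h by blast
qed

lemma primitive_locally_square_integrable:
  "locally_integrable f \<Longrightarrow> locally_square_integrable (\<lambda>x. c + primitive f x)"
  by (intro continuous_imp_locally_square_integrable continuous_intros primitive_continuous)

lemma has_weak_deriv_primitive:
  fixes f :: "real \<Rightarrow> complex"
  assumes f: "locally_square_integrable f"
  shows "has_weak_deriv_on UNIV 1 (\<lambda>x. c + primitive f x) f"
  unfolding has_weak_deriv_on_def lebesgue_on_UNIV_eq
proof
  fix \<phi> :: "real \<Rightarrow> real" assume \<phi>: "\<phi> \<in> test_functions UNIV"
  obtain a b where ab: "a < b" "\<And>k x. x \<notin> {a..b} \<Longrightarrow> (deriv ^^ k) \<phi> x = 0"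
    using test_function_vanish[OF \<phi>] by metis
  note li = locally_square_integrable_imp_locally_integrable[OF f]
  define A where "A = a - 1"
  define B where "B = b + 1"
  have AB: "A < B" using ab(1) by (simp add: A_def B_def)
  have van: "x \<notin> {A..B} \<Longrightarrow> (deriv ^^ k) \<phi> x = 0" for k x using ab by (auto simp: A_def B_def)
  have z: "\<phi> A = 0" "\<phi> B = 0" using ab(2)[of _ 0] by (simp_all add: A_def B_def)
  let ?F = "\<lambda>x. c + primitive f x"
  note t0 = test_integral_eq[OF f \<phi>, of A B 0] and
    t1 = test_integral_eq[OF primitive_locally_square_integrable[OF li, of c] \<phi>, of A B 1]
  have "integral {A..B} (\<lambda>s. f s * complex_of_real (\<phi> s)) + integral {A..B} (\<lambda>s. ?F s * complex_of_real (deriv \<phi> s))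
      = ?F B * complex_of_real (\<phi> B) - ?F A * complex_of_real (\<phi> A)"
  proof (rule integration_by_parts_primitive)
    show "f integrable_on {A..B}" "(\<lambda>x. cmod (f x)) integrable_on {A..B}" using li by (auto dest: locally_integrableD)
    show "(\<lambda>x. f x * complex_of_real (\<phi> x)) integrable_on {A..B}"
      using t0(2) van[of _ 0] by (simp add: scaleR_conv_of_real mult.commute)
    show "?F s = ?F A + integral {A..s} f" if "s \<in> {A..B}" for s
      using primitive_combine[OF li, of A s] that by simp
    show "((\<lambda>s. complex_of_real (\<phi> s)) has_vector_derivative complex_of_real (deriv \<phi> s)) (at s within {A..B})" for s
      using test_function_derivative[OF \<phi>, of 0 s]
      by (simp add: has_vector_derivative_of_real has_vector_derivative_at_within)
    show "continuous_on {A..B} (\<lambda>s. complex_of_real (deriv \<phi> s))"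
      using test_function_continuous[OF \<phi>, of _ 1] by (intro continuous_intros) simp
  qed (use AB in simp)
  then have "integral {A..B} (\<lambda>s. deriv \<phi> s *\<^sub>R ?F s) = - integral {A..B} (\<lambda>s. \<phi> s *\<^sub>R f s)"
    by (simp add: z scaleR_conv_of_real mult.commute eq_neg_iff_add_eq_0 add.commute)
  then show "(LINT x|lebesgue. (deriv ^^ 1) \<phi> x *\<^sub>R ?F x) = (- 1) ^ 1 * (LINT x|lebesgue. \<phi> x *\<^sub>R f x)"
    using t0(1) t1(1) van van[of _ 0] van[of _ 1] by simp
qed

lemma has_weak_deriv_Suc:
  assumes "has_weak_deriv_on UNIV 1 F G" "has_weak_deriv_on UNIV 1 G f"
  shows "has_weak_deriv_on UNIV 2 F f"
  unfolding has_weak_deriv_on_def lebesgue_on_UNIV_eq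
proof
  fix \<phi> :: "real \<Rightarrow> real" assume \<phi>: "\<phi> \<in> test_functions UNIV"
  show "(LINT x|lebesgue. (deriv ^^ 2) \<phi> x *\<^sub>R F x) = (- 1) ^ 2 * (LINT x|lebesgue. \<phi> x *\<^sub>R f x)"
    using has_weak_deriv_onD[OF assms(1) test_function_deriv[OF \<phi>]] has_weak_deriv_onD[OF assms(2) \<phi>]
    by (simp add: numeral_2_eq_2)
qed

lemma has_weak_deriv_diff:
  assumes "has_weak_deriv_on UNIV 1 F G" "has_weak_deriv_on UNIV 2 F f"
  shows "has_weak_deriv_on UNIV 1 G f"
  unfolding has_weak_deriv_on_def lebesgue_on_UNIV_eq
proof
  fix \<phi> :: "real \<Rightarrow> real" assume \<phi>: "\<phi> \<in> test_functions UNIV"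
  show "(LINT x|lebesgue. (deriv ^^ 1) \<phi> x *\<^sub>R G x) = (- 1) ^ 1 * (LINT x|lebesgue. \<phi> x *\<^sub>R f x)"
    using has_weak_deriv_onD[OF assms(1) test_function_deriv[OF \<phi>]] has_weak_deriv_onD[OF assms(2) \<phi>]
    by (simp add: numeral_2_eq_2) (metis minus_minus)
qed

text \<open>The vanishing integral is what makes the primitive vanish again to the right of \<open>b\<close>.\<close>

lemma primitive_test_function:
  assumes h: "h \<in> test_functions UNIV" and van: "\<And>x. x \<notin> {a..b} \<Longrightarrow> h x = 0" and ab: "a \<le> b"
    and int: "integral {a..b} h = 0"
  defines "H \<equiv> \<lambda>x. primitive h x - primitive h a"
  shows "H \<in> test_functions UNIV" "deriv H = h"
proof -
  have hc: "continuous_on UNIV h" using test_function_continuous[OF h, of UNIV 0] by simp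
  note li = continuous_imp_locally_integrable[OF hc]
  have D: "(H has_real_derivative h x) (at x)" for x
    unfolding H_def has_real_derivative_iff_has_vector_derivative
    using has_vector_derivative_diff[OF primitive_has_vector_derivative[OF hc, of x]
        has_vector_derivative_const[of "primitive h a"]] by simp
  then show d: "deriv H = h" by (auto simp: fun_eq_iff intro: DERIV_imp_deriv)
  have "(deriv ^^ n) H differentiable at x" for n x
  proof (cases n)
    case 0
    then show ?thesis using D by (auto simp: real_differentiable_def)
  next
    case (Suc m)
    then have "(deriv ^^ n) H = (deriv ^^ m) h" by (simp add: funpow_swap1 d)
    then show ?thesis using h by (simp add: test_functions_def)
  qed
  moreover have "H x = 0" if "x \<notin> {a..b}" for x
  proof (cases "x < a")
    case True
    have "integral {x..a} h = integral {x..a} (\<lambda>_. 0)"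
      by (rule integral_spike[of "{a}"]) (use van in auto)
    then show ?thesis using primitive_combine[OF li, of x a] True by (simp add: H_def)
  next
    case False
    then have x: "b < x" using that by auto
    have "integral {b..x} h = integral {b..x} (\<lambda>_. 0)"
      by (rule integral_spike[of "{b}"]) (use van in auto)
    then show ?thesis using primitive_combine[OF li, of a b] primitive_combine[OF li, of b x] ab x int by (simp add: H_def)
  qed
  ultimately show "H \<in> test_functions UNIV" by (rule test_functionsI)
qed

text \<open>If every test function had integral zero, the constant \<open>1\<close> would vanish by the fundamental lemma of the
  calculus of variations; this avoids constructing a bump function.\<close>

lemma test_function_nonzero_integral:
  obtains \<psi> where "\<psi> \<in> test_functions UNIV" "(LINT x|lebesgue. \<psi> x *\<^sub>R (1::complex)) \<noteq> 0"
proof (rule ccontr)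
  assume "\<not> thesis"
  then have "AE x::real in lebesgue. (1::complex) = 0"
    using that by (intro AE_zero_if_test_integrals_zero locally_square_integrable_const) blast
  then have "negligible (UNIV :: real set)" unfolding AE_lebesgue_iff_negligible by simp
  then show False using open_not_negligible[of "UNIV :: real set"] by simp
qed

text \<open>The argument of du Bois-Reymond: subtracting from \<open>\<phi>\<close> the multiple of \<open>\<psi>\<close> with the same integral leaves
  the derivative of a test function, which \<open>u\<close> annihilates. Hence \<open>\<integral> \<phi> u = c \<integral> \<phi>\<close> with the constant \<open>c\<close>
  read off from \<open>\<psi>\<close>.\<close>

lemma weak_deriv_zero_imp_constant:
  assumes u: "locally_square_integrable u" and d: "has_weak_deriv_on UNIV 1 u (\<lambda>_. 0)"
  obtains c where "AE x in lebesgue. u x = c"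
proof -
  let ?I = "\<lambda>\<phi>. LINT x|lebesgue. \<phi> x *\<^sub>R (1::complex)"
  obtain \<psi> where \<psi>: "\<psi> \<in> test_functions UNIV" "?I \<psi> \<noteq> 0" by (rule test_function_nonzero_integral)
  \<comment> \<open>The integrals of test functions are real, so the correcting multiple of \<open>\<psi>\<close> is again a real test function.\<close>
  have real: "\<exists>r. ?I \<phi> = complex_of_real r \<and> (\<forall>a b. (\<forall>x. x \<notin> {a..b} \<longrightarrow> \<phi> x = 0) \<longrightarrow> r = integral {a..b} \<phi>)"
    if \<phi>: "\<phi> \<in> test_functions UNIV" for \<phi>
  proof -
    have "?I \<phi> = complex_of_real (integral {a..b} \<phi>)" if "\<forall>x. x \<notin> {a..b} \<longrightarrow> \<phi> x = 0" for a b
      using test_integral_eq[OF locally_square_integrable_const \<phi>, of a b 0 1] that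
      using integral_linear[of \<phi> "{a..b}" complex_of_real] test_function_continuous[OF \<phi>, of "{a..b}" 0]
      by (simp add: scaleR_conv_of_real o_def integrable_continuous_real bounded_linear_of_real)
    moreover obtain a b where "\<And>k x. x \<notin> {a..b} \<Longrightarrow> (deriv ^^ k) \<phi> x = 0"
      using test_function_vanish[OF \<phi>] by metis
    then have "\<forall>x. x \<notin> {a..b} \<longrightarrow> \<phi> x = 0" by (metis funpow_0)
    ultimately show ?thesis by (metis of_real_eq_iff)
  qed
  define c where "c = (LINT x|lebesgue. \<psi> x *\<^sub>R u x) / ?I \<psi>"
  have lu: "locally_square_integrable (\<lambda>x. u x + (-1) *\<^sub>R c)"
    by (intro locally_square_integrable_add u locally_square_integrable_const)
  have "AE x in lebesgue. u x + (-1) *\<^sub>R c = 0"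
  proof (rule AE_zero_if_test_integrals_zero[OF lu])
    fix \<phi> :: "real \<Rightarrow> real" assume \<phi>: "\<phi> \<in> test_functions UNIV"
    obtain r where r: "?I \<phi> = complex_of_real r" "\<And>a b. (\<forall>x. x \<notin> {a..b} \<longrightarrow> \<phi> x = 0) \<Longrightarrow> r = integral {a..b} \<phi>"
      using real[OF \<phi>] by blast
    obtain q where q: "?I \<psi> = complex_of_real q" "\<And>a b. (\<forall>x. x \<notin> {a..b} \<longrightarrow> \<psi> x = 0) \<Longrightarrow> q = integral {a..b} \<psi>"
      using real[OF \<psi>(1)] by blast
    have q0: "q \<noteq> 0" using \<psi>(2) q(1) by auto
    define h where "h x = \<phi> x + (- (r / q)) * \<psi> x" for x
    have h: "h \<in> test_functions UNIV" unfolding h_def by (rule test_functions_combination[OF \<phi> \<psi>(1)])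
    obtain a b where ab: "a < b" "\<And>x. x \<notin> {a..b} \<Longrightarrow> \<phi> x = 0"
      using test_function_vanish[OF \<phi>] by (metis funpow_0)
    obtain a' b' where ab': "a' < b'" "\<And>x. x \<notin> {a'..b'} \<Longrightarrow> \<psi> x = 0"
      using test_function_vanish[OF \<psi>(1)] by (metis funpow_0)
    define A where "A = min a a'"
    define B where "B = max b b'"
    have van: "\<phi> x = 0" "\<psi> x = 0" "h x = 0" if "x \<notin> {A..B}" for x
      using that ab(2)[of x] ab'(2)[of x] by (auto simp: A_def B_def h_def min_def max_def split: if_splits)
    have "integral {A..B} h = integral {A..B} \<phi> + integral {A..B} (\<lambda>x. (- (r / q)) * \<psi> x)"
      unfolding h_def using test_function_continuous[OF \<phi>, of "{A..B}" 0] test_function_continuous[OF \<psi>(1), of "{A..B}" 0]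
      by (intro integral_add integrable_continuous_real continuous_intros) auto
    also have "\<dots> = r - r / q * q"
      using r(2)[of A B] q(2)[of A B] van by simp
    finally have "integral {A..B} h = 0" using q0 by simp
    moreover have "A \<le> B" using ab(1) by (auto simp: A_def B_def)
    ultimately obtain H where H: "H \<in> test_functions UNIV" "deriv H = h"
      using primitive_test_function[OF h van(3), of A B] by blast
    have "(LINT x|lebesgue. h x *\<^sub>R u x) = 0"
      using has_weak_deriv_onD[OF d H(1)] H(2) by simp
    moreover have "(LINT x|lebesgue. h x *\<^sub>R u x) = (LINT x|lebesgue. \<phi> x *\<^sub>R u x) - (r / q) *\<^sub>R (LINT x|lebesgue. \<psi> x *\<^sub>R u x)"
    proof -
      have "(LINT x|lebesgue. h x *\<^sub>R u x) = (LINT x|lebesgue. \<phi> x *\<^sub>R u x - (r / q) *\<^sub>R (\<psi> x *\<^sub>R u x))"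
        by (simp add: h_def scaleR_add_left scaleR_diff_left)
      also have "\<dots> = (LINT x|lebesgue. \<phi> x *\<^sub>R u x) - (LINT x|lebesgue. (r / q) *\<^sub>R (\<psi> x *\<^sub>R u x))"
        using test_function_mult_integrable[OF u \<phi>, of 0] test_function_mult_integrable[OF u \<psi>(1), of 0]
        by (intro Bochner_Integration.integral_diff integrable_scaleR_right) (simp_all only: funpow_0)
      finally show ?thesis by (simp only: integral_scaleR_right)
    qed
    ultimately have "(LINT x|lebesgue. \<phi> x *\<^sub>R u x) = (r / q) *\<^sub>R (LINT x|lebesgue. \<psi> x *\<^sub>R u x)" by simp
    also have "\<dots> = c * ?I \<phi>"
      unfolding c_def r(1) q(1) scaleR_conv_of_real[of "r / q"] of_real_divide by simp
    finally have e: "(LINT x|lebesgue. \<phi> x *\<^sub>R u x) = c * ?I \<phi>" .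
    have "(LINT x|lebesgue. \<phi> x *\<^sub>R (u x + (-1) *\<^sub>R c)) = (LINT x|lebesgue. \<phi> x *\<^sub>R u x - c * (\<phi> x *\<^sub>R (1::complex)))"
      by (simp add: scaleR_conv_of_real algebra_simps)
    also have "\<dots> = (LINT x|lebesgue. \<phi> x *\<^sub>R u x) - (LINT x|lebesgue. c * (\<phi> x *\<^sub>R (1::complex)))"
      using test_function_mult_integrable[OF u \<phi>, of 0] test_function_mult_integrable[OF locally_square_integrable_const \<phi>, of 0 1]
      by (intro Bochner_Integration.integral_diff integrable_mult_right) (simp_all only: funpow_0)
    also have "\<dots> = 0" using e by (simp only: integral_mult_right_zero diff_self)
    finally show "(LINT x|lebesgue. \<phi> x *\<^sub>R (u x + (-1) *\<^sub>R c)) = 0" .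
  qed
  then show ?thesis by (intro that[of c]) (auto elim: eventually_mono)
qed

lemma weak_deriv_imp_primitive:
  assumes u: "locally_square_integrable u" and v: "locally_square_integrable v"
    and d: "has_weak_deriv_on UNIV 1 u v"
  obtains c where "AE x in lebesgue. u x = c + primitive v x"
proof -
  note li = locally_square_integrable_imp_locally_integrable[OF v]
  have P: "locally_square_integrable (\<lambda>x. 0 + primitive v x)"
    by (rule primitive_locally_square_integrable[OF li])
  have w: "has_weak_deriv_on UNIV 1 (\<lambda>x. u x + (-1) *\<^sub>R (0 + primitive v x)) (\<lambda>x. v x + (-1) *\<^sub>R v x)"
    by (intro has_weak_deriv_on_add has_weak_deriv_on_scaleR d has_weak_deriv_primitive v u P
        locally_square_integrable_scaleR)
  have "locally_square_integrable (\<lambda>x. u x + (-1) *\<^sub>R (0 + primitive v x))"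
    by (intro locally_square_integrable_add locally_square_integrable_scaleR u P)
  then obtain c where "AE x in lebesgue. u x + (-1) *\<^sub>R (0 + primitive v x) = c"
    using weak_deriv_zero_imp_constant w by (auto simp only: scaleR_minus1_left right_minus)
  then show ?thesis by (intro that[of c]) (auto elim!: eventually_mono simp: algebra_simps)
qed

section \<open>Continuous representatives of \<open>H\<^sup>2\<^sub>p\<^sub>e\<^sub>r\<close> functions\<close>

definition mean :: "(real \<Rightarrow> complex) \<Rightarrow> complex" where
  "mean f = integral {0..2*pi} f /\<^sub>R (2 * pi)"

definition energy :: "(real \<Rightarrow> complex) \<Rightarrow> real" where
  "energy f = integral {0..2*pi} (\<lambda>x. (cmod (f x))\<^sup>2)"

text \<open>Elements of \<open>h2per\<close> are classes modulo null sets. By \<open>continuous_representatives\<close> the function and its first weak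
  derivative have continuous representatives, and by \<open>continuous_AE_eq_imp_eq\<close> these are unique.\<close>

definition h2_value :: "h2per \<Rightarrow> real \<Rightarrow> complex" where
  "h2_value u = (SOME a. continuous_on UNIV a \<and> (AE x in lebesgue. rep_h2per u x = a x))"

definition h2_slope :: "h2per \<Rightarrow> real \<Rightarrow> complex" where
  "h2_slope u = (SOME b. continuous_on UNIV b \<and> (AE x in lebesgue. H2per_deriv 1 u x = b x))"

lemma primitive_cong_AE:
  assumes "AE x in lebesgue. f x = g x"
  shows "primitive f = primitive g"
proof -
  have "negligible {x. f x \<noteq> g x}" using assms by (simp add: AE_lebesgue_iff_negligible)
  then have "integral {a..b} f = integral {a..b} g" for a b by (rule integral_spike) auto
  then show ?thesis by (simp add: primitive_def fun_eq_iff)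
qed

lemma H2per_deriv_locally_square_integrable:
  "locally_square_integrable (H2per_deriv 1 u)" "locally_square_integrable (H2per_deriv 2 u)"
  by (simp_all add: H2per_deriv)

lemma continuous_representatives:
  "\<exists>a. continuous_on UNIV a \<and> (AE x in lebesgue. rep_h2per u x = a x)"
  "\<exists>b. continuous_on UNIV b \<and> (AE x in lebesgue. H2per_deriv 1 u x = b x)"
proof -
  have w: "has_weak_deriv_on UNIV 1 (rep_h2per u) (H2per_deriv 1 u)" "has_weak_deriv_on UNIV 2 (rep_h2per u) (H2per_deriv 2 u)"
    by (simp_all add: H2per_deriv)
  note l = H2per_deriv_locally_square_integrable[of u]
  obtain c where c: "AE x in lebesgue. rep_h2per u x = c + primitive (H2per_deriv 1 u) x"
    using weak_deriv_imp_primitive[OF rep_h2per_locally_square_integrable l(1) w(1)] by blast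
  obtain c' where c': "AE x in lebesgue. H2per_deriv 1 u x = c' + primitive (H2per_deriv 2 u) x"
    using weak_deriv_imp_primitive[OF l has_weak_deriv_diff[OF w]] by blast
  show "\<exists>a. continuous_on UNIV a \<and> (AE x in lebesgue. rep_h2per u x = a x)"
    using c by (intro exI[of _ "\<lambda>x. c + primitive (H2per_deriv 1 u) x"] conjI continuous_intros
        primitive_continuous locally_square_integrable_imp_locally_integrable l)
  show "\<exists>b. continuous_on UNIV b \<and> (AE x in lebesgue. H2per_deriv 1 u x = b x)"
    using c' by (intro exI[of _ "\<lambda>x. c' + primitive (H2per_deriv 2 u) x"] conjI continuous_intros
        primitive_continuous locally_square_integrable_imp_locally_integrable l)
qed

lemma h2_value_AE: "AE x in lebesgue. rep_h2per u x = h2_value u x"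
  and h2_value_continuous: "continuous_on S (h2_value u)"
  using someI_ex[OF continuous_representatives(1)[of u]] unfolding h2_value_def[symmetric]
  by (auto intro: continuous_on_subset)

lemma h2_slope_AE: "AE x in lebesgue. H2per_deriv 1 u x = h2_slope u x"
  and h2_slope_continuous: "continuous_on S (h2_slope u)"
  using someI_ex[OF continuous_representatives(2)[of u]] unfolding h2_slope_def[symmetric]
  by (auto intro: continuous_on_subset)

lemma h2_value_eqI:
  "continuous_on UNIV a \<Longrightarrow> AE x in lebesgue. rep_h2per u x = a x \<Longrightarrow> h2_value u = a"
  by (rule continuous_AE_eq_imp_eq[OF h2_value_continuous])
    (use h2_value_AE[of u] in \<open>auto elim: eventually_elim2\<close>)

lemma h2_slope_eqI:
  "continuous_on UNIV b \<Longrightarrow> AE x in lebesgue. H2per_deriv 1 u x = b x \<Longrightarrow> h2_slope u = b"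
  by (rule continuous_AE_eq_imp_eq[OF h2_slope_continuous])
    (use h2_slope_AE[of u] in \<open>auto elim: eventually_elim2\<close>)

lemma h2_slope_combine:
  assumes "s \<le> t"
  shows "h2_slope u t = h2_slope u s + integral {s..t} (H2per_deriv 2 u)"
proof -
  note l = H2per_deriv_locally_square_integrable[of u]
  note li = locally_square_integrable_imp_locally_integrable[OF l(2)]
  have w: "has_weak_deriv_on UNIV 1 (H2per_deriv 1 u) (H2per_deriv 2 u)"
    by (rule has_weak_deriv_diff[of "rep_h2per u"]) (simp_all add: H2per_deriv)
  obtain c where c: "AE x in lebesgue. H2per_deriv 1 u x = c + primitive (H2per_deriv 2 u) x"
    using weak_deriv_imp_primitive[OF l w] by blast
  have "h2_slope u = (\<lambda>x. c + primitive (H2per_deriv 2 u) x)"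
    by (rule h2_slope_eqI[OF _ c]) (intro continuous_intros primitive_continuous li)
  then show ?thesis using primitive_combine[OF li assms] by simp
qed

lemma h2_value_has_vector_derivative: "(h2_value u has_vector_derivative h2_slope u x) (at x)"
proof -
  note l = H2per_deriv_locally_square_integrable[of u]
  have w: "has_weak_deriv_on UNIV 1 (rep_h2per u) (H2per_deriv 1 u)" by (simp add: H2per_deriv)
  obtain c where c: "AE x in lebesgue. rep_h2per u x = c + primitive (H2per_deriv 1 u) x"
    using weak_deriv_imp_primitive[OF rep_h2per_locally_square_integrable l(1) w] by blast
  have "h2_value u = (\<lambda>x. c + primitive (h2_slope u) x)"
    using c unfolding primitive_cong_AE[OF h2_slope_AE]
    by (intro h2_value_eqI continuous_intros primitive_continuous continuous_imp_locally_integrable h2_slope_continuous)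
  then show ?thesis
    using has_vector_derivative_add[OF has_vector_derivative_const[of c]
        primitive_has_vector_derivative[OF h2_slope_continuous, of u x]] by simp
qed

lemma AE_lebesgue_shift:
  fixes P :: "real \<Rightarrow> bool"
  assumes "AE x in lebesgue. P x"
  shows "AE x in lebesgue. P (x + c)"
proof -
  have "negligible {x. \<not> P x}" using assms by (simp add: AE_lebesgue_iff_negligible)
  then have "negligible ((+) (- c) ` {x. \<not> P x})" by (rule negligible_translation)
  moreover have "{x. \<not> P (x + c)} \<subseteq> (+) (- c) ` {x. \<not> P x}"
  proof
    fix x assume "x \<in> {x. \<not> P (x + c)}"
    then show "x \<in> (+) (- c) ` {x. \<not> P x}" by (intro image_eqI[of _ _ "x + c"]) auto
  qed
  ultimately show ?thesis unfolding AE_lebesgue_iff_negligible by (rule negligible_subset)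
qed

lemma h2_value_periodic: "h2_value u (x + 2 * pi) = h2_value u x"
proof -
  have "(\<lambda>x. h2_value u (x + 2 * pi)) = h2_value u"
  proof (rule continuous_AE_eq_imp_eq)
    show "continuous_on UNIV (\<lambda>x. h2_value u (x + 2 * pi))"
      by (rule continuous_on_compose2[OF h2_value_continuous[of UNIV]]) (auto intro!: continuous_intros)
    show "AE x in lebesgue. h2_value u (x + 2 * pi) = h2_value u x"
      using AE_lebesgue_shift[OF h2_value_AE[of u], of "2 * pi"] h2_value_AE[of u]
      by eventually_elim (simp add: rep_h2per_periodic)
  qed (rule h2_value_continuous)
  then show ?thesis by metis
qed

lemma h2_slope_periodic: "h2_slope u (x + 2 * pi) = h2_slope u x"
proof -
  have "((\<lambda>x. x + 2 * pi) has_real_derivative 1) (at x)"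
    by (auto intro!: derivative_eq_intros)
  then have "((h2_value u \<circ> (\<lambda>x. x + 2 * pi)) has_vector_derivative (1 *\<^sub>R h2_slope u (x + 2 * pi))) (at x)"
    by (intro vector_diff_chain_at) (auto simp: has_real_derivative_iff_has_vector_derivative h2_value_has_vector_derivative)
  then have "(h2_value u has_vector_derivative h2_slope u (x + 2 * pi)) (at x)"
    by (simp add: o_def h2_value_periodic)
  then show ?thesis using h2_value_has_vector_derivative vector_derivative_unique_at by blast
qed

lemma h2_value_add: "h2_value (u + v) = (\<lambda>x. h2_value u x + h2_value v x)"
proof (rule h2_value_eqI)
  show "continuous_on UNIV (\<lambda>x. h2_value u x + h2_value v x)" by (intro continuous_intros h2_value_continuous)
  show "AE x in lebesgue. rep_h2per (u + v) x = h2_value u x + h2_value v x"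
    using rep_h2per_add[of u v] h2_value_AE[of u] h2_value_AE[of v] by (eventually_elim) simp
qed

lemma h2_value_scaleR: "h2_value (c *\<^sub>R u) = (\<lambda>x. c *\<^sub>R h2_value u x)"
proof (rule h2_value_eqI)
  show "continuous_on UNIV (\<lambda>x. c *\<^sub>R h2_value u x)" by (intro continuous_intros h2_value_continuous)
  show "AE x in lebesgue. rep_h2per (c *\<^sub>R u) x = c *\<^sub>R h2_value u x"
    using rep_h2per_scaleR[of c u] h2_value_AE[of u] by (eventually_elim) simp
qed

lemma h2_slope_add: "h2_slope (u + v) = (\<lambda>x. h2_slope u x + h2_slope v x)"
proof (rule h2_slope_eqI)
  show "continuous_on UNIV (\<lambda>x. h2_slope u x + h2_slope v x)" by (intro continuous_intros h2_slope_continuous)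
  show "AE x in lebesgue. H2per_deriv 1 (u + v) x = h2_slope u x + h2_slope v x"
    using H2per_deriv_add[of 1 u v, OF one_le_numeral] h2_slope_AE[of u] h2_slope_AE[of v] by (eventually_elim) simp
qed

lemma h2_slope_scaleR: "h2_slope (c *\<^sub>R u) = (\<lambda>x. c *\<^sub>R h2_slope u x)"
proof (rule h2_slope_eqI)
  show "continuous_on UNIV (\<lambda>x. c *\<^sub>R h2_slope u x)" by (intro continuous_intros h2_slope_continuous)
  show "AE x in lebesgue. H2per_deriv 1 (c *\<^sub>R u) x = c *\<^sub>R h2_slope u x"
    using H2per_deriv_scaleR[of 1 c u, OF one_le_numeral] h2_slope_AE[of u] by (eventually_elim) simp
qed

lemma mean_add:
  "locally_integrable f \<Longrightarrow> locally_integrable g \<Longrightarrow> mean (\<lambda>x. f x + g x) = mean f + mean g"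
  by (simp add: mean_def integral_add locally_integrableD scaleR_add_right)

lemma mean_scaleR: "mean (\<lambda>x. c *\<^sub>R f x) = c *\<^sub>R mean f"
  by (simp add: mean_def)

lemma mean_const [simp]: "mean (\<lambda>x. c) = c"
  by (simp add: mean_def scaleR_conv_of_real)

lemma h2_value_locally_integrable: "locally_integrable (h2_value u)"
  by (rule continuous_imp_locally_integrable[OF h2_value_continuous])

text \<open>The slope is periodic, so the integral of \<open>u''\<close> over a period vanishes and the mean in the hypothesis
  is \<open>0\<close>. Then \<open>u\<close> is affine and periodic, hence constant, and the constant is its mean.\<close>

lemma h2per_zero_if_deriv_eq_mean:
  assumes "AE x in lebesgue. H2per_deriv 2 u x = mean (h2_value u)"
  shows "u = 0"
proof -
  define m where "m = mean (h2_value u)"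
  have neg: "negligible {x. H2per_deriv 2 u x \<noteq> m}" using assms by (simp add: AE_lebesgue_iff_negligible m_def)
  have i: "integral {s..t} (H2per_deriv 2 u) = (t - s) *\<^sub>R m" if "s \<le> t" for s t
  proof -
    have "integral {s..t} (H2per_deriv 2 u) = integral {s..t} (\<lambda>_. m)" using neg by (rule integral_spike) auto
    then show ?thesis using that by simp
  qed
  have m0: "m = 0"
    using h2_slope_combine[of 0 "2 * pi" u] i[of 0 "2 * pi"] h2_slope_periodic[of u 0] by simp
  have slope: "h2_slope u x = h2_slope u 0" for x
    using h2_slope_combine[of 0 x u] h2_slope_combine[of x 0 u] i[of 0 x] i[of x 0] m0 by (cases "0 \<le> x") auto
  have "((\<lambda>x. h2_slope u 0) has_integral (h2_value u (2 * pi) - h2_value u 0)) {0..2 * pi}"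
  proof (rule fundamental_theorem_of_calculus)
    show "(h2_value u has_vector_derivative h2_slope u 0) (at x within {0..2 * pi})" for x
      using h2_value_has_vector_derivative[of u x] unfolding slope[of x] by (rule has_vector_derivative_at_within)
  qed simp
  moreover have "h2_value u (2 * pi) - h2_value u 0 = 0" using h2_value_periodic[of u 0] by simp
  ultimately have "(2 * pi) *\<^sub>R h2_slope u 0 = 0"
    using has_integral_const_real[of "h2_slope u 0" 0 "2 * pi"] has_integral_unique
    by (metis (no_types, lifting) content_real diff_zero mult_nonneg_nonneg pi_ge_zero zero_le_numeral)
  then have "h2_slope u x = 0" for x using slope[of x] by simp
  then have d0: "(h2_value u has_vector_derivative 0) (at x within UNIV)" for x
    using h2_value_has_vector_derivative[of u x] by simp
  obtain c where "\<And>x. x \<in> UNIV \<Longrightarrow> h2_value u x = c"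
    using has_vector_derivative_zero_constant[OF convex_UNIV d0] by blast
  then have c: "h2_value u = (\<lambda>_. c)" by auto
  then have "c = 0" using m0 by (simp add: m_def)
  then have "AE x in lebesgue. rep_h2per u x = 0" using h2_value_AE[of u] c by simp
  then show ?thesis using rep_h2per_zero by (intro h2per_eqI) (auto elim: eventually_elim2)
qed

lemma h2per_eq_if_deriv_minus_mean_eq:
  assumes "AE x in lebesgue. H2per_deriv 2 u x - mean (h2_value u) = H2per_deriv 2 v x - mean (h2_value v)"
  shows "u = v"
proof -
  let ?w = "u + (-1) *\<^sub>R v"
  have M: "mean (h2_value ?w) = mean (h2_value u) + (-1) *\<^sub>R mean (h2_value v)"
    unfolding h2_value_add h2_value_scaleR mean_scaleR[symmetric]
    by (intro mean_add h2_value_locally_integrable continuous_imp_locally_integrable continuous_intros h2_value_continuous)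
  have D: "AE x in lebesgue. H2per_deriv 2 ?w x = H2per_deriv 2 u x + (-1) *\<^sub>R H2per_deriv 2 v x"
    using H2per_deriv_add[of 2 u "(-1) *\<^sub>R v", OF order.refl] H2per_deriv_scaleR[of 2 "-1" v, OF order.refl]
    by eventually_elim (simp only:)
  have "AE x in lebesgue. H2per_deriv 2 (u + - v) x = mean (h2_value (u + - v))"
    using assms D unfolding scaleR_minus1_left M[unfolded scaleR_minus1_left] by eventually_elim algebra
  then have "u + - v = 0" by (rule h2per_zero_if_deriv_eq_mean)
  then show ?thesis by simp
qed

section \<open>The norm and a Sobolev bound\<close>

lemma energy_integrable:
  assumes "locally_square_integrable f"
  shows "(\<lambda>x. (cmod (f x))\<^sup>2) integrable_on {a..b}"
proof -
  have "integrable (lebesgue_on {a..b}) (\<lambda>x. (cmod (f x))\<^sup>2)"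
    using assms by (simp add: locally_square_integrable_def square_integrable_def)
  then show ?thesis by (rule integrable_on_lebesgue_on) simp
qed

lemma energy_nonneg: "energy f \<ge> 0"
  unfolding energy_def
  by (cases "(\<lambda>x. (cmod (f x))\<^sup>2) integrable_on {0..2*pi}")
    (auto intro: integral_nonneg simp: not_integrable_integral)

lemma L2_norm_per_energy:
  assumes "locally_square_integrable f"
  shows "(L2_norm_per f)\<^sup>2 = energy f"
proof -
  have "integrable (lebesgue_on {0<..<2*pi}) (\<lambda>x. (cmod (f x))\<^sup>2)"
    using locally_imp_square_integrable[OF assms] by (simp add: square_integrable_def)
  then have "(LINT x|lebesgue_on {0<..<2*pi}. (cmod (f x))\<^sup>2) = integral {0<..<2*pi} (\<lambda>x. (cmod (f x))\<^sup>2)"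
    by (rule lebesgue_integral_eq_integral) simp
  also have "\<dots> = energy f" unfolding energy_def by (rule integral_open_interval_real[symmetric])
  finally show ?thesis using energy_nonneg[of f] by (simp add: L2_norm_per_def)
qed

lemma norm_h2per_energy:
  "(norm u)\<^sup>2 = energy (h2_value u) + energy (h2_slope u) + energy (H2per_deriv 2 u)"
proof -
  have "L2_norm_per (H2per_deriv 0 u) = L2_norm_per (h2_value u)"
    by (rule L2_norm_per_cong_AE)
      (use H2per_deriv_0[of u] h2_value_AE[of u] in \<open>auto simp: H2per_deriv
        intro!: continuous_imp_locally_square_integrable h2_value_continuous elim: eventually_elim2\<close>)
  moreover have "L2_norm_per (H2per_deriv 1 u) = L2_norm_per (h2_slope u)"
    by (rule L2_norm_per_cong_AE)
      (use h2_slope_AE[of u] in \<open>auto simp: H2per_deriv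
        intro!: continuous_imp_locally_square_integrable h2_slope_continuous\<close>)
  moreover have "(norm u)\<^sup>2 = (\<Sum>j\<le>2. (L2_norm_per (H2per_deriv j u))\<^sup>2)"
    unfolding norm_h2per_def by (simp add: sum_nonneg)
  moreover have "{..2} = {0, 1, 2 :: nat}" by auto
  ultimately show ?thesis
    by (simp add: L2_norm_per_energy continuous_imp_locally_square_integrable
        h2_value_continuous h2_slope_continuous H2per_deriv_locally_square_integrable)
qed

text \<open>The Cauchy-Schwarz inequality in the additive form that Young's inequality gives. Taking \<open>\<eta>\<close> small and then \<open>t - s\<close> small compared with \<open>\<eta>\<close> gives
  equicontinuity; \<open>\<eta> = 1\<close> gives the Sobolev bound.\<close>

lemma norm_integral_le_energy:
  assumes k: "locally_square_integrable k" and st: "0 \<le> s" "s \<le> t" "t \<le> 2 * pi" and \<eta>: "\<eta> > 0"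
  shows "cmod (integral {s..t} k) \<le> \<eta> * energy k + (t - s) / \<eta>"
proof -
  note li = locally_square_integrable_imp_locally_integrable[OF k]
  have "cmod (integral {s..t} k) \<le> integral {s..t} (\<lambda>x. \<eta> * (cmod (k x))\<^sup>2 + 1 / \<eta>)"
  proof (rule integral_norm_bound_integral)
    show "k integrable_on {s..t}" by (rule locally_integrableD[OF li])
    show "(\<lambda>x. \<eta> * (cmod (k x))\<^sup>2 + 1 / \<eta>) integrable_on {s..t}"
      by (intro integrable_add integrable_on_mult_right energy_integrable k) auto
    fix x
    have "0 \<le> (\<eta> * cmod (k x) - 1)\<^sup>2" by simp
    then have "2 * (\<eta> * cmod (k x)) \<le> \<eta> * (\<eta> * (cmod (k x))\<^sup>2) + 1" by (simp add: power2_eq_square algebra_simps)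
    then have "\<eta> * cmod (k x) \<le> \<eta> * (\<eta> * (cmod (k x))\<^sup>2 + 1 / \<eta>)"
    proof -
      have "0 \<le> \<eta> * cmod (k x)" using \<eta> by simp
      then have "\<eta> * cmod (k x) \<le> \<eta> * (\<eta> * (cmod (k x))\<^sup>2) + 1"
        using \<open>2 * (\<eta> * cmod (k x)) \<le> _\<close> by linarith
      then show ?thesis using \<eta> by (simp add: distrib_left)
    qed
    then show "cmod (k x) \<le> \<eta> * (cmod (k x))\<^sup>2 + 1 / \<eta>" using \<eta> by simp
  qed
  also have "\<dots> = \<eta> * integral {s..t} (\<lambda>x. (cmod (k x))\<^sup>2) + (t - s) / \<eta>"
    using st(2) by (subst integral_add) (auto intro!: integrable_on_mult_right energy_integrable k)
  also have "integral {s..t} (\<lambda>x. (cmod (k x))\<^sup>2) \<le> energy k"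
    unfolding energy_def by (intro integral_subset_le energy_integrable k) (use st in auto)
  finally show ?thesis using \<eta> by simp
qed

text \<open>The minimum of \<open>cmod f\<close> is at most its average, which \<open>y \<le> 1 + y\<^sup>2\<close> bounds by the energy; the oscillation of
  \<open>f\<close> is bounded by \<open>norm_integral_le_energy\<close>.\<close>

lemma sup_le_energy:
  fixes f k :: "real \<Rightarrow> complex"
  assumes f: "continuous_on UNIV f" and k: "locally_square_integrable k"
    and fk: "\<And>s t. s \<le> t \<Longrightarrow> f t = f s + integral {s..t} k" and s: "s \<in> {0..2 * pi}" and \<eta>: "\<eta> > 0"
  shows "cmod (f s) \<le> 1 + energy f + (\<eta> * energy k + 2 * pi / \<eta>)"
proof -
  have fc: "continuous_on {0..2 * pi} (\<lambda>x. cmod (f x))" by (intro continuous_intros continuous_on_subset[OF f]) auto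
  obtain t where t: "t \<in> {0..2 * pi}" "\<And>x. x \<in> {0..2 * pi} \<Longrightarrow> cmod (f t) \<le> cmod (f x)"
    using continuous_attains_inf[OF compact_Icc _ fc] by auto
  have "integral {0..2 * pi} (\<lambda>x. cmod (f t)) \<le> integral {0..2 * pi} (\<lambda>x. 1 + (cmod (f x))\<^sup>2)"
  proof (rule integral_le)
    show "(\<lambda>x. 1 + (cmod (f x))\<^sup>2) integrable_on {0..2 * pi}"
      by (intro integrable_add energy_integrable continuous_imp_locally_square_integrable f) auto
    fix x assume "x \<in> {0..2 * pi}"
    then have "cmod (f t) \<le> cmod (f x)" by (rule t)
    also have "\<dots> \<le> 1 + (cmod (f x))\<^sup>2"
      using zero_le_power2[of "cmod (f x) - 1 / 2"] by (simp add: power2_eq_square algebra_simps)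
    finally show "cmod (f t) \<le> 1 + (cmod (f x))\<^sup>2" .
  qed auto
  also have "\<dots> = 2 * pi + energy f"
    unfolding energy_def
    by (subst integral_add) (auto intro!: energy_integrable continuous_imp_locally_square_integrable f)
  finally have "2 * pi * cmod (f t) \<le> 2 * pi + energy f" by simp
  also have "\<dots> \<le> 2 * pi * (1 + energy f)"
    using energy_nonneg[of f] mult_right_mono[of 1 "2 * pi" "energy f"] pi_gt3 by (simp add: algebra_simps)
  finally have 1: "cmod (f t) \<le> 1 + energy f" by simp
  have le: "cmod (f y - f x) \<le> \<eta> * energy k + 2 * pi / \<eta>" if "x \<in> {0..2 * pi}" "y \<in> {0..2 * pi}" "x \<le> y" for x y
  proof -
    have "cmod (f y - f x) \<le> \<eta> * energy k + (y - x) / \<eta>"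
      using norm_integral_le_energy[OF k, of x y \<eta>] that \<eta> fk[OF that(3)] by simp
    also have "(y - x) / \<eta> \<le> 2 * pi / \<eta>" using that \<eta> by (intro divide_right_mono) auto
    finally show ?thesis by simp
  qed
  have "cmod (f s - f t) \<le> \<eta> * energy k + 2 * pi / \<eta>"
    using le[of s t] le[of t s] s t(1) by (cases "s \<le> t") (auto simp: norm_minus_commute)
  then show ?thesis using 1 norm_triangle_sub[of "f s" "f t"] by linarith
qed

lemma h2_value_combine: "s \<le> t \<Longrightarrow> h2_value u t = h2_value u s + integral {s..t} (h2_slope u)"
  using integral_unique[OF fundamental_theorem_of_calculus[of s t "h2_value u" "h2_slope u",
        OF _ has_vector_derivative_at_within[OF h2_value_has_vector_derivative]]] by simp

lemma sobolev_bound: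
  assumes "s \<in> {0..2 * pi}"
  shows "cmod (h2_value u s) \<le> 1 + 2 * pi + (norm u)\<^sup>2" "cmod (h2_slope u s) \<le> 1 + 2 * pi + (norm u)\<^sup>2"
  using sup_le_energy[OF h2_value_continuous continuous_imp_locally_square_integrable[OF h2_slope_continuous] h2_value_combine assms, of 1 u]
    sup_le_energy[OF h2_slope_continuous H2per_deriv_locally_square_integrable(2) h2_slope_combine assms, of 1 u]
    energy_nonneg[of "h2_value u"] energy_nonneg[of "h2_slope u"] energy_nonneg[of "H2per_deriv 2 u"]
  unfolding norm_h2per_energy by linarith+

section \<open>Periodic functions\<close>

lemma periodic_shift_nat:
  fixes f :: "real \<Rightarrow> 'a"
  assumes "\<And>x. f (x + 2 * pi) = f x"
  shows "f (x + 2 * pi * real n) = f x"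
proof (induction n)
  case (Suc n)
  then show ?case using assms[of "x + 2 * pi * real n"] by (simp add: algebra_simps)
qed simp

lemma periodic_integrable:
  fixes f :: "real \<Rightarrow> 'a::banach"
  assumes per: "\<And>x. f (x + 2 * pi) = f x" and i: "f integrable_on {0..2 * pi}"
  shows "f integrable_on {a..b}"
proof -
  have pos: "f integrable_on {2 * pi * real n..2 * pi * real (Suc n)}" for n
  proof -
    have e: "(\<lambda>x. f (x + 2 * pi * real n)) = f" by (simp add: fun_eq_iff periodic_shift_nat[of f, OF per])
    have b: "2 * pi * real n - 2 * pi * real n = 0" "2 * pi * real (Suc n) - 2 * pi * real n = 2 * pi"
      by (simp_all add: algebra_simps)
    show ?thesis
      using integrable_shift_real_ivl_iff[of f "2 * pi * real n" "2 * pi * real n" "2 * pi * real (Suc n)"] i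
      unfolding b e by simp
  qed
  have neg: "f integrable_on {- (2 * pi * real (Suc n))..- (2 * pi * real n)}" for n
  proof -
    have e: "(\<lambda>x. f (x + 2 * pi * real (Suc n))) = f"
      using periodic_shift_nat[of f, OF per] by (simp add: fun_eq_iff del: of_nat_Suc)
    have b: "0 - 2 * pi * real (Suc n) = - (2 * pi * real (Suc n))" "2 * pi - 2 * pi * real (Suc n) = - (2 * pi * real n)"
      by (simp_all add: algebra_simps)
    show ?thesis
      using integrable_shift_real_ivl_iff[of f "2 * pi * real (Suc n)" 0 "2 * pi"] i unfolding b e by simp
  qed
  have big: "f integrable_on {- (2 * pi * real n)..2 * pi * real n}" for n
  proof (induction n)
    case 0
    show ?case using integrable_on_refl[of f "0 :: real"] by simp
  next
    case (Suc n)
    have "f integrable_on {- (2 * pi * real (Suc n))..2 * pi * real n}"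
      by (rule Henstock_Kurzweil_Integration.integrable_combine[OF _ _ neg Suc]) auto
    from Henstock_Kurzweil_Integration.integrable_combine[OF _ _ this pos] show ?case
      by (simp add: order_trans[of _ 0])
  qed
  obtain n :: nat where n: "max \<bar>a\<bar> \<bar>b\<bar> / (2 * pi) \<le> real n" using real_arch_simple by blast
  then have "max \<bar>a\<bar> \<bar>b\<bar> \<le> 2 * pi * real n" by (simp add: field_simps)
  then have "{a..b} \<subseteq> {- (2 * pi * real n)..2 * pi * real n}" by (auto simp: max_def split: if_splits)
  then show ?thesis using big integrable_subinterval_real by blast
qed

lemma locally_square_integrable_HK:
  assumes "\<And>a b. f integrable_on {a..b}" "\<And>a b. (\<lambda>x. cmod (f x)) integrable_on {a..b}"
    and "\<And>a b. (\<lambda>x. (cmod (f x))\<^sup>2) integrable_on {a..b}"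
  shows "locally_square_integrable f"
  unfolding locally_square_integrable_def square_integrable_def
proof (intro allI conjI)
  fix a b :: real
  have "f absolutely_integrable_on {a..b}" using assms(1,2) by (simp add: absolutely_integrable_on_def)
  then have "integrable (lebesgue_on {a..b}) f" by (simp add: set_integrable_def integrable_restrict_space)
  then show "f \<in> borel_measurable (lebesgue_on {a..b})" by (rule borel_measurable_integrable)
  have "(\<lambda>x. (cmod (f x))\<^sup>2) absolutely_integrable_on {a..b}"
    using assms(3) by (simp add: absolutely_integrable_on_def)
  then show "integrable (lebesgue_on {a..b}) (\<lambda>x. (cmod (f x))\<^sup>2)"
    by (simp add: set_integrable_def integrable_restrict_space)
qed

lemma periodic_extension_periodic: "periodic_extension e (x + 2 * pi) = periodic_extension e x"
proof -
  have "\<lfloor>(x + 2 * pi) / (2 * pi)\<rfloor> = \<lfloor>x / (2 * pi)\<rfloor> + 1" by (simp add: add_divide_distrib)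
  then show ?thesis by (simp add: periodic_extension_def algebra_simps)
qed

lemma periodic_extension_eq:
  assumes "0 \<le> x" "x < 2 * pi"
  shows "periodic_extension e x = e x"
proof -
  have "\<lfloor>x / (2 * pi)\<rfloor> = 0" using assms by (simp add: floor_eq_iff)
  then show ?thesis by (simp add: periodic_extension_def)
qed

lemma periodic_eqI:
  assumes "\<And>x. f (x + 2 * pi) = f x" and "\<And>x. g (x + 2 * pi) = g x"
    and "\<And>x. 0 \<le> x \<Longrightarrow> x < 2 * pi \<Longrightarrow> f x = g x"
  shows "f = g"
proof
  fix x
  define k where "k = \<lfloor>x / (2 * pi)\<rfloor>"
  define y where "y = x - 2 * pi * real_of_int k"
  have "real_of_int k \<le> x / (2 * pi)" "x / (2 * pi) < real_of_int k + 1" unfolding k_def by linarith+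
  then have y: "0 \<le> y" "y < 2 * pi" by (auto simp: y_def field_simps)
  have "f x = f y \<and> g x = g y"
  proof (cases "0 \<le> k")
    case True
    then have "x = y + 2 * pi * real (nat k)" by (simp add: y_def)
    then show ?thesis using periodic_shift_nat[of f, OF assms(1)] periodic_shift_nat[of g, OF assms(2)] by metis
  next
    case False
    then have "y = x + 2 * pi * real (nat (- k))" by (simp add: y_def)
    then show ?thesis using periodic_shift_nat[of f, OF assms(1)] periodic_shift_nat[of g, OF assms(2)] by metis
  qed
  then show "f x = g x" using assms(3)[OF y] by simp
qed

lemma periodic_extension_locally_square_integrable:
  assumes e: "square_integrable {0<..<2 * pi} e"
  shows "locally_square_integrable (periodic_extension e)"
proof -
  interpret finite_measure "lebesgue_on {0<..<2 * pi :: real}" by (rule finite_measure_lebesgue_on) simp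
  have m: "e \<in> borel_measurable (lebesgue_on {0<..<2 * pi})" and
    e2: "integrable (lebesgue_on {0<..<2 * pi}) (\<lambda>x. (cmod (e x))\<^sup>2)"
    using e by (simp_all add: square_integrable_def)
  have e1: "integrable (lebesgue_on {0<..<2 * pi}) e"
  proof (rule Bochner_Integration.integrable_bound[OF _ m])
    show "integrable (lebesgue_on {0<..<2 * pi}) (\<lambda>x. 1 + (cmod (e x))\<^sup>2)" using e2 by simp
    have "t \<le> 1 + t\<^sup>2" for t :: real using zero_le_power2[of "t - 1/2"]
      by (simp add: power2_eq_square algebra_simps)
    then show "AE x in lebesgue_on {0<..<2 * pi}. cmod (e x) \<le> norm (1 + (cmod (e x))\<^sup>2)"
      by (auto intro: order_trans)
  qed
  have key: "(\<lambda>x. G (periodic_extension e x)) integrable_on {a..b}"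
    if "integrable (lebesgue_on {0<..<2 * pi}) (\<lambda>x. G (e x))" for G :: "complex \<Rightarrow> 'b::euclidean_space" and a b
  proof (rule periodic_integrable)
    have "(\<lambda>x. G (e x)) integrable_on {0<..<2 * pi}" using that by (rule integrable_on_lebesgue_on) simp
    then have "(\<lambda>x. G (periodic_extension e x)) integrable_on {0<..<2 * pi}"
      by (rule integrable_eq) (simp add: periodic_extension_eq)
    then show "(\<lambda>x. G (periodic_extension e x)) integrable_on {0..2 * pi}"
      by (simp add: integrable_on_def has_integral_Icc_iff_Ioo)
  qed (simp add: periodic_extension_periodic)
  show ?thesis
    by (rule locally_square_integrable_HK) (auto intro!: key e1 e2 integrable_norm)
qed

section \<open>The operator \<open>v \<mapsto> v'' - mean v\<close>\<close>

lemma primitive_periodic: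
  assumes li: "locally_integrable f" and per: "\<And>x. f (x + 2 * pi) = f x" and int: "integral {0..2 * pi} f = 0"
  shows "primitive f (x + 2 * pi) = primitive f x"
proof -
  have shift: "integral {a + 2 * pi..b + 2 * pi} f = integral {a..b} f" for a b
    using integral_shift_real_ivl[of "a + 2 * pi" "2 * pi" "b + 2 * pi" f] by (simp add: per)
  have p: "primitive f (2 * pi) = 0" using int by (simp add: primitive_nonneg)
  show ?thesis
  proof (cases "0 \<le> x")
    case True
    then show ?thesis
      using primitive_combine[OF li, of "2 * pi" "x + 2 * pi"] shift[of 0 x] p by (simp add: primitive_nonneg)
  next
    case False
    then show ?thesis
      using primitive_combine[OF li, of "x + 2 * pi" "2 * pi"] primitive_combine[OF li, of x 0] shift[of x 0] p
      by (simp add: add_eq_0_iff)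
  qed
qed

lemma norm_integral_le_sup:
  assumes "locally_integrable f" "\<And>x. x \<in> {0..2 * pi} \<Longrightarrow> cmod (f x) \<le> C" "0 \<le> s" "s \<le> 2 * pi"
  shows "cmod (integral {0..s} f) \<le> 2 * pi * C"
proof -
  have C: "0 \<le> C" using order_trans[OF norm_ge_zero assms(2)[of 0]] by simp
  have "cmod (integral {0..s} f) \<le> integral {0..s} (\<lambda>_. C)"
    by (rule integral_norm_bound_integral) (use assms in \<open>auto intro: locally_integrableD\<close>)
  also have "\<dots> = s * C" using assms by simp
  also have "\<dots> \<le> 2 * pi * C" using assms C by (intro mult_right_mono) auto
  finally show ?thesis .
qed

lemma norm_mean_le:
  assumes "locally_integrable f" "\<And>x. x \<in> {0..2 * pi} \<Longrightarrow> cmod (f x) \<le> C"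
  shows "cmod (mean f) \<le> C"
proof -
  have "cmod (integral {0..2 * pi} f) \<le> 2 * pi * C" by (rule norm_integral_le_sup) (use assms in auto)
  then show ?thesis by (simp add: mean_def field_simps)
qed

lemma energy_le_sup:
  assumes "locally_square_integrable f" "\<And>x. x \<in> {0..2 * pi} \<Longrightarrow> cmod (f x) \<le> C"
  shows "energy f \<le> 2 * pi * C\<^sup>2"
proof -
  have "energy f \<le> integral {0..2 * pi} (\<lambda>_. C\<^sup>2)"
    unfolding energy_def
    by (rule integral_le) (use assms in \<open>auto intro!: energy_integrable power_mono\<close>)
  then show ?thesis by simp
qed

lemma energy_cong_AE:
  assumes "AE x in lebesgue. f x = g x"
  shows "energy f = energy g"
proof -
  have "negligible {x. f x \<noteq> g x}" using assms by (simp add: AE_lebesgue_iff_negligible)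
  then show ?thesis unfolding energy_def by (rule integral_spike) auto
qed

text \<open>For \<open>cmod g \<le> 1\<close> the solution \<open>v\<close> below satisfies \<open>cmod v \<le> 1 + 32 \<pi>\<^sup>2\<close>, \<open>cmod v' \<le> 8 \<pi>\<close> and \<open>cmod v'' \<le> 2\<close> on a period;
  this is the resulting bound on its norm.\<close>

definition solution_bound :: real where
  "solution_bound = sqrt (2 * pi * ((1 + 32 * pi\<^sup>2)\<^sup>2 + (8 * pi)\<^sup>2 + 2\<^sup>2))"

text \<open>The second derivative on periodic functions has the constants as kernel, and its range is the set of functions of
  mean zero. Subtracting the mean repairs both defects and leaves an inverse that consists of two
  primitives: the mean of \<open>g\<close> is removed before the first one, the mean of the first primitive \<open>G1\<close> before the
  second one, so that both are periodic, and the additive constant \<open>c\<close> is chosen such that the mean of the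
  solution is minus the mean of \<open>g\<close>.\<close>

lemma periodic_problem:
  assumes g: "locally_square_integrable g" and per: "\<And>x. g (x + 2 * pi) = g x"
  shows "\<exists>u. (AE x in lebesgue. H2per_deriv 2 u x - mean (h2_value u) = g x) \<and>
    (\<forall>B. (\<forall>x. cmod (g x) \<le> B) \<longrightarrow> norm u \<le> solution_bound * B)"
proof -
  note li = locally_square_integrable_imp_locally_integrable[OF g]
  have gm: "locally_square_integrable (\<lambda>x. g x + (-1) *\<^sub>R mean g)"
    by (intro locally_square_integrable_add g locally_square_integrable_const)
  define g0 where "g0 x = g x + (-1) *\<^sub>R mean g" for x
  have g0: "locally_square_integrable g0" using gm by (simp add: g0_def[abs_def])
  note li0 = locally_square_integrable_imp_locally_integrable[OF g0]
  have zero: "integral {0..2 * pi} (\<lambda>x. f x + (-1) *\<^sub>R mean f) = 0" if "locally_integrable f" for f :: "real \<Rightarrow> complex"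
    using that by (subst integral_add) (auto intro: locally_integrableD simp: mean_def)
  define G1 where "G1 = primitive g0"
  have G1c: "continuous_on UNIV G1" unfolding G1_def by (rule primitive_continuous[OF li0])
  have per1: "G1 (x + 2 * pi) = G1 x" for x
    unfolding G1_def by (rule primitive_periodic[OF li0]) (use per zero[OF li] in \<open>simp_all add: g0_def[abs_def]\<close>)
  note li1 = continuous_imp_locally_integrable[OF G1c]
  define G2 where "G2 x = G1 x + (-1) *\<^sub>R mean G1" for x
  have G2c: "continuous_on UNIV G2" unfolding G2_def by (intro continuous_intros G1c)
  note li2 = continuous_imp_locally_integrable[OF G2c]
  note lsi2 = continuous_imp_locally_square_integrable[OF G2c]
  define V where "V = primitive G2"
  have Vc: "continuous_on UNIV V" unfolding V_def by (rule primitive_continuous[OF li2])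
  have perV: "V (x + 2 * pi) = V x" for x
    unfolding V_def by (rule primitive_periodic[OF li2]) (use per1 zero[OF li1] in \<open>simp_all add: G2_def[abs_def]\<close>)
  note liV = continuous_imp_locally_integrable[OF Vc]
  define c where "c = - mean V - mean g"
  define v where "v x = c + V x" for x
  have vc: "continuous_on UNIV v" unfolding v_def by (intro continuous_intros Vc)
  note lsiv = continuous_imp_locally_square_integrable[OF vc]
  have w1: "has_weak_deriv_on UNIV 1 v G2"
    unfolding v_def V_def by (rule has_weak_deriv_primitive[OF lsi2])
  have "has_weak_deriv_on UNIV 1 (\<lambda>x. (- mean G1) + primitive g0 x) g0" by (rule has_weak_deriv_primitive[OF g0])
  moreover have "(\<lambda>x. (- mean G1) + primitive g0 x) = G2" by (simp add: G2_def G1_def fun_eq_iff)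
  ultimately have w2: "has_weak_deriv_on UNIV 2 v g0" using has_weak_deriv_Suc[OF w1] by simp
  have vH: "v \<in> H2per_funs"
    unfolding H2per_funs_def using lsiv w1 w2 lsi2 g0 perV by (auto simp: v_def)
  define u where "u = abs_h2per v"
  have rep: "AE x in lebesgue. rep_h2per u x = v x" unfolding u_def by (rule rep_abs_h2per[OF vH])
  have val: "h2_value u = v" by (rule h2_value_eqI[OF vc rep])
  have "AE x in lebesgue. H2per_deriv 1 u x = G2 x"
    by (rule H2per_deriv_AE_eqI[OF _ lsiv lsi2 rep w1]) simp
  then have slope: "h2_slope u = G2" by (rule h2_slope_eqI[OF G2c])
  have D2: "AE x in lebesgue. H2per_deriv 2 u x = g0 x"
    by (rule H2per_deriv_AE_eqI[OF _ lsiv g0 rep w2]) simp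
  have "mean v = c + mean V"
    unfolding v_def by (subst mean_add) (auto intro: liV continuous_imp_locally_integrable)
  then have mv: "mean v = - mean g" by (simp add: c_def)
  have "AE x in lebesgue. H2per_deriv 2 u x - mean (h2_value u) = g x"
    using D2 by eventually_elim (simp add: val mv g0_def)
  moreover have "norm u \<le> solution_bound * B" if B: "\<And>x. cmod (g x) \<le> B" for B
  proof -
    have B0: "0 \<le> B" using B[of 0] norm_ge_zero[of "g 0"] by linarith
    have mg: "cmod (mean g) \<le> B" by (rule norm_mean_le[OF li B])
    have b0: "cmod (g0 x) \<le> 2 * B" for x
      using norm_triangle_ineq4[of "g x" "mean g"] B[of x] mg by (simp add: g0_def)
    have b1: "cmod (G1 x) \<le> 4 * pi * B" if "x \<in> {0..2 * pi}" for x
      using norm_integral_le_sup[OF li0 b0, of x] that by (simp add: G1_def primitive_nonneg)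
    have m1: "cmod (mean G1) \<le> 4 * pi * B" by (rule norm_mean_le[OF li1 b1])
    have b2: "cmod (G2 x) \<le> 8 * pi * B" if "x \<in> {0..2 * pi}" for x
      using norm_triangle_ineq4[of "G1 x" "mean G1"] b1[OF that] m1 by (simp add: G2_def)
    have b3: "cmod (V x) \<le> 16 * pi\<^sup>2 * B" if "x \<in> {0..2 * pi}" for x
      using norm_integral_le_sup[OF li2 b2, of x] that by (simp add: V_def primitive_nonneg power2_eq_square)
    have m3: "cmod (mean V) \<le> 16 * pi\<^sup>2 * B" by (rule norm_mean_le[OF liV b3])
    have b4: "cmod (v x) \<le> (1 + 32 * pi\<^sup>2) * B" if "x \<in> {0..2 * pi}" for x
    proof -
      have "v x = V x - (mean V + mean g)" by (simp add: v_def c_def)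
      then have "cmod (v x) \<le> cmod (V x) + (cmod (mean V) + cmod (mean g))"
        by (metis add_left_mono norm_triangle_ineq norm_triangle_ineq4 order_trans)
      then show ?thesis using b3[OF that] m3 mg by (simp add: algebra_simps)
    qed
    have "(norm u)\<^sup>2 = energy v + energy G2 + energy g0"
      unfolding norm_h2per_energy val slope energy_cong_AE[OF D2] ..
    also have "\<dots> \<le> 2 * pi * ((1 + 32 * pi\<^sup>2) * B)\<^sup>2 + 2 * pi * (8 * pi * B)\<^sup>2 + 2 * pi * (2 * B)\<^sup>2"
      by (intro add_mono energy_le_sup lsiv lsi2 g0 b4 b2 b0)
    also have "\<dots> = (solution_bound * B)\<^sup>2"
    proof -
      have "solution_bound\<^sup>2 = 2 * pi * ((1 + 32 * pi\<^sup>2)\<^sup>2 + (8 * pi)\<^sup>2 + 2\<^sup>2)"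
        by (simp add: solution_bound_def)
      then show ?thesis
        unfolding power_mult_distrib[of _ B] by (simp only: distrib_left distrib_right mult.assoc)
    qed
    finally show ?thesis
      by (rule power2_le_imp_le) (use B0 in \<open>simp add: solution_bound_def\<close>)
  qed
  ultimately show ?thesis by blast
qed

definition solve :: "(real \<Rightarrow> complex) \<Rightarrow> h2per" where
  "solve g = (THE u. AE x in lebesgue. H2per_deriv 2 u x - mean (h2_value u) = g x)"

lemma solve:
  assumes "locally_square_integrable g" "\<And>x. g (x + 2 * pi) = g x"
  shows "AE x in lebesgue. H2per_deriv 2 (solve g) x - mean (h2_value (solve g)) = g x"
    and "(\<And>x. cmod (g x) \<le> B) \<Longrightarrow> norm (solve g) \<le> solution_bound * B"
    and "AE x in lebesgue. H2per_deriv 2 u x - mean (h2_value u) = g x \<Longrightarrow> u = solve g"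
proof -
  obtain w where w: "AE x in lebesgue. H2per_deriv 2 w x - mean (h2_value w) = g x"
    "\<And>B. (\<And>x. cmod (g x) \<le> B) \<Longrightarrow> norm w \<le> solution_bound * B"
    using periodic_problem[OF assms] by blast
  have uniq: "u = w" if "AE x in lebesgue. H2per_deriv 2 u x - mean (h2_value u) = g x" for u
    by (rule h2per_eq_if_deriv_minus_mean_eq) (use that w(1) in \<open>auto elim: eventually_elim2\<close>)
  have s: "solve g = w" unfolding solve_def using w(1) uniq by (rule the_equality)
  show "AE x in lebesgue. H2per_deriv 2 (solve g) x - mean (h2_value (solve g)) = g x"
    unfolding s by (rule w)
  show "(\<And>x. cmod (g x) \<le> B) \<Longrightarrow> norm (solve g) \<le> solution_bound * B" unfolding s by (rule w)
  show "AE x in lebesgue. H2per_deriv 2 u x - mean (h2_value u) = g x \<Longrightarrow> u = solve g"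
    unfolding s by (rule uniq)
qed

lemma h2_deriv_minus_mean_combination:
  assumes "AE x in lebesgue. H2per_deriv 2 u x - mean (h2_value u) = f x"
    and "AE x in lebesgue. H2per_deriv 2 v x - mean (h2_value v) = g x"
  shows "AE x in lebesgue. H2per_deriv 2 (u + c *\<^sub>R v) x - mean (h2_value (u + c *\<^sub>R v)) = f x + c *\<^sub>R g x"
proof -
  have M: "mean (h2_value (u + c *\<^sub>R v)) = mean (h2_value u) + c *\<^sub>R mean (h2_value v)"
    unfolding h2_value_add h2_value_scaleR mean_scaleR[symmetric]
    by (intro mean_add h2_value_locally_integrable continuous_imp_locally_integrable continuous_intros h2_value_continuous)
  show ?thesis
    using assms H2per_deriv_add[of 2 u "c *\<^sub>R v", OF order.refl] H2per_deriv_scaleR[of 2 c v, OF order.refl]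
  proof eventually_elim
    case (elim x)
    show ?case
      unfolding M elim(3,4) elim(1,2)[symmetric] scaleR_diff_right by simp
  qed
qed

section \<open>The trace of \<open>H\<^sup>2\<^sub>p\<^sub>e\<^sub>r\<close> in the continuous functions is compact\<close>

instance bcontfun :: (metric_space, banach) banach ..

definition bcf_mult :: "(real \<Rightarrow>\<^sub>C complex) \<Rightarrow> (real \<Rightarrow>\<^sub>C complex) \<Rightarrow> (real \<Rightarrow>\<^sub>C complex)" where
  "bcf_mult f g = Bcontfun (\<lambda>x. f x * g x)"

definition bcf_cnj :: "(real \<Rightarrow>\<^sub>C complex) \<Rightarrow> (real \<Rightarrow>\<^sub>C complex)" where
  "bcf_cnj f = Bcontfun (\<lambda>x. cnj (f x))"

lemma apply_Bcontfun:
  fixes h :: "real \<Rightarrow> complex"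
  shows "continuous_on UNIV h \<Longrightarrow> (\<And>x. cmod (h x) \<le> C) \<Longrightarrow> apply_bcontfun (Bcontfun h) x = h x"
  by (subst Bcontfun_inverse) (auto intro: bcontfun_normI)

lemma bcf_mult_apply [simp]: "bcf_mult f g x = f x * g x"
  unfolding bcf_mult_def
  by (rule apply_Bcontfun[of _ "norm f * norm g"])
    (auto intro!: continuous_intros mult_mono norm_bounded simp: norm_mult)

lemma bcf_cnj_apply [simp]: "bcf_cnj f x = cnj (f x)"
  unfolding bcf_cnj_def
  by (rule apply_Bcontfun[of _ "norm f"]) (auto intro!: continuous_intros norm_bounded)

lemma norm_bcf_mult: "norm (bcf_mult f g) \<le> norm f * norm g"
  by (rule norm_bound) (auto intro!: mult_mono norm_bounded simp: norm_mult)

lemma bounded_bilinear_bcf_mult: "bounded_bilinear bcf_mult"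
  by (rule bounded_bilinear.intro)
    (auto intro!: bcontfun_eqI exI[of _ 1] norm_bcf_mult simp: algebra_simps)

lemma bounded_linear_bcf_cnj: "bounded_linear bcf_cnj"
  by (rule bounded_linear_intro[of _ 1])
    (auto intro!: bcontfun_eqI norm_bound norm_bounded)

text \<open>Extension by the end values turns a continuous function on \<open>[0,2\<pi>]\<close> into an element of the Banach
  space of bounded continuous functions on the line, with the same sup norm.\<close>

definition clamped :: "(real \<Rightarrow> complex) \<Rightarrow> (real \<Rightarrow>\<^sub>C complex)" where
  "clamped h = Bcontfun (\<lambda>s. h (max 0 (min (2 * pi) s)))"

lemma clamp_in: "max 0 (min (2 * pi) s) \<in> {0..2 * pi}" by simp

lemma clamped_apply:
  assumes "continuous_on {0..2 * pi} h"
  shows "clamped h s = h (max 0 (min (2 * pi) s))"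
proof -
  have "bounded (h ` {0..2 * pi})" by (intro compact_imp_bounded compact_continuous_image assms) simp
  then obtain C where "\<forall>y\<in>h ` {0..2 * pi}. cmod y \<le> C" unfolding bounded_iff by blast
  then have "cmod (h (max 0 (min (2 * pi) s))) \<le> C" for s using clamp_in by blast
  then show ?thesis unfolding clamped_def
    by (intro apply_Bcontfun[of _ C] continuous_on_compose2[OF assms] continuous_intros) auto
qed

lemma norm_clamped_le:
  assumes "continuous_on {0..2 * pi} h" "\<And>s. s \<in> {0..2 * pi} \<Longrightarrow> cmod (h s) \<le> C"
  shows "norm (clamped h) \<le> C"
  by (rule norm_bound) (use assms(2)[OF clamp_in] in \<open>simp add: clamped_apply[OF assms(1)]\<close>)

definition h2_trace :: "h2per \<Rightarrow> (real \<Rightarrow>\<^sub>C complex) \<times> (real \<Rightarrow>\<^sub>C complex)" where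
  "h2_trace u = (clamped (h2_value u), clamped (h2_slope u))"

text \<open>The Sobolev bound is not homogeneous, but for a linear map it is enough to bound the image of the unit sphere.\<close>

lemma bounded_linear_h2_trace: "bounded_linear h2_trace"
proof (rule bounded_linear_intro)
  show "h2_trace (u + v) = h2_trace u + h2_trace v" for u v
    by (auto simp: h2_trace_def clamped_apply h2_value_add h2_slope_add continuous_on_add
        h2_value_continuous h2_slope_continuous intro!: bcontfun_eqI)
  show scale: "h2_trace (c *\<^sub>R u) = c *\<^sub>R h2_trace u" for c u
    by (auto simp: h2_trace_def clamped_apply h2_value_scaleR h2_slope_scaleR continuous_on_scaleR
        h2_value_continuous h2_slope_continuous intro!: bcontfun_eqI)
  have unit: "norm (h2_trace u) \<le> 2 * (2 + 2 * pi)" if "norm u = 1" for u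
  proof -
    have "norm (clamped (h2_value u)) \<le> 2 + 2 * pi" "norm (clamped (h2_slope u)) \<le> 2 + 2 * pi"
      using sobolev_bound[of _ u] that
      by (auto intro!: norm_clamped_le h2_value_continuous h2_slope_continuous)
    then show ?thesis using norm_Pair_le[of "clamped (h2_value u)" "clamped (h2_slope u)"] by (simp add: h2_trace_def)
  qed
  show "norm (h2_trace u) \<le> norm u * (2 * (2 + 2 * pi))" for u
  proof (cases "u = 0")
    case True
    then show ?thesis using scale[of 0 u] by simp
  next
    case False
    then have "u = norm u *\<^sub>R (u /\<^sub>R norm u)" by simp
    then have "h2_trace u = norm u *\<^sub>R h2_trace (u /\<^sub>R norm u)" by (metis scale)
    then have "norm (h2_trace u) = norm u * norm (h2_trace (u /\<^sub>R norm u))" by simp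
    also have "\<dots> \<le> norm u * (2 * (2 + 2 * pi))" using False by (intro mult_left_mono unit) auto
    finally show ?thesis .
  qed
qed

lemma arzela_ascoli_clamped:
  fixes h :: "nat \<Rightarrow> real \<Rightarrow> complex"
  assumes cont: "\<And>n. continuous_on {0..2 * pi} (h n)"
    and bound: "\<And>n x. x \<in> {0..2 * pi} \<Longrightarrow> cmod (h n x) \<le> C"
    and equi: "\<And>\<epsilon>. \<epsilon> > 0 \<Longrightarrow> \<exists>\<delta>>0. \<forall>n. \<forall>x\<in>{0..2 * pi}. \<forall>y\<in>{0..2 * pi}. \<bar>x - y\<bar> < \<delta> \<longrightarrow> cmod (h n x - h n y) < \<epsilon>"
  obtains l and r :: "nat \<Rightarrow> nat" where "strict_mono r" "(\<lambda>n. clamped (h (r n))) \<longlonglongrightarrow> l"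
proof -
  obtain g and r :: "nat \<Rightarrow> nat" where g: "continuous_on {0..2 * pi} g" "strict_mono r"
    "\<And>e. 0 < e \<Longrightarrow> \<exists>N. \<forall>n x. n \<ge> N \<and> x \<in> {0..2 * pi} \<longrightarrow> norm (h (r n) x - g x) < e"
  proof (rule Arzela_Ascoli[of "{0..2 * pi}" h C])
    show "\<exists>d>0. \<forall>n y. y \<in> {0..2 * pi} \<and> norm (x - y) < d \<longrightarrow> norm (h n x - h n y) < e"
      if "x \<in> {0..2 * pi}" "0 < e" for x e
      using equi[OF that(2)] that(1) unfolding real_norm_def by blast
  qed (use bound that in auto)
  have "(\<lambda>n. clamped (h (r n))) \<longlonglongrightarrow> clamped g"
    unfolding LIMSEQ_iff
  proof (intro allI impI)
    fix e :: real assume e: "e > 0"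
    then obtain N where N: "\<And>n x. n \<ge> N \<Longrightarrow> x \<in> {0..2 * pi} \<Longrightarrow> norm (h (r n) x - g x) < e / 2"
      using g(3)[of "e / 2"] by auto
    show "\<exists>N. \<forall>n\<ge>N. norm (clamped (h (r n)) - clamped g) < e"
    proof (intro exI[of _ N] allI impI)
      fix n assume "n \<ge> N"
      then have "norm (clamped (h (r n)) - clamped g) \<le> e / 2"
        by (intro norm_bound) (use N[OF _ clamp_in] in \<open>auto simp: clamped_apply cont g(1) less_imp_le\<close>)
      then show "norm (clamped (h (r n)) - clamped g) < e" using e by simp
    qed
  qed
  then show ?thesis using that g(2) by blast
qed

lemma equicontinuous_of_energy:
  fixes f k :: "nat \<Rightarrow> real \<Rightarrow> complex"
  assumes fk: "\<And>n s t. s \<le> t \<Longrightarrow> f n t = f n s + integral {s..t} (k n)"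
    and k: "\<And>n. locally_square_integrable (k n)" and E: "\<And>n. energy (k n) \<le> R" and \<epsilon>: "\<epsilon> > 0"
  shows "\<exists>\<delta>>0. \<forall>n. \<forall>x\<in>{0..2 * pi}. \<forall>y\<in>{0..2 * pi}. \<bar>x - y\<bar> < \<delta> \<longrightarrow> cmod (f n x - f n y) < \<epsilon>"
proof -
  have R: "R \<ge> 0" using E[of 0] energy_nonneg[of "k 0"] by linarith
  define \<eta> where "\<eta> = \<epsilon> / (2 * (R + 1))"
  have \<eta>: "\<eta> > 0" "\<eta> * R \<le> \<epsilon> / 2" using \<epsilon> R by (simp_all add: \<eta>_def field_simps)
  have one: "cmod (f n y - f n x) < \<epsilon>" if "x \<in> {0..2 * pi}" "y \<in> {0..2 * pi}" "x \<le> y" "y - x < \<eta> * \<epsilon> / 2" for n x y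
  proof -
    have "cmod (f n y - f n x) \<le> \<eta> * energy (k n) + (y - x) / \<eta>"
      using norm_integral_le_energy[OF k, of x y \<eta> n] that \<eta> fk[OF that(3), of n] by simp
    moreover have "\<eta> * energy (k n) \<le> \<eta> * R" using E \<eta> by (intro mult_left_mono) auto
    moreover have "(y - x) / \<eta> < \<epsilon> / 2" using that(4) \<eta>(1) by (simp add: field_simps)
    ultimately show ?thesis using \<eta>(2) by linarith
  qed
  show ?thesis
  proof (intro exI[of _ "\<eta> * \<epsilon> / 2"] conjI allI ballI impI)
    show "\<eta> * \<epsilon> / 2 > 0" using \<eta> \<epsilon> by simp
    fix n x y assume "x \<in> {0..2 * pi}" "y \<in> {0..2 * pi}" "\<bar>x - y\<bar> < \<eta> * \<epsilon> / 2"
    then show "cmod (f n x - f n y) < \<epsilon>"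
      using one[of x y n] one[of y x n] by (cases "x \<le> y") (auto simp: norm_minus_commute)
  qed
qed

lemma compact_map_h2_trace: "compact_map h2_trace"
  unfolding compact_map_def
proof (intro allI impI)
  fix u :: "nat \<Rightarrow> h2per" assume "bounded (range u)"
  then obtain R where R: "\<And>n. norm (u n) \<le> R" by (auto simp: bounded_iff)
  have R2: "(norm (u n))\<^sup>2 \<le> R\<^sup>2" for n using R by (intro power_mono) auto
  have E: "energy (h2_slope (u n)) \<le> R\<^sup>2" "energy (H2per_deriv 2 (u n)) \<le> R\<^sup>2" for n
    using R2[of n] energy_nonneg[of "h2_value (u n)"] energy_nonneg[of "h2_slope (u n)"] energy_nonneg[of "H2per_deriv 2 (u n)"]
    unfolding norm_h2per_energy by linarith+
  have B: "cmod (h2_value (u n) s) \<le> 1 + 2 * pi + R\<^sup>2" "cmod (h2_slope (u n) s) \<le> 1 + 2 * pi + R\<^sup>2"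
    if "s \<in> {0..2 * pi}" for n s
    using sobolev_bound[OF that, of "u n"] R2[of n] by linarith+
  obtain l and r :: "nat \<Rightarrow> nat" where r: "strict_mono r" "(\<lambda>n. clamped (h2_value (u (r n)))) \<longlonglongrightarrow> l"
  proof (rule arzela_ascoli_clamped[of "\<lambda>n. h2_value (u n)" "1 + 2 * pi + R\<^sup>2"])
    show "\<exists>\<delta>>0. \<forall>n. \<forall>x\<in>{0..2 * pi}. \<forall>y\<in>{0..2 * pi}. \<bar>x - y\<bar> < \<delta> \<longrightarrow>
        cmod (h2_value (u n) x - h2_value (u n) y) < \<epsilon>" if "\<epsilon> > 0" for \<epsilon>
      by (rule equicontinuous_of_energy[OF h2_value_combine
            continuous_imp_locally_square_integrable[OF h2_slope_continuous] E(1) that])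
  qed (use B h2_value_continuous that in auto)
  obtain m and q :: "nat \<Rightarrow> nat" where q: "strict_mono q" "(\<lambda>n. clamped (h2_slope (u (r (q n))))) \<longlonglongrightarrow> m"
  proof (rule arzela_ascoli_clamped[of "\<lambda>n. h2_slope (u (r n))" "1 + 2 * pi + R\<^sup>2"])
    show "\<exists>\<delta>>0. \<forall>n. \<forall>x\<in>{0..2 * pi}. \<forall>y\<in>{0..2 * pi}. \<bar>x - y\<bar> < \<delta> \<longrightarrow>
        cmod (h2_slope (u (r n)) x - h2_slope (u (r n)) y) < \<epsilon>" if "\<epsilon> > 0" for \<epsilon>
      by (rule equicontinuous_of_energy[OF h2_slope_combine
            H2per_deriv_locally_square_integrable(2) E(2) that])
  qed (use B h2_slope_continuous that in auto)
  have "(\<lambda>n. clamped (h2_value (u (r (q n))))) \<longlonglongrightarrow> l"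
    using LIMSEQ_subseq_LIMSEQ[OF r(2) q(1)] by (simp add: o_def)
  from tendsto_Pair[OF this q(2)] have "(\<lambda>n. h2_trace (u ((r \<circ> q) n))) \<longlonglongrightarrow> (l, m)"
    by (simp add: h2_trace_def)
  then show "\<exists>l r. strict_mono r \<and> (\<lambda>n. h2_trace (u (r n))) \<longlonglongrightarrow> l"
    using strict_mono_o[OF r(1) q(1)] by blast
qed

text \<open>The elements of the trace space carry no periodicity; it is restored by repeating the restriction to one period.\<close>

definition solve_bcf :: "(real \<Rightarrow>\<^sub>C complex) \<Rightarrow> h2per" where
  "solve_bcf f = solve (periodic_extension (apply_bcontfun f))"

lemma bcf_periodic_extension:
  "locally_square_integrable (periodic_extension (apply_bcontfun f))"
  by (intro periodic_extension_locally_square_integrable locally_imp_square_integrable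
      continuous_imp_locally_square_integrable) simp

lemma solve_bcf:
  "AE x in lebesgue. H2per_deriv 2 (solve_bcf f) x - mean (h2_value (solve_bcf f)) = periodic_extension f x"
  unfolding solve_bcf_def by (rule solve(1)[OF bcf_periodic_extension periodic_extension_periodic])

lemma bounded_linear_solve_bcf: "bounded_linear solve_bcf"
proof (rule bounded_linear_intro)
  have comb: "solve_bcf f + c *\<^sub>R solve_bcf g = solve_bcf (f + c *\<^sub>R g)" for f g c
    unfolding solve_bcf_def[of "f + c *\<^sub>R g"]
    by (rule solve(3)[OF bcf_periodic_extension periodic_extension_periodic])
      (use h2_deriv_minus_mean_combination[OF solve_bcf solve_bcf, of f c g] in \<open>simp add: periodic_extension_def\<close>)
  show "solve_bcf (f + g) = solve_bcf f + solve_bcf g" for f g using comb[of f 1 g] by simp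
  show "solve_bcf (c *\<^sub>R f) = c *\<^sub>R solve_bcf f" for c f
    using comb[of f "c - 1" f] by (simp add: scaleR_diff_left)
  show "norm (solve_bcf f) \<le> norm f * solution_bound" for f
    unfolding solve_bcf_def mult.commute[of _ solution_bound]
    by (rule solve(2)[OF bcf_periodic_extension periodic_extension_periodic])
      (simp add: periodic_extension_def norm_bounded)
qed

lemma const_bcontfun_apply [simp]: "apply_bcontfun (const_bcontfun z :: real \<Rightarrow>\<^sub>C complex) s = z"
  by (simp add: const_bcontfun.rep_eq)

lemma bounded_linear_mean: "bounded_linear (\<lambda>f. const_bcontfun (mean (apply_bcontfun f)) :: real \<Rightarrow>\<^sub>C complex)"
proof (rule bounded_linear_intro[of _ 1])
  have li: "locally_integrable (apply_bcontfun f)" for f :: "real \<Rightarrow>\<^sub>C complex"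
    by (rule continuous_imp_locally_integrable) simp
  show "const_bcontfun (mean (f + g)) = const_bcontfun (mean f) + (const_bcontfun (mean g) :: real \<Rightarrow>\<^sub>C complex)"
    for f g :: "real \<Rightarrow>\<^sub>C complex"
    using mean_add[OF li li, of f g] by (intro bcontfun_eqI) (simp add: plus_bcontfun.rep_eq)
  show "const_bcontfun (mean (r *\<^sub>R f)) = r *\<^sub>R (const_bcontfun (mean f) :: real \<Rightarrow>\<^sub>C complex)"
    for r and f :: "real \<Rightarrow>\<^sub>C complex"
    using mean_scaleR[of r f] by (intro bcontfun_eqI) (simp add: scaleR_bcontfun.rep_eq)
  show "norm (const_bcontfun (mean f) :: real \<Rightarrow>\<^sub>C complex) \<le> norm f * 1" for f :: "real \<Rightarrow>\<^sub>C complex"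
    by (rule norm_bound) (simp add: norm_mean_le[OF li norm_bounded])
qed

section \<open>A priori bounds\<close>

lemma locally_square_integrable_mult_continuous:
  fixes f g :: "real \<Rightarrow> complex"
  assumes f: "locally_square_integrable f" and g: "continuous_on UNIV g"
  shows "(\<lambda>x. f x * g x) integrable_on {a..b}"
proof -
  have gc: "continuous_on {a..b} g" by (rule continuous_on_subset[OF g]) simp
  have "(\<lambda>x. g x * f x) absolutely_integrable_on {a..b}"
    by (rule absolutely_integrable_bounded_measurable_product)
      (auto intro!: bilinear_times continuous_imp_measurable_on_sets_lebesgue[OF gc] compact_imp_bounded
        compact_continuous_image gc locally_square_integrable_imp_absolutely_integrable[OF f])
  then show ?thesis by (simp add: absolutely_integrable_on_def mult.commute)
qed

lemma norm_integral_product_le: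
  fixes f g :: "real \<Rightarrow> complex"
  assumes f: "locally_square_integrable f" and g: "continuous_on UNIV g" and \<mu>: "\<mu> > 0"
    and st: "0 \<le> s" "s \<le> t" "t \<le> 2 * pi"
  shows "cmod (integral {s..t} (\<lambda>x. f x * cnj (g x))) \<le> (\<mu> * energy f + energy g / \<mu>) / 2"
proof -
  have gl: "locally_square_integrable g" by (rule continuous_imp_locally_square_integrable[OF g])
  let ?h = "\<lambda>x. (\<mu> * (cmod (f x))\<^sup>2 + (cmod (g x))\<^sup>2 / \<mu>) / 2"
  have hi: "?h integrable_on {u..v}" for u v
    by (intro integrable_on_divide integrable_add integrable_on_mult_right energy_integrable f gl)
  have "cmod (integral {s..t} (\<lambda>x. f x * cnj (g x))) \<le> integral {s..t} ?h"
  proof (rule integral_norm_bound_integral)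
    show "(\<lambda>x. f x * cnj (g x)) integrable_on {s..t}"
      by (intro locally_square_integrable_mult_continuous f continuous_intros g)
    fix x
    have "0 \<le> (\<mu> * cmod (f x) - cmod (g x))\<^sup>2 / \<mu>" using \<mu> by simp
    also have "\<dots> = \<mu> * (cmod (f x))\<^sup>2 + (cmod (g x))\<^sup>2 / \<mu> - 2 * (cmod (f x) * cmod (g x))"
      using \<mu> by (simp add: field_simps power2_eq_square)
    finally show "cmod (f x * cnj (g x)) \<le> ?h x" by (simp add: norm_mult)
  qed (rule hi)
  also have "\<dots> \<le> integral {0..2 * pi} ?h"
    by (rule integral_subset_le) (use st hi \<mu> in auto)
  also have "\<dots> = (\<mu> * energy f + energy g / \<mu>) / 2"
    unfolding energy_def using \<mu>
    by (simp add: integral_add integrable_on_mult_right integrable_on_divide energy_integrable f gl integral_divide)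
  finally show ?thesis .
qed

text \<open>The equation for a triple \<open>(a, b, D)\<close> consisting of a function, its derivative and its weak second derivative, with
  all inhomogeneous terms collected in \<open>F\<close>.\<close>

definition lle_profile ::
    "real \<Rightarrow> real \<Rightarrow> real \<Rightarrow> (real \<Rightarrow> complex) \<Rightarrow> (real \<Rightarrow> complex) \<Rightarrow> (real \<Rightarrow> complex) \<Rightarrow> (real \<Rightarrow> complex) \<Rightarrow> bool" where
  "lle_profile d \<zeta> \<omega> F a b D \<longleftrightarrow>
     (\<forall>x. (a has_vector_derivative b x) (at x)) \<and> continuous_on UNIV b \<and>
     (\<forall>s t. s \<le> t \<longrightarrow> b t = b s + integral {s..t} D) \<and> a (2 * pi) = a 0 \<and> b (2 * pi) = b 0 \<and>
     locally_square_integrable D \<and> locally_square_integrable F \<and>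
     (AE s in lebesgue. of_real d * D s = \<i> * of_real \<omega> * b s + (of_real \<zeta> - \<i>) * a s
        - of_real ((cmod (a s))\<^sup>2) * a s + F s)"

text \<open>Multiply the equation by \<open>cnj a\<close> and integrate over a period. By periodicity the integral \<open>Bc\<close> of
  \<open>b cnj a\<close> is purely imaginary, so in the imaginary part only the damping term \<open>-\<i> a\<close> and the forcing survive;
  this gives \<open>A \<le> e\<close> for the energy \<open>A\<close> of \<open>a\<close>. The real part expresses \<open>d B\<close>, with \<open>B\<close> the energy of \<open>b\<close>, by the drift term, the
  quartic integral \<open>Q\<close> and terms already under control. The drift term is at most \<open>\<bar>\<omega>\<bar> (\<mu> B + A / \<mu>) / 2\<close>. The quartic
  integral is at most \<open>S A\<close>, where \<open>S = A + (\<eta> B + A / \<eta>)\<close> bounds \<open>(cmod a)\<^sup>2\<close>: its minimum is at most \<open>A\<close>, and it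
  varies by at most the integral of \<open>2 cmod a cmod b\<close>. The constants \<open>\<mu>\<close> and \<open>\<eta>\<close> are small enough that each of these
  two terms contributes at most \<open>\<bar>d\<bar> B / 4\<close>, so \<open>B\<close> can be solved for. The equation then bounds the
  energy of \<open>D\<close>.\<close>

lemma a_priori_bound:
  fixes d \<zeta> \<omega> e :: real
  assumes d: "d \<noteq> 0" and e: "e \<ge> 0"
  shows "\<exists>K. \<forall>F a b D. lle_profile d \<zeta> \<omega> F a b D \<longrightarrow> energy F \<le> e \<longrightarrow> energy a + energy b + energy D \<le> K"
proof -
  define \<mu> where "\<mu> = \<bar>d\<bar> / (2 * (\<bar>\<omega>\<bar> + 1))"
  define \<eta> where "\<eta> = \<bar>d\<bar> / (4 * (e + 1))"
  have \<mu>: "\<mu> > 0" "\<bar>\<omega>\<bar> * \<mu> \<le> \<bar>d\<bar> / 2"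
  proof -
    show "\<mu> > 0" using d by (simp add: \<mu>_def)
    have "\<bar>\<omega>\<bar> * \<mu> \<le> (\<bar>\<omega>\<bar> + 1) * \<mu>" using \<open>\<mu> > 0\<close> by (intro mult_right_mono) auto
    also have "\<dots> = \<bar>d\<bar> / 2" by (simp add: \<mu>_def field_simps)
    finally show "\<bar>\<omega>\<bar> * \<mu> \<le> \<bar>d\<bar> / 2" .
  qed
  have \<eta>: "\<eta> > 0" "\<eta> * e \<le> \<bar>d\<bar> / 4"
  proof -
    show "\<eta> > 0" using d e by (simp add: \<eta>_def)
    have "\<eta> * e \<le> \<eta> * (e + 1)" using \<open>\<eta> > 0\<close> by (intro mult_left_mono) auto
    also have "\<dots> = \<bar>d\<bar> / 4" using e by (simp add: \<eta>_def field_simps)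
    finally show "\<eta> * e \<le> \<bar>d\<bar> / 4" .
  qed
  define Kb where "Kb = 2 / \<bar>d\<bar> * (\<bar>\<omega>\<bar> * (e / \<mu> / 2) + \<bar>\<zeta>\<bar> * e + (e + e / \<eta>) * e + e)"
  define KS where "KS = e + \<eta> * Kb + e / \<eta>"
  define KD where "KD = 4 * (\<omega>\<^sup>2 * Kb + (\<zeta>\<^sup>2 + 1) * e + KS\<^sup>2 * e + e) / d\<^sup>2"
  show ?thesis
  proof (intro exI[of _ "e + Kb + KD"] allI impI)
    fix F a b D
    assume prof: "lle_profile d \<zeta> \<omega> F a b D" and Fe: "energy F \<le> e"
    then have deriv: "\<forall>x. (a has_vector_derivative b x) (at x)" and bc: "continuous_on UNIV b"
      and bD: "\<forall>s t. s \<le> t \<longrightarrow> b t = b s + integral {s..t} D"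
      and per: "a (2 * pi) = a 0" "b (2 * pi) = b 0"
      and D: "locally_square_integrable D" and F: "locally_square_integrable F"
      and eq: "AE s in lebesgue. of_real d * D s = \<i> * of_real \<omega> * b s + (of_real \<zeta> - \<i>) * a s
        - of_real ((cmod (a s))\<^sup>2) * a s + F s"
      unfolding lle_profile_def by - (elim conjE, assumption)+
    have ac: "continuous_on UNIV a"
    proof (rule has_vector_derivative_imp_continuous_on)
      show "(a has_vector_derivative b x) (at x within UNIV)" for x using deriv by simp
    qed
    have dv: "(a has_vector_derivative b x) (at x within S)" for x S
      by (rule has_vector_derivative_at_within[OF deriv[rule_format]])
    have al: "locally_square_integrable a" and bl: "locally_square_integrable b"
      using ac bc by (auto intro: continuous_imp_locally_square_integrable)
    have con: "continuous_on {s..t} a" "continuous_on {s..t} b" for s t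
      using ac bc by (auto intro: continuous_on_subset)
    let ?I = "{0..2 * pi}"
    define A where "A = energy a"
    define B where "B = energy b"
    have A0: "A \<ge> 0" and B0: "B \<ge> 0" by (simp_all add: A_def B_def energy_nonneg)
    define Bc where "Bc = integral ?I (\<lambda>s. b s * cnj (a s))"
    define Fc where "Fc = integral ?I (\<lambda>s. F s * cnj (a s))"
    define Q where "Q = integral ?I (\<lambda>s. ((cmod (a s))\<^sup>2)\<^sup>2)"
    have energy_c: "integral ?I (\<lambda>s. f s * cnj (f s)) = of_real (energy f)"
      if "locally_square_integrable f" for f
    proof -
      have "(\<lambda>s. f s * cnj (f s)) = (\<lambda>s. of_real ((cmod (f s))\<^sup>2))" by (simp add: complex_norm_square[symmetric])
      then show ?thesis unfolding energy_def
        using integral_linear[OF energy_integrable[OF that] bounded_linear_of_real] by (simp add: o_def)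
    qed
    have "integral ?I (\<lambda>s. D s * cnj (a s)) + integral ?I (\<lambda>s. b s * cnj (b s))
        = b (2 * pi) * cnj (a (2 * pi)) - b 0 * cnj (a 0)"
    proof (rule integration_by_parts_primitive)
      show "D integrable_on ?I" "(\<lambda>x. cmod (D x)) integrable_on ?I"
        using locally_square_integrable_imp_locally_integrable[OF D] by (auto dest: locally_integrableD)
      show "(\<lambda>x. D x * cnj (a x)) integrable_on ?I"
        by (intro locally_square_integrable_mult_continuous D continuous_intros ac)
      show "((\<lambda>s. cnj (a s)) has_vector_derivative cnj (b s)) (at s within ?I)" for s
        by (rule has_vector_derivative_cnj[OF dv])
      show "continuous_on ?I (\<lambda>s. cnj (b s))" by (intro continuous_intros con)
    qed (use bD in auto)
    then have Da: "integral ?I (\<lambda>s. D s * cnj (a s)) = - of_real B"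
      unfolding energy_c[OF bl] per B_def by (simp add: eq_neg_iff_add_eq_0)
    have dder: "((\<lambda>s. a s * cnj (a s)) has_vector_derivative (a x * cnj (b x) + b x * cnj (a x))) (at x within S)" for x S
      by (rule has_vector_derivative_mult[OF dv has_vector_derivative_cnj[OF dv]])
    have sq: "a t * cnj (a t) - a s * cnj (a s)
        = integral {s..t} (\<lambda>x. a x * cnj (b x)) + integral {s..t} (\<lambda>x. b x * cnj (a x))" if "s \<le> t" for s t
    proof -
      have "integral {s..t} (\<lambda>x. a x * cnj (b x) + b x * cnj (a x)) = a t * cnj (a t) - a s * cnj (a s)"
        using fundamental_theorem_of_calculus[OF that dder] by (rule integral_unique)
      then show ?thesis
        by (subst (asm) integral_add) (auto intro!: integrable_continuous_real continuous_intros con)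
    qed
    have "integral ?I (\<lambda>x. a x * cnj (b x)) = cnj Bc"
    proof -
      have "(\<lambda>s. b s * cnj (a s)) integrable_on ?I" by (intro integrable_continuous_real continuous_intros con)
      from integral_linear[OF this bounded_linear_cnj] show ?thesis by (simp add: Bc_def o_def mult.commute)
    qed
    then have "cnj Bc + Bc = 0" using sq[of 0 "2 * pi"] per(1) by (simp add: Bc_def[symmetric])
    then have "Re (cnj Bc + Bc) = 0" by (simp only: zero_complex.sel)
    then have ReB: "Re Bc = 0" by simp
    have main: "- of_real (d * B) = \<i> * of_real \<omega> * Bc + (of_real \<zeta> - \<i>) * of_real A - of_real Q + Fc"
    proof -
      let ?J = "\<lambda>s. \<i> * of_real \<omega> * (b s * cnj (a s)) + (of_real \<zeta> - \<i>) * (a s * cnj (a s))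
          - of_real (((cmod (a s))\<^sup>2)\<^sup>2) + F s * cnj (a s)"
      have "negligible {s. of_real d * D s \<noteq> \<i> * of_real \<omega> * b s + (of_real \<zeta> - \<i>) * a s
        - of_real ((cmod (a s))\<^sup>2) * a s + F s}"
        using eq by (simp add: AE_lebesgue_iff_negligible)
      then have "integral ?I (\<lambda>s. of_real d * (D s * cnj (a s))) = integral ?I ?J"
      proof (rule integral_spike)
        fix s assume "s \<in> ?I - {s. of_real d * D s \<noteq> \<i> * of_real \<omega> * b s + (of_real \<zeta> - \<i>) * a s
          - of_real ((cmod (a s))\<^sup>2) * a s + F s}"
        then have e: "of_real d * D s = \<i> * of_real \<omega> * b s + (of_real \<zeta> - \<i>) * a s
          - of_real ((cmod (a s))\<^sup>2) * a s + F s" by blast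
        have n: "complex_of_real (((cmod (a s))\<^sup>2)\<^sup>2) = of_real ((cmod (a s))\<^sup>2) * (a s * cnj (a s))"
          by (simp only: power2_eq_square[of "(cmod (a s))\<^sup>2"] of_real_mult complex_norm_square[of "a s"])
        show "?J s = of_real d * (D s * cnj (a s))"
          unfolding n mult.assoc[symmetric, of "of_real d"] e by (simp add: algebra_simps)
      qed
      also have "\<dots> = \<i> * of_real \<omega> * Bc + (of_real \<zeta> - \<i>) * of_real A - of_real Q + Fc"
      proof -
        have i: "(\<lambda>s. b s * cnj (a s)) integrable_on ?I" "(\<lambda>s. a s * cnj (a s)) integrable_on ?I"
          "(\<lambda>s. complex_of_real (((cmod (a s))\<^sup>2)\<^sup>2)) integrable_on ?I"
          by (auto intro!: integrable_continuous_real continuous_intros con)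
        have i4: "(\<lambda>s. F s * cnj (a s)) integrable_on ?I"
          by (intro locally_square_integrable_mult_continuous F continuous_intros ac)
        have "(\<lambda>s. ((cmod (a s))\<^sup>2)\<^sup>2) integrable_on ?I"
          by (intro integrable_continuous_real continuous_intros con)
        note ql = integral_linear[OF this bounded_linear_of_real[where 'a = complex]]
        have q: "integral ?I (\<lambda>s. complex_of_real (((cmod (a s))\<^sup>2)\<^sup>2)) = of_real Q"
          using ql unfolding Q_def by (simp only: o_def)
        have h: "((\<lambda>s. b s * cnj (a s)) has_integral Bc) ?I" "((\<lambda>s. a s * cnj (a s)) has_integral of_real A) ?I"
          "((\<lambda>s. complex_of_real (((cmod (a s))\<^sup>2)\<^sup>2)) has_integral of_real Q) ?I"
          "((\<lambda>s. F s * cnj (a s)) has_integral Fc) ?I"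
          using integrable_integral[OF i(1)] integrable_integral[OF i(2)] integrable_integral[OF i(3)] integrable_integral[OF i4]
          unfolding q energy_c[OF al] Bc_def[symmetric] Fc_def[symmetric] A_def[symmetric] .
        show ?thesis
          by (rule integral_unique[OF has_integral_add[OF has_integral_diff[OF has_integral_add[OF
                  has_integral_mult_right[OF h(1)] has_integral_mult_right[OF h(2)]] h(3)] h(4)]])
      qed
      finally show ?thesis by (simp add: Da)
    qed
    have im: "A = Im Fc"
      using arg_cong[OF main, of Im] ReB by simp
    have re: "- (d * B) = - (\<omega> * Im Bc) + \<zeta> * A - Q + Re Fc"
      using arg_cong[OF main, of Re] by simp
    have "cmod Fc \<le> (1 * energy F + energy a / 1) / 2"
      unfolding Fc_def by (rule norm_integral_product_le[OF F ac]) auto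
    then have Fcle: "cmod Fc \<le> (e + A) / 2" using Fe by (simp add: A_def)
    have "A \<le> cmod Fc" using im abs_Im_le_cmod[of Fc] by linarith
    then have "A \<le> (e + A) / 2" using Fcle by (rule order_trans)
    then have Ae: "A \<le> e" by simp
    have Fce: "cmod Fc \<le> e" using Fcle Ae by simp
    have "cmod Bc \<le> (\<mu> * energy b + energy a / \<mu>) / 2"
      unfolding Bc_def by (rule norm_integral_product_le[OF bl ac \<mu>(1)]) auto
    then have "\<bar>\<omega>\<bar> * cmod Bc \<le> \<bar>\<omega>\<bar> * ((\<mu> * B + A / \<mu>) / 2)" by (intro mult_left_mono) (simp_all add: A_def B_def)
    also have "\<dots> = (\<bar>\<omega>\<bar> * \<mu>) * B / 2 + \<bar>\<omega>\<bar> * (A / \<mu> / 2)" by (simp add: algebra_simps)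
    also have "\<dots> \<le> (\<bar>d\<bar> / 2) * B / 2 + \<bar>\<omega>\<bar> * (e / \<mu> / 2)"
      using \<mu> B0 Ae by (intro add_mono divide_right_mono mult_right_mono mult_left_mono) auto
    finally have Bcle: "\<bar>\<omega>\<bar> * cmod Bc \<le> \<bar>d\<bar> * B / 4 + \<bar>\<omega>\<bar> * (e / \<mu> / 2)" by simp
    define S where "S = A + (\<eta> * B + A / \<eta>)"
    have ctc: "continuous_on ?I (\<lambda>x. (cmod (a x))\<^sup>2)" by (intro continuous_intros con)
    obtain t where t: "t \<in> ?I" "\<And>x. x \<in> ?I \<Longrightarrow> (cmod (a t))\<^sup>2 \<le> (cmod (a x))\<^sup>2"
      using continuous_attains_inf[OF compact_Icc _ ctc] by auto
    have "integral ?I (\<lambda>x. (cmod (a t))\<^sup>2) \<le> energy a"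
      unfolding energy_def by (rule integral_le) (use t energy_integrable[OF al] in auto)
    then have "2 * pi * (cmod (a t))\<^sup>2 \<le> A" by (simp add: A_def)
    moreover have "1 * (cmod (a t))\<^sup>2 \<le> 2 * pi * (cmod (a t))\<^sup>2" using pi_gt3 by (intro mult_right_mono) auto
    ultimately have at: "(cmod (a t))\<^sup>2 \<le> A" by simp
    have var: "\<bar>(cmod (a y))\<^sup>2 - (cmod (a x))\<^sup>2\<bar> \<le> \<eta> * B + A / \<eta>" if "x \<in> ?I" "y \<in> ?I" "x \<le> y" for x y
    proof -
      have "cmod (integral {x..y} (\<lambda>x. a x * cnj (b x))) \<le> ((1 / \<eta>) * energy a + energy b / (1 / \<eta>)) / 2"
        by (rule norm_integral_product_le[OF al bc]) (use that \<eta> in auto)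
      moreover have "cmod (integral {x..y} (\<lambda>x. b x * cnj (a x))) \<le> (\<eta> * energy b + energy a / \<eta>) / 2"
        by (rule norm_integral_product_le[OF bl ac]) (use that \<eta> in auto)
      moreover have "cmod (a y * cnj (a y) - a x * cnj (a x))
          \<le> cmod (integral {x..y} (\<lambda>x. a x * cnj (b x))) + cmod (integral {x..y} (\<lambda>x. b x * cnj (a x)))"
        unfolding sq[OF that(3)] by (rule norm_triangle_ineq)
      moreover have "cmod (a y * cnj (a y) - a x * cnj (a x)) = \<bar>(cmod (a y))\<^sup>2 - (cmod (a x))\<^sup>2\<bar>"
        unfolding complex_norm_square[symmetric] of_real_diff[symmetric] by (rule norm_of_real)
      ultimately show ?thesis by (simp add: A_def B_def mult.commute)
    qed
    have aS: "(cmod (a s))\<^sup>2 \<le> S" if "s \<in> ?I" for s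
      using var[of s t] var[of t s] at t(1) that by (cases "s \<le> t") (auto simp: S_def abs_le_iff)
    have S0: "S \<ge> 0" using A0 B0 \<eta> by (simp add: S_def)
    have "Q \<le> integral ?I (\<lambda>s. S * (cmod (a s))\<^sup>2)"
      unfolding Q_def
    proof (rule integral_le)
      show "((cmod (a s))\<^sup>2)\<^sup>2 \<le> S * (cmod (a s))\<^sup>2" if "s \<in> ?I" for s
        using mult_right_mono[OF aS[OF that], of "(cmod (a s))\<^sup>2"] by (simp add: power2_eq_square[of "(cmod (a s))\<^sup>2"])
    qed (auto intro!: integrable_continuous_real continuous_intros con)
    then have QS: "Q \<le> S * A" by (simp add: A_def energy_def)
    have Q0: "Q \<ge> 0" unfolding Q_def by (rule integral_nonneg) (auto intro!: integrable_continuous_real continuous_intros con)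
    have "A / \<eta> \<le> e / \<eta>" using Ae \<eta> by (intro divide_right_mono) auto
    then have Se: "S \<le> e + \<eta> * B + e / \<eta>" using Ae unfolding S_def by linarith
    have "S * A \<le> (e + \<eta> * B + e / \<eta>) * e"
      using Se Ae A0 S0 by (intro mult_mono) auto
    also have "\<dots> = (e + e / \<eta>) * e + (\<eta> * e) * B" by (simp add: algebra_simps)
    also have "\<dots> \<le> (e + e / \<eta>) * e + (\<bar>d\<bar> / 4) * B" using \<eta> B0 by (intro add_left_mono mult_right_mono) auto
    finally have Qle: "Q \<le> (e + e / \<eta>) * e + \<bar>d\<bar> * B / 4" using QS by simp
    have "\<bar>d\<bar> * B = \<bar>- (\<omega> * Im Bc) + \<zeta> * A - Q + Re Fc\<bar>"
      unfolding re[symmetric] using B0 by (simp add: abs_mult)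
    also have "\<dots> \<le> \<bar>\<omega> * Im Bc\<bar> + \<bar>\<zeta> * A\<bar> + \<bar>Q\<bar> + \<bar>Re Fc\<bar>" by linarith
    also have "\<dots> \<le> \<bar>\<omega>\<bar> * cmod Bc + \<bar>\<zeta>\<bar> * e + Q + e"
    proof -
      have "\<bar>\<omega> * Im Bc\<bar> \<le> \<bar>\<omega>\<bar> * cmod Bc" by (simp add: abs_mult mult_left_mono abs_Im_le_cmod)
      moreover have "\<bar>\<zeta> * A\<bar> \<le> \<bar>\<zeta>\<bar> * e" using Ae A0 by (simp add: abs_mult mult_left_mono)
      moreover have "\<bar>Re Fc\<bar> \<le> e" using abs_Re_le_cmod[of Fc] Fce by linarith
      ultimately show ?thesis using Q0 by linarith
    qed
    also have "\<dots> \<le> \<bar>d\<bar> * B / 2 + (\<bar>\<omega>\<bar> * (e / \<mu> / 2) + \<bar>\<zeta>\<bar> * e + (e + e / \<eta>) * e + e)"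
      using Bcle Qle by linarith
    finally have "\<bar>d\<bar> * B \<le> \<bar>d\<bar> * B / 2 + (\<bar>\<omega>\<bar> * (e / \<mu> / 2) + \<bar>\<zeta>\<bar> * e + (e + e / \<eta>) * e + e)" .
    moreover have "\<bar>d\<bar> * B = \<bar>d\<bar> * B / 2 + \<bar>d\<bar> / 2 * B" by simp
    ultimately have "\<bar>d\<bar> / 2 * B \<le> \<bar>\<omega>\<bar> * (e / \<mu> / 2) + \<bar>\<zeta>\<bar> * e + (e + e / \<eta>) * e + e" by linarith
    then have "2 / \<bar>d\<bar> * (\<bar>d\<bar> / 2 * B) \<le> Kb" unfolding Kb_def by (intro mult_left_mono) auto
    then have BK: "B \<le> Kb" using d by simp
    have SK: "S \<le> KS" using Se BK \<eta> by (simp add: KS_def) (meson add_le_cancel_left mult_left_mono order_trans less_imp_le add_right_mono)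
    have "d\<^sup>2 * energy D \<le> 4 * (\<omega>\<^sup>2 * B + (\<zeta>\<^sup>2 + 1) * A + S\<^sup>2 * A + energy F)"
    proof -
      let ?R = "\<lambda>s. (\<i> * of_real \<omega> * b s + (of_real \<zeta> - \<i>) * a s - of_real ((cmod (a s))\<^sup>2) * a s) + F s"
      have Rl: "locally_square_integrable ?R"
        by (intro locally_square_integrable_add F continuous_imp_locally_square_integrable continuous_intros ac bc)
      have "d\<^sup>2 * energy D = energy (\<lambda>s. of_real d * D s)"
        unfolding energy_def by (simp add: norm_mult power_mult_distrib)
      also have "\<dots> = energy ?R" by (rule energy_cong_AE[OF eq])
      also have "\<dots> \<le> integral ?I (\<lambda>s. 4 * (\<omega>\<^sup>2 * (cmod (b s))\<^sup>2 + (\<zeta>\<^sup>2 + 1) * (cmod (a s))\<^sup>2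
          + S\<^sup>2 * (cmod (a s))\<^sup>2 + (cmod (F s))\<^sup>2))"
        unfolding energy_def
      proof (rule integral_le)
        show "(\<lambda>s. (cmod (?R s))\<^sup>2) integrable_on ?I" by (rule energy_integrable[OF Rl])
        show "(\<lambda>s. 4 * (\<omega>\<^sup>2 * (cmod (b s))\<^sup>2 + (\<zeta>\<^sup>2 + 1) * (cmod (a s))\<^sup>2
          + S\<^sup>2 * (cmod (a s))\<^sup>2 + (cmod (F s))\<^sup>2)) integrable_on ?I"
          by (intro integrable_on_mult_right integrable_add energy_integrable al bl F)
        fix s assume s: "s \<in> ?I"
        have four: "(cmod (x + y - z + v))\<^sup>2 \<le> 4 * ((cmod x)\<^sup>2 + (cmod y)\<^sup>2 + (cmod z)\<^sup>2 + (cmod v)\<^sup>2)" for x y z v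
        proof -
          have "cmod (x + y - z + v) \<le> cmod x + cmod y + cmod z + cmod v"
            using norm_triangle_ineq[of "x + y - z" v] norm_triangle_ineq4[of "x + y" z] norm_triangle_ineq[of x y] by linarith
          then have "(cmod (x + y - z + v))\<^sup>2 \<le> (cmod x + cmod y + cmod z + cmod v)\<^sup>2" by (intro power_mono) auto
          also have "\<dots> \<le> 4 * ((cmod x)\<^sup>2 + (cmod y)\<^sup>2 + (cmod z)\<^sup>2 + (cmod v)\<^sup>2)"
          proof -
            have "(p + q + r + w)\<^sup>2 \<le> 4 * (p\<^sup>2 + q\<^sup>2 + r\<^sup>2 + w\<^sup>2)" for p q r w :: real
              using zero_le_power2[of "p - q"] zero_le_power2[of "p - r"] zero_le_power2[of "p - w"]
                zero_le_power2[of "q - r"] zero_le_power2[of "q - w"] zero_le_power2[of "r - w"]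
              unfolding power2_eq_square by (simp add: algebra_simps)
            then show ?thesis .
          qed
          finally show ?thesis .
        qed
        have "(cmod (of_real \<zeta> - \<i>))\<^sup>2 = \<zeta>\<^sup>2 + 1" by (simp add: cmod_power2)
        moreover have "((cmod (a s))\<^sup>2)\<^sup>2 \<le> S\<^sup>2" by (rule power_mono[OF aS[OF s]]) simp
        then have "((cmod (a s))\<^sup>2)\<^sup>2 * (cmod (a s))\<^sup>2 \<le> S\<^sup>2 * (cmod (a s))\<^sup>2" by (rule mult_right_mono) simp
        ultimately show "(cmod (?R s))\<^sup>2 \<le> 4 * (\<omega>\<^sup>2 * (cmod (b s))\<^sup>2 + (\<zeta>\<^sup>2 + 1) * (cmod (a s))\<^sup>2
          + S\<^sup>2 * (cmod (a s))\<^sup>2 + (cmod (F s))\<^sup>2)"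
          using four[of "\<i> * of_real \<omega> * b s" "(of_real \<zeta> - \<i>) * a s" "of_real ((cmod (a s))\<^sup>2) * a s" "F s"]
          by (simp add: norm_mult power_mult_distrib norm_power)
      qed
      also have "\<dots> = 4 * (\<omega>\<^sup>2 * B + (\<zeta>\<^sup>2 + 1) * A + S\<^sup>2 * A + energy F)"
      proof -
        have h: "((\<lambda>s. (cmod (f s))\<^sup>2) has_integral energy f) ?I" if "locally_square_integrable f" for f
          unfolding energy_def by (rule integrable_integral[OF energy_integrable[OF that]])
        show ?thesis
          unfolding A_def B_def
          by (rule integral_unique[OF has_integral_mult_right[OF has_integral_add[OF has_integral_add[OF has_integral_add[OF
                  has_integral_mult_right[OF h[OF bl]] has_integral_mult_right[OF h[OF al]]]
                  has_integral_mult_right[OF h[OF al]]] h[OF F]]]])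
      qed
      finally show ?thesis .
    qed
    also have "\<dots> \<le> 4 * (\<omega>\<^sup>2 * Kb + (\<zeta>\<^sup>2 + 1) * e + KS\<^sup>2 * e + e)"
      using BK Ae Fe SK S0 A0
      by (intro mult_left_mono add_mono mult_mono power_mono) auto
    finally have "energy D \<le> KD" using d by (simp add: KD_def field_simps)
    then show "energy a + energy b + energy D \<le> e + Kb + KD"
      using Ae BK by (simp add: A_def B_def)
  qed
qed

section \<open>The equation as a compact fixed point problem\<close>

type_synonym trace_space = "(real \<Rightarrow>\<^sub>C complex) \<times> (real \<Rightarrow>\<^sub>C complex)"

text \<open>Partially evaluated bilinear maps depend linearly and continuously, in operator norm, on their first argument. This
  carries regularity of curves and continuity from the coefficients of \<open>lle_rhs_deriv\<close> to the operators themselves.\<close>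

lemma bounded_linear_Blinfun_bilinear:
  assumes "bounded_bilinear B"
  shows "bounded_linear (\<lambda>m. Blinfun (B m))"
proof -
  interpret bounded_bilinear B by (rule assms)
  obtain K where K: "K \<ge> 0" "\<And>a b. norm (B a b) \<le> norm a * norm b * K" using nonneg_bounded by blast
  have ap: "blinfun_apply (Blinfun (B m)) h = B m h" for m h
    by (simp add: bounded_linear_Blinfun_apply bounded_linear_right)
  show ?thesis
  proof (rule bounded_linear_intro[where K = K])
    show "Blinfun (B (x + y)) = Blinfun (B x) + Blinfun (B y)" for x y
      by (rule blinfun_eqI) (simp add: ap add_left blinfun.add_left)
    show "Blinfun (B (r *\<^sub>R x)) = r *\<^sub>R Blinfun (B x)" for r x
      by (rule blinfun_eqI) (simp add: ap scaleR_left blinfun.scaleR_left)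
    show "norm (Blinfun (B x)) \<le> norm x * K" for x
      by (rule norm_blinfun_bound) (use K in \<open>simp_all add: ap mult.assoc mult.left_commute mult.commute\<close>)
  qed
qed

text \<open>The equation solved for \<open>u'' - mean u\<close>: its linear part, the full right-hand side
  without the periodic forcing, and the derivative of the latter, all in terms of \<open>x = (u, u')\<close>.\<close>

definition lle_linear :: "real \<Rightarrow> real \<Rightarrow> real \<Rightarrow> trace_space \<Rightarrow> real \<Rightarrow>\<^sub>C complex" where
  "lle_linear d \<zeta> \<omega> x = bcf_mult (const_bcontfun (\<i> * of_real \<omega> / of_real d)) (snd x)
     + bcf_mult (const_bcontfun ((of_real \<zeta> - \<i>) / of_real d)) (fst x) - const_bcontfun (mean (fst x))"

definition lle_rhs :: "real \<Rightarrow> real \<Rightarrow> real \<Rightarrow> real \<Rightarrow> trace_space \<Rightarrow> real \<Rightarrow>\<^sub>C complex" where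
  "lle_rhs d \<zeta> \<omega> f0 x = lle_linear d \<zeta> \<omega> x + const_bcontfun (\<i> * of_real f0 / of_real d)
     - (1 / d) *\<^sub>R bcf_mult (bcf_mult (fst x) (bcf_cnj (fst x))) (fst x)"

definition lle_rhs_deriv :: "real \<Rightarrow> real \<Rightarrow> real \<Rightarrow> trace_space \<Rightarrow> trace_space \<Rightarrow>\<^sub>L (real \<Rightarrow>\<^sub>C complex)" where
  "lle_rhs_deriv d \<zeta> \<omega> x = Blinfun (lle_linear d \<zeta> \<omega>)
     + (- 1 / d) *\<^sub>R (2 *\<^sub>R Blinfun (\<lambda>h. bcf_mult (bcf_mult (fst x) (bcf_cnj (fst x))) (fst h))
        + Blinfun (\<lambda>h. bcf_mult (bcf_mult (fst x) (fst x)) (bcf_cnj (fst h))))"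

lemmas bl_mult_right = bounded_bilinear.bounded_linear_right[OF bounded_bilinear_bcf_mult]

lemma bounded_linear_lle_linear: "bounded_linear (lle_linear d \<zeta> \<omega>)"
  unfolding lle_linear_def
  by (intro bounded_linear_add bounded_linear_sub bounded_linear_compose[OF bl_mult_right]
      bounded_linear_compose[OF bounded_linear_mean] bounded_linear_fst bounded_linear_snd)

lemma bilinear_mult_fst: "bounded_bilinear (\<lambda>m h :: trace_space. bcf_mult m (fst h))"
  by (rule bounded_bilinear.comp[OF bounded_bilinear_bcf_mult bounded_linear_ident bounded_linear_fst])

lemma bilinear_mult_cnj_fst: "bounded_bilinear (\<lambda>m h :: trace_space. bcf_mult m (bcf_cnj (fst h)))"
  by (rule bounded_bilinear.comp[OF bounded_bilinear_bcf_mult bounded_linear_ident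
        bounded_linear_compose[OF bounded_linear_bcf_cnj bounded_linear_fst]])

lemma lle_rhs_deriv_apply:
  "lle_rhs_deriv d \<zeta> \<omega> x h = lle_linear d \<zeta> \<omega> h
     + (- 1 / d) *\<^sub>R (2 *\<^sub>R bcf_mult (bcf_mult (fst x) (bcf_cnj (fst x))) (fst h)
        + bcf_mult (bcf_mult (fst x) (fst x)) (bcf_cnj (fst h)))"
  unfolding lle_rhs_deriv_def blinfun.add_left blinfun.scaleR_left
  by (simp only: bounded_linear_Blinfun_apply bounded_linear_lle_linear
      bounded_bilinear.bounded_linear_right[OF bilinear_mult_fst]
      bounded_bilinear.bounded_linear_right[OF bilinear_mult_cnj_fst])

lemma lle_rhs_has_derivative: "(lle_rhs d \<zeta> \<omega> f0 has_derivative lle_rhs_deriv d \<zeta> \<omega> x) (at x)"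
proof -
  note m = bounded_bilinear.FDERIV[OF bounded_bilinear_bcf_mult]
  have f: "((\<lambda>x :: trace_space. fst x) has_derivative fst) (at x)"
    by (intro bounded_linear_imp_has_derivative bounded_linear_fst)
  have c: "((\<lambda>x :: trace_space. bcf_cnj (fst x)) has_derivative (\<lambda>h. bcf_cnj (fst h))) (at x)"
    by (intro bounded_linear_imp_has_derivative bounded_linear_compose[OF bounded_linear_bcf_cnj] bounded_linear_fst)
  have l: "(lle_linear d \<zeta> \<omega> has_derivative lle_linear d \<zeta> \<omega>) (at x)"
    by (intro bounded_linear_imp_has_derivative bounded_linear_lle_linear)
  have "((\<lambda>x. lle_linear d \<zeta> \<omega> x + const_bcontfun (\<i> * of_real f0 / of_real d)
     - (1 / d) *\<^sub>R bcf_mult (bcf_mult (fst x) (bcf_cnj (fst x))) (fst x)) has_derivative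
     (\<lambda>h :: trace_space. lle_linear d \<zeta> \<omega> h + 0 - (1 / d) *\<^sub>R (bcf_mult (bcf_mult (fst x) (bcf_cnj (fst x))) (fst h)
       + bcf_mult (bcf_mult (fst x) (bcf_cnj (fst h)) + bcf_mult (fst h) (bcf_cnj (fst x))) (fst x)))) (at x)"
    by (intro has_derivative_diff has_derivative_add l has_derivative_const has_derivative_scaleR_right
        m[OF m[OF f c] f])
  moreover have "(\<lambda>h :: trace_space. lle_linear d \<zeta> \<omega> h + 0 - (1 / d) *\<^sub>R (bcf_mult (bcf_mult (fst x) (bcf_cnj (fst x))) (fst h)
       + bcf_mult (bcf_mult (fst x) (bcf_cnj (fst h)) + bcf_mult (fst h) (bcf_cnj (fst x))) (fst x)))
     = lle_rhs_deriv d \<zeta> \<omega> x"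
  proof
    fix h :: trace_space
    have "bcf_mult (bcf_mult (fst x) (bcf_cnj (fst x))) (fst h)
       + bcf_mult (bcf_mult (fst x) (bcf_cnj (fst h)) + bcf_mult (fst h) (bcf_cnj (fst x))) (fst x)
      = 2 *\<^sub>R bcf_mult (bcf_mult (fst x) (bcf_cnj (fst x))) (fst h)
        + bcf_mult (bcf_mult (fst x) (fst x)) (bcf_cnj (fst h))"
      by (rule bcontfun_eqI) (simp add: scaleR_conv_of_real algebra_simps)
    then show "lle_linear d \<zeta> \<omega> h + 0 - (1 / d) *\<^sub>R (bcf_mult (bcf_mult (fst x) (bcf_cnj (fst x))) (fst h)
       + bcf_mult (bcf_mult (fst x) (bcf_cnj (fst h)) + bcf_mult (fst h) (bcf_cnj (fst x))) (fst x))
       = lle_rhs_deriv d \<zeta> \<omega> x h"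
      unfolding lle_rhs_deriv_apply by simp
  qed
  ultimately show ?thesis unfolding lle_rhs_def by simp
qed

definition lle_map :: "real \<Rightarrow> real \<Rightarrow> real \<Rightarrow> real \<Rightarrow> trace_space \<Rightarrow> h2per" where
  "lle_map d \<zeta> \<omega> f0 x = solve_bcf (lle_rhs d \<zeta> \<omega> f0 x)"

definition lle_map_deriv :: "real \<Rightarrow> real \<Rightarrow> real \<Rightarrow> trace_space \<Rightarrow> trace_space \<Rightarrow>\<^sub>L h2per" where
  "lle_map_deriv d \<zeta> \<omega> x = Blinfun solve_bcf o\<^sub>L lle_rhs_deriv d \<zeta> \<omega> x"

lemma lle_map_deriv_apply: "lle_map_deriv d \<zeta> \<omega> x h = solve_bcf (lle_rhs_deriv d \<zeta> \<omega> x h)"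
  by (simp add: lle_map_deriv_def bounded_linear_Blinfun_apply bounded_linear_solve_bcf)

lemma lle_map_has_derivative: "(lle_map d \<zeta> \<omega> f0 has_derivative lle_map_deriv d \<zeta> \<omega> x) (at x)"
  unfolding lle_map_def lle_map_deriv_apply[abs_def]
  by (rule bounded_linear.has_derivative[OF bounded_linear_solve_bcf lle_rhs_has_derivative])

lemma lle_map_Ck:
  assumes "Ck_curve k T x"
  shows "Ck_curve k T (\<lambda>t. lle_map d \<zeta> \<omega> f0 (x t))"
proof -
  have f: "Ck_curve k T (\<lambda>t. fst (x t))" by (rule Ck_curve_linear[OF bounded_linear_fst assms])
  have c: "Ck_curve k T (\<lambda>t. bcf_cnj (fst (x t)))" by (rule Ck_curve_linear[OF bounded_linear_bcf_cnj f])
  have "Ck_curve k T (\<lambda>t. (lle_linear d \<zeta> \<omega> (x t) + const_bcontfun (\<i> * of_real f0 / of_real d))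
     + (- (1 / d)) *\<^sub>R bcf_mult (bcf_mult (fst (x t)) (bcf_cnj (fst (x t)))) (fst (x t)))"
    by (intro Ck_curve_add Ck_curve_const Ck_curve_linear[OF bounded_linear_lle_linear assms]
        Ck_curve_linear[OF bounded_linear_scaleR_right] Ck_curve_bilinear[OF bounded_bilinear_bcf_mult] f c)
  then have "Ck_curve k T (\<lambda>t. lle_rhs d \<zeta> \<omega> f0 (x t))" by (simp add: lle_rhs_def)
  then show ?thesis unfolding lle_map_def by (rule Ck_curve_linear[OF bounded_linear_solve_bcf])
qed

lemmas compose_solve_linear =
  bounded_bilinear.bounded_linear_right[OF bounded_bilinear_blinfun_compose]

lemma lle_map_deriv_Ck:
  assumes "Ck_curve k T x"
  shows "Ck_curve k T (\<lambda>t. lle_map_deriv d \<zeta> \<omega> (x t))"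
proof -
  have f: "Ck_curve k T (\<lambda>t. fst (x t))" by (rule Ck_curve_linear[OF bounded_linear_fst assms])
  have c: "Ck_curve k T (\<lambda>t. bcf_cnj (fst (x t)))" by (rule Ck_curve_linear[OF bounded_linear_bcf_cnj f])
  show ?thesis
    unfolding lle_map_deriv_def lle_rhs_deriv_def
    by (rule Ck_curve_linear[OF compose_solve_linear])
      (intro Ck_curve_add Ck_curve_const Ck_curve_linear[OF bounded_linear_scaleR_right]
        Ck_curve_linear[OF bounded_linear_Blinfun_bilinear[OF bilinear_mult_fst]]
        Ck_curve_linear[OF bounded_linear_Blinfun_bilinear[OF bilinear_mult_cnj_fst]]
        Ck_curve_bilinear[OF bounded_bilinear_bcf_mult] f c)
qed

lemma lle_map_deriv_continuous: "continuous_on UNIV (lle_map_deriv d \<zeta> \<omega>)"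
proof -
  have f: "continuous_on UNIV (\<lambda>x :: trace_space. fst x)" by (intro continuous_intros)
  have c: "continuous_on UNIV (\<lambda>x :: trace_space. bcf_cnj (fst x))"
    by (rule bounded_linear.continuous_on[OF bounded_linear_bcf_cnj f])
  show ?thesis
    unfolding lle_map_deriv_def lle_rhs_deriv_def
    by (rule bounded_linear.continuous_on[OF compose_solve_linear])
      (intro continuous_on_add continuous_on_const continuous_on_scaleR
        bounded_linear.continuous_on[OF bounded_linear_Blinfun_bilinear[OF bilinear_mult_fst]]
        bounded_linear.continuous_on[OF bounded_linear_Blinfun_bilinear[OF bilinear_mult_cnj_fst]]
        bounded_bilinear.continuous_on[OF bounded_bilinear_bcf_mult] f c)
qed

lemma lle_map_bounded:
  assumes "bounded S"
  shows "bounded (lle_map d \<zeta> \<omega> f0 ` S)"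
proof -
  let ?c = "const_bcontfun (\<i> * of_real f0 / of_real d) :: real \<Rightarrow>\<^sub>C complex"
  obtain B where B: "\<And>x. x \<in> S \<Longrightarrow> norm x \<le> B" using assms by (auto simp: bounded_iff)
  obtain K where K: "K \<ge> 0" "\<And>x. norm (lle_linear d \<zeta> \<omega> x) \<le> norm x * K"
    using bounded_linear.nonneg_bounded[OF bounded_linear_lle_linear] by blast
  have "norm (lle_rhs d \<zeta> \<omega> f0 x) \<le> B * K + norm ?c + \<bar>1 / d\<bar> * (B * B * B)" if x: "x \<in> S" for x
  proof -
    let ?q = "bcf_mult (bcf_mult (fst x) (bcf_cnj (fst x))) (fst x)"
    have f: "norm (fst x) \<le> B" using norm_fst_le[of "fst x" "snd x"] B[OF x] by simp
    then have B0: "0 \<le> B" using norm_ge_zero order_trans by blast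
    have g: "norm (bcf_cnj (fst x)) \<le> B" by (rule norm_bound) (simp add: order_trans[OF norm_bounded f])
    have "norm (bcf_mult (fst x) (bcf_cnj (fst x))) \<le> B * B"
      by (rule order_trans[OF norm_bcf_mult mult_mono[OF f g]]) (use B0 in auto)
    then have q: "norm ?q \<le> B * B * B"
      by (rule order_trans[OF norm_bcf_mult mult_mono[OF _ f]]) (use B0 in auto)
    have "norm (lle_rhs d \<zeta> \<omega> f0 x) \<le> norm (lle_linear d \<zeta> \<omega> x) + norm ?c + norm ((1 / d) *\<^sub>R ?q)"
      unfolding lle_rhs_def by (rule order_trans[OF norm_triangle_ineq4 add_right_mono[OF norm_triangle_ineq]])
    also have "\<dots> \<le> B * K + norm ?c + \<bar>1 / d\<bar> * (B * B * B)"
      unfolding norm_scaleR using q K order_trans[OF K(2) mult_right_mono[OF B[OF x] K(1)]]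
      by (intro add_mono mult_left_mono) auto
    finally show ?thesis .
  qed
  then have "bounded (lle_rhs d \<zeta> \<omega> f0 ` S)" unfolding bounded_iff by blast
  then have "bounded (solve_bcf ` (lle_rhs d \<zeta> \<omega> f0 ` S))"
    by (rule bounded_linear_image[OF _ bounded_linear_solve_bcf])
  then show ?thesis by (simp add: lle_map_def image_image)
qed

lemma mean_clamped: "continuous_on {0..2 * pi} h \<Longrightarrow> mean (clamped h) = mean h"
  unfolding mean_def by (rule arg_cong[where f = "\<lambda>z. z /\<^sub>R (2 * pi)"], rule integral_cong)
    (auto simp: clamped_apply)

lemma periodic_extension_lle_rhs:
  "periodic_extension (lle_rhs d \<zeta> \<omega> f0 (h2_trace u))
    = (\<lambda>s. (\<i> * of_real \<omega> * h2_slope u s + (of_real \<zeta> - \<i>) * h2_value u s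
        - of_real ((cmod (h2_value u s))\<^sup>2) * h2_value u s + \<i> * of_real f0) / of_real d - mean (h2_value u))"
proof (rule periodic_eqI)
  fix s assume s: "0 \<le> s" "s < 2 * pi"
  then have cl: "clamped (h2_value u) s = h2_value u s" "clamped (h2_slope u) s = h2_slope u s"
    by (simp_all add: clamped_apply h2_value_continuous h2_slope_continuous)
  have sq: "complex_of_real ((cmod (h2_value u s))\<^sup>2) = h2_value u s * cnj (h2_value u s)"
    by (rule complex_norm_square)
  show "periodic_extension (lle_rhs d \<zeta> \<omega> f0 (h2_trace u)) s
    = (\<i> * of_real \<omega> * h2_slope u s + (of_real \<zeta> - \<i>) * h2_value u s
        - of_real ((cmod (h2_value u s))\<^sup>2) * h2_value u s + \<i> * of_real f0) / of_real d - mean (h2_value u)"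
    unfolding sq periodic_extension_eq[OF s] lle_rhs_def lle_linear_def h2_trace_def
    by (simp add: cl mean_clamped h2_value_continuous scaleR_conv_of_real diff_divide_distrib add_divide_distrib left_diff_distrib)
qed (simp_all add: periodic_extension_periodic h2_value_periodic h2_slope_periodic)

lemma periodic_extension_lle_rhs_deriv:
  "periodic_extension (lle_rhs_deriv d \<zeta> \<omega> (h2_trace u) (h2_trace \<phi>))
    = (\<lambda>s. (\<i> * of_real \<omega> * h2_slope \<phi> s + (of_real \<zeta> - \<i> - 2 * of_real ((cmod (h2_value u s))\<^sup>2)) * h2_value \<phi> s
        - (h2_value u s)\<^sup>2 * cnj (h2_value \<phi> s)) / of_real d - mean (h2_value \<phi>))"
proof (rule periodic_eqI)
  fix s assume s: "0 \<le> s" "s < 2 * pi"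
  then have cl: "clamped (h2_value w) s = h2_value w s" "clamped (h2_slope w) s = h2_slope w s" for w
    by (simp_all add: clamped_apply h2_value_continuous h2_slope_continuous)
  have sq: "complex_of_real ((cmod (h2_value u s))\<^sup>2) = h2_value u s * cnj (h2_value u s)"
    by (rule complex_norm_square)
  show "periodic_extension (lle_rhs_deriv d \<zeta> \<omega> (h2_trace u) (h2_trace \<phi>)) s
    = (\<i> * of_real \<omega> * h2_slope \<phi> s + (of_real \<zeta> - \<i> - 2 * of_real ((cmod (h2_value u s))\<^sup>2)) * h2_value \<phi> s
        - (h2_value u s)\<^sup>2 * cnj (h2_value \<phi> s)) / of_real d - mean (h2_value \<phi>)"
    unfolding sq periodic_extension_eq[OF s] lle_rhs_deriv_apply lle_linear_def h2_trace_def
    by (simp add: cl mean_clamped h2_value_continuous scaleR_conv_of_real power2_eq_square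
        diff_divide_distrib add_divide_distrib left_diff_distrib)
qed (simp_all add: periodic_extension_periodic h2_value_periodic h2_slope_periodic)

lemma solve_bcf_eq_iff:
  "u = solve_bcf f \<longleftrightarrow> (AE s in lebesgue. H2per_deriv 2 u s - mean (h2_value u) = periodic_extension f s)"
  using solve_bcf[of f] solve(3)[OF bcf_periodic_extension periodic_extension_periodic, of u f]
  unfolding solve_bcf_def[symmetric] by blast

text \<open>A fixed point of the linearized map lies in the kernel of the linearization, which is spanned by the
  derivative of the constant \<open>u0\<close>, that is, by \<open>0\<close>.\<close>

lemma nondegenerate_constant:
  assumes d: "d \<noteq> 0" and nd: "nondegenerate d \<zeta> \<omega> (const_h2per u0)"
    and \<phi>: "lle_map_deriv d \<zeta> \<omega> (h2_trace (const_h2per u0)) (h2_trace \<phi>) = \<phi>"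
  shows "\<phi> = 0"
proof -
  let ?u = "const_h2per u0"
  have rep: "AE x in lebesgue. rep_h2per ?u x = u0"
    unfolding const_h2per.abs_eq by (rule rep_abs_h2per[OF H2per_funs_const])
  obtain w where w: "AE s in lebesgue. rep_h2per w s = H2per_deriv 1 ?u s"
    "{\<phi>. AE s in lebesgue. LLE_linearization d \<zeta> \<omega> ?u \<phi> s = 0} = span {w}"
    using nd by (auto simp: nondegenerate_def)
  have "AE s in lebesgue. H2per_deriv 1 ?u s = 0"
    by (rule H2per_deriv_AE_eqI[OF _ locally_square_integrable_const locally_square_integrable_const rep
          has_weak_deriv_on_const]) auto
  then have "AE s in lebesgue. rep_h2per w s = rep_h2per 0 s"
    using w(1) rep_h2per_zero by eventually_elim simp
  then have "w = 0" by (rule h2per_eqI)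
  have "AE s in lebesgue. H2per_deriv 2 \<phi> s - mean (h2_value \<phi>)
      = periodic_extension (lle_rhs_deriv d \<zeta> \<omega> (h2_trace ?u) (h2_trace \<phi>)) s"
    using \<phi> unfolding lle_map_deriv_apply by (subst solve_bcf_eq_iff[symmetric]) simp
  then have "AE s in lebesgue. LLE_linearization d \<zeta> \<omega> ?u \<phi> s = 0"
    using h2_value_AE[of \<phi>] h2_slope_AE[of \<phi>] h2_value_AE[of ?u]
    unfolding periodic_extension_lle_rhs_deriv
  proof eventually_elim
    case (elim s)
    have "of_real d * H2per_deriv 2 \<phi> s = \<i> * of_real \<omega> * h2_slope \<phi> s
        + (of_real \<zeta> - \<i> - 2 * of_real ((cmod (h2_value ?u s))\<^sup>2)) * h2_value \<phi> s
        - (h2_value ?u s)\<^sup>2 * cnj (h2_value \<phi> s)"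
      using elim(1) d by (simp add: field_simps)
    then show ?case unfolding LLE_linearization_def elim(2-4) by simp
  qed
  then have "\<phi> \<in> span {w}" unfolding w(2)[symmetric] by simp
  then show ?thesis by (simp add: \<open>w = 0\<close>)
qed

definition lle_forcing :: "real \<Rightarrow> (real \<Rightarrow> complex) \<Rightarrow> h2per" where
  "lle_forcing d e = solve (\<lambda>s. \<i> / of_real d * periodic_extension e s)"

lemma H2_funs_periodic_extension:
  assumes "e \<in> H2_funs"
  shows "locally_square_integrable (periodic_extension e)"
  using assms by (intro periodic_extension_locally_square_integrable) (simp add: H2_funs_def)

lemma locally_square_integrable_mult_const:
  assumes "locally_square_integrable f"
  shows "locally_square_integrable (\<lambda>x. c * f x)"
proof -
  have "f integrable_on {a..b}" "(\<lambda>x. cmod (f x)) integrable_on {a..b}" for a b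
    using locally_square_integrable_imp_locally_integrable[OF assms] by (auto dest: locally_integrableD)
  then show ?thesis
    by (intro locally_square_integrable_HK)
      (simp_all add: norm_mult power_mult_distrib integrable_on_mult_right energy_integrable[OF assms])
qed

text \<open>The first form is the fixed point equation. The second one is the equation in terms of the continuous representatives and feeds \<open>a_priori_bound\<close>.\<close>

lemma LLE_solutions_iff:
  assumes d: "d \<noteq> 0" and e: "e \<in> H2_funs"
  shows "(t, u) \<in> LLE_solutions d \<zeta> \<omega> f0 e \<longleftrightarrow> u = t *\<^sub>R lle_forcing d e + lle_map d \<zeta> \<omega> f0 (h2_trace u)"
    and "(t, u) \<in> LLE_solutions d \<zeta> \<omega> f0 e \<longleftrightarrow> (AE s in lebesgue. of_real d * H2per_deriv 2 u s
      = \<i> * of_real \<omega> * h2_slope u s + (of_real \<zeta> - \<i>) * h2_value u s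
        - of_real ((cmod (h2_value u s))\<^sup>2) * h2_value u s
        + (\<i> * of_real f0 + (\<i> * of_real t) * periodic_extension e s))"
proof -
  let ?R = "\<lambda>s. \<i> * of_real \<omega> * h2_slope u s + (of_real \<zeta> - \<i>) * h2_value u s
        - of_real ((cmod (h2_value u s))\<^sup>2) * h2_value u s"
  let ?P = "AE s in lebesgue. of_real d * H2per_deriv 2 u s
      = ?R s + (\<i> * of_real f0 + (\<i> * of_real t) * periodic_extension e s)"
  have "(t, u) \<in> LLE_solutions d \<zeta> \<omega> f0 e \<longleftrightarrow> (AE s in lebesgue.
     - of_real d * H2per_deriv 2 u s + \<i> * of_real \<omega> * H2per_deriv 1 u s
     + (of_real \<zeta> - \<i>) * rep_h2per u s - of_real ((cmod (rep_h2per u s))\<^sup>2) * rep_h2per u s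
     + \<i> * of_real f0 + \<i> * of_real t * periodic_extension e s = 0)"
    by (simp add: LLE_solutions_def)
  also have "\<dots> \<longleftrightarrow> ?P"
  proof
    assume "AE s in lebesgue. - of_real d * H2per_deriv 2 u s + \<i> * of_real \<omega> * H2per_deriv 1 u s
     + (of_real \<zeta> - \<i>) * rep_h2per u s - of_real ((cmod (rep_h2per u s))\<^sup>2) * rep_h2per u s
     + \<i> * of_real f0 + \<i> * of_real t * periodic_extension e s = 0"
    then show ?P using h2_value_AE[of u] h2_slope_AE[of u]
    proof eventually_elim
      case (elim s)
      then show ?case by (simp add: add_eq_0_iff algebra_simps)
    qed
  next
    assume ?P
    then show "AE s in lebesgue. - of_real d * H2per_deriv 2 u s + \<i> * of_real \<omega> * H2per_deriv 1 u s
     + (of_real \<zeta> - \<i>) * rep_h2per u s - of_real ((cmod (rep_h2per u s))\<^sup>2) * rep_h2per u s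
     + \<i> * of_real f0 + \<i> * of_real t * periodic_extension e s = 0"
      using h2_value_AE[of u] h2_slope_AE[of u]
    proof eventually_elim
      case (elim s)
      show ?case unfolding mult_minus_left elim by (simp add: algebra_simps)
    qed
  qed
  finally show P: "(t, u) \<in> LLE_solutions d \<zeta> \<omega> f0 e \<longleftrightarrow> ?P" .
  have "AE s in lebesgue. H2per_deriv 2 (lle_forcing d e) s - mean (h2_value (lle_forcing d e))
      = \<i> / of_real d * periodic_extension e s"
    unfolding lle_forcing_def
    by (rule solve(1)[OF locally_square_integrable_mult_const[OF H2_funs_periodic_extension[OF e]]])
      (simp add: periodic_extension_periodic)
  note comb = h2_deriv_minus_mean_combination[OF solve_bcf this, of "lle_rhs d \<zeta> \<omega> f0 (h2_trace u)" t]
  let ?v = "solve_bcf (lle_rhs d \<zeta> \<omega> f0 (h2_trace u)) + t *\<^sub>R lle_forcing d e"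
  have comb': "AE s in lebesgue. of_real d * (H2per_deriv 2 ?v s - mean (h2_value ?v) + mean (h2_value u))
      = ?R s + (\<i> * of_real f0 + (\<i> * of_real t) * periodic_extension e s)"
    using comb unfolding periodic_extension_lle_rhs
  proof eventually_elim
    case (elim s)
    then show ?case using d by (simp add: scaleR_conv_of_real field_simps)
  qed
  have "?P \<longleftrightarrow> u = ?v"
  proof
    assume ?P
    then have "AE s in lebesgue. H2per_deriv 2 u s - mean (h2_value u) = H2per_deriv 2 ?v s - mean (h2_value ?v)"
      using comb'
    proof eventually_elim
      case (elim s)
      then have "of_real d * H2per_deriv 2 u s = of_real d * (H2per_deriv 2 ?v s - mean (h2_value ?v) + mean (h2_value u))"
        by simp
      then have "H2per_deriv 2 u s = H2per_deriv 2 ?v s - mean (h2_value ?v) + mean (h2_value u)"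
        using d by (simp only: mult_cancel_left of_real_eq_0_iff simp_thms)
      then show ?case by simp
    qed
    then show "u = ?v" by (rule h2per_eq_if_deriv_minus_mean_eq)
  next
    assume "u = ?v"
    then show ?P using comb' by (simp only: diff_add_cancel)
  qed
  then show "(t, u) \<in> LLE_solutions d \<zeta> \<omega> f0 e \<longleftrightarrow> u = t *\<^sub>R lle_forcing d e + lle_map d \<zeta> \<omega> f0 (h2_trace u)"
    unfolding P lle_map_def by (simp only: add.commute)
qed

lemma LLE_solutions_a_priori:
  assumes d: "d \<noteq> 0" and e: "e \<in> H2_funs"
  shows "bounded {(t, u). \<bar>t\<bar> \<le> R \<and> (t, u) \<in> LLE_solutions d \<zeta> \<omega> f0 e}"
proof -
  have p: "locally_square_integrable (periodic_extension e)" by (rule H2_funs_periodic_extension[OF e])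
  let ?F = "\<lambda>t s. \<i> * of_real f0 + (\<i> * of_real t) * periodic_extension e s"
  have F: "locally_square_integrable (?F t)" for t
    by (intro locally_square_integrable_add locally_square_integrable_const locally_square_integrable_mult_const p)
  define E where "E = integral {0..2 * pi} (\<lambda>s. 2 * f0\<^sup>2 + 2 * R\<^sup>2 * (cmod (periodic_extension e s))\<^sup>2)"
  have i: "(\<lambda>s. 2 * f0\<^sup>2 + 2 * R\<^sup>2 * (cmod (periodic_extension e s))\<^sup>2) integrable_on {0..2 * pi}"
    by (intro integrable_add integrable_on_mult_right energy_integrable p) auto
  have FE: "energy (?F t) \<le> E" if t: "\<bar>t\<bar> \<le> R" for t
    unfolding energy_def E_def
  proof (rule integral_le[OF energy_integrable[OF F] i])
    fix s
    have "cmod (?F t s) \<le> \<bar>f0\<bar> + \<bar>t\<bar> * cmod (periodic_extension e s)"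
      using norm_triangle_ineq[of "\<i> * of_real f0" "(\<i> * of_real t) * periodic_extension e s"] by (simp add: norm_mult)
    also have "\<dots> \<le> \<bar>f0\<bar> + R * cmod (periodic_extension e s)" using t by (intro add_left_mono mult_right_mono) auto
    finally have "(cmod (?F t s))\<^sup>2 \<le> (\<bar>f0\<bar> + R * cmod (periodic_extension e s))\<^sup>2" by (intro power_mono) auto
    also have "\<dots> \<le> 2 * f0\<^sup>2 + 2 * R\<^sup>2 * (cmod (periodic_extension e s))\<^sup>2"
      using zero_le_power2[of "\<bar>f0\<bar> - R * cmod (periodic_extension e s)"]
      by (simp add: power2_sum power2_diff power_mult_distrib)
    finally show "(cmod (?F t s))\<^sup>2 \<le> 2 * f0\<^sup>2 + 2 * R\<^sup>2 * (cmod (periodic_extension e s))\<^sup>2" .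
  qed
  have "0 \<le> E" unfolding E_def by (rule integral_nonneg[OF i]) simp
  then obtain K where K: "\<And>F a b D. lle_profile d \<zeta> \<omega> F a b D \<Longrightarrow> energy F \<le> E \<Longrightarrow> energy a + energy b + energy D \<le> K"
    using a_priori_bound[OF d] by blast
  have "norm u \<le> sqrt K" if "\<bar>t\<bar> \<le> R" "(t, u) \<in> LLE_solutions d \<zeta> \<omega> f0 e" for t u
  proof -
    have "lle_profile d \<zeta> \<omega> (?F t) (h2_value u) (h2_slope u) (H2per_deriv 2 u)"
      unfolding lle_profile_def
      using h2_value_has_vector_derivative h2_slope_continuous h2_slope_combine h2_value_periodic[of u 0]
        h2_slope_periodic[of u 0] H2per_deriv_locally_square_integrable(2) F
        that(2)[unfolded LLE_solutions_iff(2)[OF d e]] by simp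
    from K[OF this FE[OF that(1)]] show ?thesis
      unfolding norm_h2per_energy[symmetric] by (rule real_le_rsqrt)
  qed
  then have "norm p \<le> \<bar>R\<bar> + sqrt K" if "p \<in> {(t, u). \<bar>t\<bar> \<le> R \<and> (t, u) \<in> LLE_solutions d \<zeta> \<omega> f0 e}" for p
    using that norm_Pair_le[of "fst p" "snd p"] by (force simp: case_prod_unfold)
  then show ?thesis unfolding bounded_iff by blast
qed

text \<open>The sign \<open>\<sigma>\<close> multiplies the parameter, which amounts to replacing the forcing \<open>E\<close> by \<open>\<sigma> E\<close>; \<open>\<sigma> = - 1\<close>
  serves the continuum over the negative half-axis.\<close>

theorem lle_continuum_alternative:
  fixes \<sigma> :: real
  assumes d: "d \<noteq> 0" and e: "e \<in> H2_funs" and \<sigma>: "\<bar>\<sigma>\<bar> = 1"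
    and sol: "(0, const_h2per u0) \<in> LLE_solutions d \<zeta> \<omega> f0 e"
    and nd: "nondegenerate d \<zeta> \<omega> (const_h2per u0)"
  shows "continuum_alternative {(t, u). (\<sigma> * t, u) \<in> LLE_solutions d \<zeta> \<omega> f0 e} (const_h2per u0)"
proof -
  note iff = LLE_solutions_iff(1)[OF d e]
  have iff': "(\<sigma> * t, u) \<in> LLE_solutions d \<zeta> \<omega> f0 e
      \<longleftrightarrow> u = t *\<^sub>R (\<sigma> *\<^sub>R lle_forcing d e) + lle_map d \<zeta> \<omega> f0 (h2_trace u)" for t u
    unfolding iff scaleR_scaleR by (simp only: mult.commute)
  have bd: "bounded {(t, u). \<bar>t\<bar> \<le> R \<and> u = t *\<^sub>R (\<sigma> *\<^sub>R lle_forcing d e) + lle_map d \<zeta> \<omega> f0 (h2_trace u)}" for R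
  proof -
    obtain B where B: "\<And>t u. \<bar>t\<bar> \<le> R \<Longrightarrow> (t, u) \<in> LLE_solutions d \<zeta> \<omega> f0 e \<Longrightarrow> norm (t, u) \<le> B"
      using LLE_solutions_a_priori[OF d e, of R \<zeta> \<omega> f0] unfolding bounded_iff by auto
    have "norm (t, u) \<le> B" if "\<bar>t\<bar> \<le> R" "(\<sigma> * t, u) \<in> LLE_solutions d \<zeta> \<omega> f0 e" for t u
      using B[of "\<sigma> * t" u] that \<sigma> by (simp add: norm_prod_def abs_mult)
    then show ?thesis unfolding bounded_iff iff'[symmetric] by auto
  qed
  have cp: "continuation_problem h2_trace (lle_map d \<zeta> \<omega> f0) (lle_map_deriv d \<zeta> \<omega>) (\<sigma> *\<^sub>R lle_forcing d e) (const_h2per u0)"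
  proof (rule continuation_problem.intro)
    show "lle_map d \<zeta> \<omega> f0 (h2_trace (const_h2per u0)) = const_h2per u0"
      using sol unfolding iff by simp
  qed (fact bounded_linear_h2_trace compact_map_h2_trace lle_map_has_derivative lle_map_deriv_continuous lle_map_Ck
      lle_map_deriv_Ck lle_map_bounded nondegenerate_constant[OF d nd] bd)+
  have "continuation_problem.solutions h2_trace (lle_map d \<zeta> \<omega> f0) (\<sigma> *\<^sub>R lle_forcing d e)
      = {(t, u). (\<sigma> * t, u) \<in> LLE_solutions d \<zeta> \<omega> f0 e}"
    unfolding iff' by (rule continuation_problem.solutions_def[OF cp])
  then show ?thesis using continuation_problem.continuation[OF cp] by simp
qed

section \<open>Reflection of the parameter and the two continua\<close>

lemma smooth_curve_on_reflect:
  assumes "smooth_curve_on T g"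
  shows "smooth_curve_on (uminus ` T) (\<lambda>t. g (- t))"
proof -
  obtain D where D: "\<And>t. t \<in> T \<Longrightarrow> D 0 t = g t"
    "\<And>k t. t \<in> T \<Longrightarrow> (D k has_vector_derivative D (Suc k) t) (at t within T)"
    using assms unfolding smooth_curve_on_def by blast
  show ?thesis
    unfolding smooth_curve_on_def
  proof (intro exI[of _ "\<lambda>k t. (- 1) ^ k *\<^sub>R D k (- t)"] conjI ballI allI)
    fix t assume t: "t \<in> uminus ` T"
    then show "(- 1) ^ 0 *\<^sub>R D 0 (- t) = g (- t)" using D(1) by auto
    have T: "uminus ` uminus ` T = T" by (simp add: image_image)
    fix k
    have "(D k has_vector_derivative D (Suc k) (- t)) (at (- t) within uminus ` uminus ` T)"
      unfolding T using t by (intro D(2)) auto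
    moreover have "(uminus has_vector_derivative - 1) (at t within uminus ` T)"
      by (auto intro!: derivative_eq_intros)
    ultimately have "((D k \<circ> uminus) has_vector_derivative (- 1) *\<^sub>R D (Suc k) (- t)) (at t within uminus ` T)"
      by (intro vector_diff_chain_within)
    from bounded_linear.has_vector_derivative[OF bounded_linear_scaleR_right this]
    show "((\<lambda>t. (- 1) ^ k *\<^sub>R D k (- t)) has_vector_derivative (- 1) ^ Suc k *\<^sub>R D (Suc k) (- t)) (at t within uminus ` T)"
      by (rule back_subst[of "\<lambda>F. F"]) (simp add: o_def)
  qed
qed

text \<open>The reflection \<open>\<rho> (t, v) = (- t, v)\<close> is an isometric involution, so it carries closed, connected and bounded
  sets, maximality and the local graph from one half-space to the other.\<close>

lemma continuum_alternative_reflect: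
  fixes A :: "(real \<times> 'a::real_normed_vector) set"
  assumes "continuum_alternative {(t, u). (- 1 * t, u) \<in> A} u0"
  shows "\<exists>C. maximal_continuum (A \<inter> {..0} \<times> UNIV) (0, u0) C \<and>
        (\<exists>\<epsilon>>0. \<exists>U g. open U \<and> (0, u0) \<in> U \<and> smooth_curve_on {-\<epsilon><..0} g \<and>
           C \<inter> U = (\<lambda>t. (t, g t)) ` {-\<epsilon><..0}) \<and>
        (\<forall>M>0. bounded (C \<inter> {-M..0} \<times> UNIV)) \<and>
        (fst ` C = {..0} \<or> (\<exists>v. v \<noteq> u0 \<and> (0, v) \<in> C))"
proof -
  define \<rho> where "\<rho> = (\<lambda>p :: real \<times> 'a. (- fst p, snd p))"
  have inv: "\<rho> (\<rho> p) = p" and \<rho>0: "\<rho> (0, v) = (0, v)" for p v by (simp_all add: \<rho>_def)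
  have im: "\<rho> ` S = \<rho> -` S" for S
    using inv by (auto simp: image_iff) metis
  have cont: "continuous_on S \<rho>" for S unfolding \<rho>_def by (intro continuous_intros)
  have cl: "closed (\<rho> -` S)" if "closed S" for S
    using that by (rule closed_vimage[OF _ cont])
  have cn: "connected (\<rho> -` S)" if "connected S" for S
    unfolding im[symmetric] by (rule connected_continuous_image[OF cont that])
  have inv_vimage: "\<rho> -` \<rho> -` S = S" for S by (simp add: vimage_def inv)
  let ?B = "{(t, u). (- 1 * t, u) \<in> A} \<inter> {0..} \<times> UNIV"
  have AB: "\<rho> -` ?B = A \<inter> {..0} \<times> UNIV" "\<rho> -` (A \<inter> {..0} \<times> UNIV) = ?B"
    by (auto simp: \<rho>_def)
  obtain C \<epsilon> U g where C: "maximal_continuum ?B (0, u0) C"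
    and \<epsilon>: "\<epsilon> > 0" and U: "open U" "(0, u0) \<in> U" and g: "smooth_curve_on {0..<\<epsilon>} g"
    and CU: "C \<inter> U = (\<lambda>t. (t, g t)) ` {0..<\<epsilon>}"
    and bd: "\<And>M. M > 0 \<Longrightarrow> bounded (C \<inter> {0..M} \<times> UNIV)"
    and alt: "fst ` C = {0..} \<or> (\<exists>v. v \<noteq> u0 \<and> (0, v) \<in> C)"
    using assms unfolding continuum_alternative_def by blast
  note C = C[unfolded maximal_continuum_def]
  have max: "maximal_continuum (A \<inter> {..0} \<times> UNIV) (0, u0) (\<rho> -` C)"
    unfolding maximal_continuum_def
  proof (intro conjI allI impI)
    show "closed (\<rho> -` C)" "connected (\<rho> -` C)" "(0, u0) \<in> \<rho> -` C" using C cl cn \<rho>0 by auto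
    show "\<rho> -` C \<subseteq> A \<inter> {..0} \<times> UNIV" unfolding AB(1)[symmetric] using C by (intro vimage_mono) blast
    fix D assume D: "closed D \<and> connected D \<and> D \<subseteq> A \<inter> {..0} \<times> UNIV \<and> (0, u0) \<in> D"
    have "\<rho> -` D \<subseteq> ?B" unfolding AB(2)[symmetric] using D by (intro vimage_mono) blast
    then have "\<rho> -` D \<subseteq> C" using C cl[of D] cn[of D] D \<rho>0 by auto
    then have "\<rho> -` \<rho> -` D \<subseteq> \<rho> -` C" by (rule vimage_mono)
    then show "D \<subseteq> \<rho> -` C" unfolding inv_vimage .
  qed
  have um: "uminus ` {0..<\<epsilon>} = {-\<epsilon><..0}" by simp
  have curve: "smooth_curve_on {-\<epsilon><..0} (\<lambda>t. g (- t))"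
    using smooth_curve_on_reflect[OF g] unfolding um .
  have "\<rho> -` C \<inter> \<rho> -` U = \<rho> ` (\<lambda>t. (t, g t)) ` {0..<\<epsilon>}"
    unfolding vimage_Int[symmetric] CU im ..
  also have "\<dots> = (\<lambda>t. (t, g (- t))) ` uminus ` {0..<\<epsilon>}"
    unfolding image_image \<rho>_def by simp
  finally have graph: "\<rho> -` C \<inter> \<rho> -` U = (\<lambda>t. (t, g (- t))) ` {-\<epsilon><..0}" unfolding um .
  have openU: "open (\<rho> -` U)" by (rule open_vimage[OF U(1) cont])
  have bound: "bounded (\<rho> -` C \<inter> {-M..0} \<times> UNIV)" if M: "M > 0" for M
  proof -
    obtain K where K: "\<And>p. p \<in> C \<inter> {0..M} \<times> UNIV \<Longrightarrow> norm p \<le> K"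
      using bd[OF M] unfolding bounded_iff by blast
    have "norm p \<le> K" if "p \<in> \<rho> -` C \<inter> {-M..0} \<times> UNIV" for p
    proof -
      have "norm (\<rho> p) \<le> K" by (rule K) (use that in \<open>auto simp: \<rho>_def\<close>)
      then show ?thesis by (simp add: norm_prod_def \<rho>_def)
    qed
    then show ?thesis unfolding bounded_iff by blast
  qed
  have fst: "fst ` (\<rho> -` C) = uminus ` fst ` C"
    unfolding im[symmetric] image_image by (simp add: \<rho>_def)
  have "fst ` (\<rho> -` C) = {..0} \<or> (\<exists>v. v \<noteq> u0 \<and> (0, v) \<in> \<rho> -` C)"
    using alt unfolding fst by (elim disjE) (simp_all add: \<rho>0)
  moreover have "(0, u0) \<in> \<rho> -` U" using U \<rho>0 by simp
  ultimately show ?thesis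
    using max \<epsilon> openU curve graph bound
    by (intro exI[of _ "\<rho> -` C"] conjI exI[of _ \<epsilon>] exI[of _ "\<rho> -` U"] exI[of _ "\<lambda>t. g (- t)"] allI impI)
qed

theorem theorem6:
  fixes d \<zeta> \<omega> f0 :: real and e :: "real \<Rightarrow> complex" and u0 :: complex
  assumes "d \<noteq> 0"
    and "e \<in> H2_funs"
    and "(0, const_h2per u0) \<in> LLE_solutions d \<zeta> \<omega> f0 e"
    and "nondegenerate d \<zeta> \<omega> (const_h2per u0)"
  shows
    "(\<exists>C. maximal_continuum (LLE_solutions d \<zeta> \<omega> f0 e \<inter> {0..} \<times> UNIV) (0, const_h2per u0) C \<and>
        (\<exists>\<epsilon>>0. \<exists>U g. open U \<and> (0, const_h2per u0) \<in> U \<and> smooth_curve_on {0..<\<epsilon>} g \<and>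
           C \<inter> U = (\<lambda>f1. (f1, g f1)) ` {0..<\<epsilon>}) \<and>
        (\<forall>M>0. bounded (C \<inter> {0..M} \<times> UNIV)) \<and>
        (fst ` C = {0..} \<or> (\<exists>v. v \<noteq> const_h2per u0 \<and> (0, v) \<in> C))) \<and>
     (\<exists>C. maximal_continuum (LLE_solutions d \<zeta> \<omega> f0 e \<inter> {..0} \<times> UNIV) (0, const_h2per u0) C \<and>
        (\<exists>\<epsilon>>0. \<exists>U g. open U \<and> (0, const_h2per u0) \<in> U \<and> smooth_curve_on {-\<epsilon><..0} g \<and>
           C \<inter> U = (\<lambda>f1. (f1, g f1)) ` {-\<epsilon><..0}) \<and>
        (\<forall>M>0. bounded (C \<inter> {-M..0} \<times> UNIV)) \<and>
        (fst ` C = {..0} \<or> (\<exists>v. v \<noteq> const_h2per u0 \<and> (0, v) \<in> C)))"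
proof
  note alternative = lle_continuum_alternative[OF assms(1,2) _ assms(3,4)]
  have "continuum_alternative (LLE_solutions d \<zeta> \<omega> f0 e) (const_h2per u0)"
    using alternative[of 1] by simp
  then show "\<exists>C. maximal_continuum (LLE_solutions d \<zeta> \<omega> f0 e \<inter> {0..} \<times> UNIV) (0, const_h2per u0) C \<and>
        (\<exists>\<epsilon>>0. \<exists>U g. open U \<and> (0, const_h2per u0) \<in> U \<and> smooth_curve_on {0..<\<epsilon>} g \<and>
           C \<inter> U = (\<lambda>f1. (f1, g f1)) ` {0..<\<epsilon>}) \<and>
        (\<forall>M>0. bounded (C \<inter> {0..M} \<times> UNIV)) \<and>
        (fst ` C = {0..} \<or> (\<exists>v. v \<noteq> const_h2per u0 \<and> (0, v) \<in> C))"
    unfolding continuum_alternative_def .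
  show "\<exists>C. maximal_continuum (LLE_solutions d \<zeta> \<omega> f0 e \<inter> {..0} \<times> UNIV) (0, const_h2per u0) C \<and>
        (\<exists>\<epsilon>>0. \<exists>U g. open U \<and> (0, const_h2per u0) \<in> U \<and> smooth_curve_on {-\<epsilon><..0} g \<and>
           C \<inter> U = (\<lambda>f1. (f1, g f1)) ` {-\<epsilon><..0}) \<and>
        (\<forall>M>0. bounded (C \<inter> {-M..0} \<times> UNIV)) \<and>
        (fst ` C = {..0} \<or> (\<exists>v. v \<noteq> const_h2per u0 \<and> (0, v) \<in> C))"
    by (rule continuum_alternative_reflect[OF alternative[of "- 1"]]) simp
qed

end
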